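(* Let $\Omega\subset\mathbb R^{\mathrm d}$, $\mathrm d\in\{1,2\}$, be a bounded open set, $X=H_0^1(\Omega)$, and let $\varphi:\Omega\to\mathbb R$ be measurable with $\varphi\ge\nu$ a.e. in $\Omega$ for some constant $\nu>0$. Let $\mathrm D_\mu$ be a linear operator that is bounded from $L^p(\Omega)$ to $L^p(\Omega)^{\mathrm d}$ for every $1\le p\le\infty$. For $\mathrm D\in\{\nabla,\mathrm D_\mu\}$ define $\mathcal P^{\mathrm D}:X\to X'$ by $$\langle\mathcal P^{\mathrm D}(u),w\rangle=\int_{\Omega^+(u)}(|\mathrm Du|-\varphi)^{\pm}\,\frac{\mathrm Du\cdot\mathrm Dw}{|\mathrm Du|}\,\mathrm dx,\qquad \Omega^+(u)=\{x\in\Omega:|\mathrm Du(x)|>0\}.$$ Then $\mathcal P^{\nabla}$, regarded as a map $X\to(W_0^{1,\infty}(\Omega))'$, and $\mathcal P^{\mathrm D_\mu}$, regarded as a map $X\to X'$, are Newton differentiable. In both cases a Newton derivative $G_{\mathcal P}$ is given by $$\langle G_{\mathcal P}(u)v,w\rangle=\int_{\Omega^+(u)}\big(G_P(\mathrm Du)\,\mathrm Dv\big)\cdot\mathrm Dw\,\mathrm dx,$$ (i) for all $u,v\in X$ and $w\in W_0^{1,\infty}(\Omega)$, with the duality pairing between $(W_0^{1,\infty}(\Omega))'$ and $W_0^{1,\infty}(\Omega)$, in the case $\mathrm D=\nabla$, $\mathcal P=\mathcal P^\nabla$; (ii) for all $u,v,w\in X$, with the duality pairing between $X'$ and $X$,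 in the case $\mathrm D=\mathrm D_\mu$, $\mathcal P=\mathcal P^{\mathrm D_\mu}$. Here, for a measurable $y:\Omega\to\mathbb R^{\mathrm d}$, $G_P(y)$ is the matrix-valued function equal, at points with $y(x)\ne0$, to $$G_P(y)(x)=\chi_{(0,1)}(|y(x)|-\varphi(x))\,\frac{y(x)y(x)^T}{|y(x)|^2}+(|y(x)|-\varphi(x))^\pm\,\frac1{|y(x)|}\Big(\mathrm{id}-\frac{y(x)y(x)^T}{|y(x)|^2}\Big).$$
   Context: $(t)^\pm:=\min(1,\max(0,t))$ for $t\in\mathbb R$, applied pointwise. $\chi_{(0,1)}$ is the indicator function of the interval $(0,1)$. $\nabla$ is the weak gradient; $W_0^{1,\infty}(\Omega)=W^{1,\infty}(\Omega)\cap H_0^1(\Omega)$ with the $W^{1,\infty}$ norm. Primes on spaces denote topological duals. The operator $\mathrm D_\mu$ ($\mu>0$ a fixed parameter) is meant as an approximation of the gradient; only the stated boundedness is assumed. Newton differentiability: for real Banach spaces $V,Z$ and $D\subset V$ open, a map $F:D\to Z$ is Newton differentiable at $u\in D$ if there are an open neighborhood $\mathcal N(u)\subset D$ of $u$ and a map $G_F:\mathcal N(u)\to\mathcal L(V,Z)$ (bounded linear operators) with $$\lim_{\|h\|_V\to0}\frac{\|F(u+h)-F(u)-G_F(u+h)h\|_Z}{\|h\|_V}=0.$$ $F$ is Newton differentiable with Newton derivative $G_F:D\to\mathcal L(V,Z)$ if this limit relation holds at every $u\in D$. Newton derivatives are in general not unique. *)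

theory Defs
  imports
    "HOL-Analysis.Analysis"
    "HOL-Probability.Essential_Supremum"
    "HOL-Library.Function_Algebras"
begin

section \<open>Pointwise real vector space structure on functions\<close>

instantiation "fun" :: (type, real_vector) real_vector
begin

definition scaleR_fun :: "real \<Rightarrow> ('a \<Rightarrow> 'b) \<Rightarrow> 'a \<Rightarrow> 'b"
  where "scaleR_fun c f = (\<lambda>x. c *\<^sub>R f x)"

instance
  by standard (auto simp: scaleR_fun_def fun_eq_iff plus_fun_def scaleR_add_right scaleR_add_left)

end

section \<open>Newton differentiability\<close>

text \<open>
  The spaces that occur depend on the domain \<open>\<Omega>\<close>, so a normed space is given by a subspace of an
  ambient real vector space together with its norm. Function spaces on \<open>\<Omega>\<close> consist of
  representatives \<open>u :: real^'n \<Rightarrow> real\<close>, whose values outside \<open>\<Omega>\<close> are irrelevant; the norm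
  vanishes exactly on the functions that are zero almost everywhere on \<open>\<Omega>\<close>, so
  functions that agree almost everywhere are at distance zero, as in the usual identification.
\<close>

record 'v nspace =
  carr :: "'v set"
  nrm :: "'v \<Rightarrow> real"

definition open_subset :: "'v::real_vector nspace \<Rightarrow> 'v set \<Rightarrow> bool" where
  "open_subset V U \<longleftrightarrow> U \<subseteq> carr V \<and>
     (\<forall>u\<in>U. \<exists>e>0. \<forall>v\<in>carr V. nrm V (v - u) < e \<longrightarrow> v \<in> U)"

definition bounded_linear_maps ::
    "'v::real_vector nspace \<Rightarrow> 'z::real_vector nspace \<Rightarrow> ('v \<Rightarrow> 'z) set" where
  "bounded_linear_maps V Z = {T.
     (\<forall>v\<in>carr V. T v \<in> carr Z) \<and>
     (\<forall>v\<in>carr V. \<forall>v'\<in>carr V. T (v + v') = T v + T v') \<and>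
     (\<forall>c. \<forall>v\<in>carr V. T (c *\<^sub>R v) = c *\<^sub>R T v) \<and>
     (\<exists>C. \<forall>v\<in>carr V. nrm Z (T v) \<le> C * nrm V v)}"

text \<open>Functionals are normalized to \<open>0\<close> off the carrier; this makes the dual a vector space.\<close>

definition functional_on :: "'v nspace \<Rightarrow> ('v \<Rightarrow> real) \<Rightarrow> 'v \<Rightarrow> real" where
  "functional_on V f = (\<lambda>v. if v \<in> carr V then f v else 0)"

definition dual_space :: "'v::real_vector nspace \<Rightarrow> ('v \<Rightarrow> real) nspace" where
  "dual_space V = \<lparr>
     carr = {f \<in> bounded_linear_maps V \<lparr>carr = UNIV, nrm = abs\<rparr>. \<forall>v. v \<notin> carr V \<longrightarrow> f v = 0},
     nrm = (\<lambda>f. SUP v\<in>{v \<in> carr V. nrm V v \<le> 1}. \<bar>f v\<bar>)\<rparr>"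

text \<open>The filter below is \<open>\<parallel>h\<parallel> \<rightarrow> 0\<close> with \<open>\<parallel>h\<parallel> \<noteq> 0\<close> and \<open>u + h\<close> in the neighbourhood \<open>N\<close>.\<close>

definition newton_limit ::
    "'v::real_vector nspace \<Rightarrow> 'z::real_vector nspace \<Rightarrow> 'v set \<Rightarrow>
     ('v \<Rightarrow> 'z) \<Rightarrow> ('v \<Rightarrow> 'v \<Rightarrow> 'z) \<Rightarrow> 'v \<Rightarrow> bool" where
  "newton_limit V Z N F G u \<longleftrightarrow>
     ((\<lambda>h. nrm Z (F (u + h) - F u - G (u + h) h) / nrm V h) \<longlongrightarrow> 0)
       (inf (filtercomap (nrm V) (at_right 0)) (principal {h \<in> carr V. u + h \<in> N}))"

definition newton_differentiable_at ::
    "'v::real_vector nspace \<Rightarrow> 'z::real_vector nspace \<Rightarrow> 'v set \<Rightarrow> ('v \<Rightarrow> 'z) \<Rightarrow> 'v \<Rightarrow> bool" where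
  "newton_differentiable_at V Z D F u \<longleftrightarrow>
     open_subset V D \<and> F \<in> D \<rightarrow> carr Z \<and>
     (\<exists>N G. open_subset V N \<and> u \<in> N \<and> N \<subseteq> D \<and> G \<in> N \<rightarrow> bounded_linear_maps V Z \<and>
        newton_limit V Z N F G u)"

definition has_newton_derivative ::
    "'v::real_vector nspace \<Rightarrow> 'z::real_vector nspace \<Rightarrow> 'v set \<Rightarrow>
     ('v \<Rightarrow> 'z) \<Rightarrow> ('v \<Rightarrow> 'v \<Rightarrow> 'z) \<Rightarrow> bool" where
  "has_newton_derivative V Z D F G \<longleftrightarrow>
     open_subset V D \<and> F \<in> D \<rightarrow> carr Z \<and> G \<in> D \<rightarrow> bounded_linear_maps V Z \<and>
     (\<forall>u\<in>D. newton_limit V Z D F G u)"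

section \<open>Lebesgue spaces\<close>

definition Lp_set :: "(real^'n) set \<Rightarrow> ennreal \<Rightarrow> (real^'n \<Rightarrow> 'b::real_normed_vector) set" where
  "Lp_set \<Omega> p = {f \<in> borel_measurable (lebesgue_on \<Omega>).
     if p = \<infinity> then esssup (lebesgue_on \<Omega>) (\<lambda>x. ennreal (norm (f x))) < \<infinity>
     else integrable (lebesgue_on \<Omega>) (\<lambda>x. norm (f x) powr enn2real p)}"

definition Lp_norm :: "(real^'n) set \<Rightarrow> ennreal \<Rightarrow> (real^'n \<Rightarrow> 'b::real_normed_vector) \<Rightarrow> real" where
  "Lp_norm \<Omega> p f =
     (if p = \<infinity> then enn2real (esssup (lebesgue_on \<Omega>) (\<lambda>x. ennreal (norm (f x))))
      else (LINT x|lebesgue_on \<Omega>. norm (f x) powr enn2real p) powr (1 / enn2real p))"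

text \<open>
  Linearity is required almost everywhere; boundedness then makes the operator respect
  almost-everywhere equality.
\<close>

definition Lp_bounded_operator ::
    "(real^'n) set \<Rightarrow> ennreal \<Rightarrow> ((real^'n \<Rightarrow> real) \<Rightarrow> real^'n \<Rightarrow> real^'n) \<Rightarrow> bool" where
  "Lp_bounded_operator \<Omega> p T \<longleftrightarrow>
     (\<forall>u\<in>Lp_set \<Omega> p. T u \<in> Lp_set \<Omega> p) \<and>
     (\<forall>u\<in>Lp_set \<Omega> p. \<forall>v\<in>Lp_set \<Omega> p. AE x in lebesgue_on \<Omega>. T (u + v) x = T u x + T v x) \<and>
     (\<forall>c. \<forall>u\<in>Lp_set \<Omega> p. AE x in lebesgue_on \<Omega>. T (c *\<^sub>R u) x = c *\<^sub>R T u x) \<and>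
     (\<exists>C. \<forall>u\<in>Lp_set \<Omega> p. Lp_norm \<Omega> p (T u) \<le> C * Lp_norm \<Omega> p u)"

section \<open>Weak gradients and Sobolev spaces\<close>

definition partial :: "'n::finite \<Rightarrow> (real^'n \<Rightarrow> real) \<Rightarrow> real^'n \<Rightarrow> real" where
  "partial i f x = frechet_derivative f (at x) (axis i 1)"

primrec Ck :: "nat \<Rightarrow> (real^'n \<Rightarrow> real) \<Rightarrow> bool" where
  "Ck 0 f \<longleftrightarrow> continuous_on UNIV f"
| "Ck (Suc k) f \<longleftrightarrow> (\<forall>x. f differentiable (at x)) \<and> (\<forall>i. Ck k (partial i f))"

definition test_functions :: "(real^'n) set \<Rightarrow> (real^'n \<Rightarrow> real) set" where
  "test_functions \<Omega> = {\<psi>. (\<forall>k. Ck k \<psi>) \<and>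
     compact (closure {x. \<psi> x \<noteq> 0}) \<and> closure {x. \<psi> x \<noteq> 0} \<subseteq> \<Omega>}"

definition locally_integrable ::
    "(real^'n) set \<Rightarrow> (real^'n \<Rightarrow> 'b::euclidean_space) \<Rightarrow> bool" where
  "locally_integrable \<Omega> f \<longleftrightarrow> (\<forall>K. compact K \<and> K \<subseteq> \<Omega> \<longrightarrow> set_integrable lebesgue K f)"

definition has_weak_gradient ::
    "(real^'n) set \<Rightarrow> (real^'n \<Rightarrow> real) \<Rightarrow> (real^'n \<Rightarrow> real^'n) \<Rightarrow> bool" where
  "has_weak_gradient \<Omega> u g \<longleftrightarrow> locally_integrable \<Omega> u \<and> locally_integrable \<Omega> g \<and>
     (\<forall>\<psi>\<in>test_functions \<Omega>. \<forall>i.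
        (LINT x|lebesgue_on \<Omega>. u x * partial i \<psi> x) = - (LINT x|lebesgue_on \<Omega>. g x $ i * \<psi> x))"

text \<open>Weak gradients are unique almost everywhere on \<open>\<Omega>\<close>, so any choice will do.\<close>

definition weak_grad :: "(real^'n) set \<Rightarrow> (real^'n \<Rightarrow> real) \<Rightarrow> real^'n \<Rightarrow> real^'n" where
  "weak_grad \<Omega> u = (SOME g. has_weak_gradient \<Omega> u g)"

definition W1p_set :: "(real^'n) set \<Rightarrow> ennreal \<Rightarrow> (real^'n \<Rightarrow> real) set" where
  "W1p_set \<Omega> p = {u \<in> Lp_set \<Omega> p. \<exists>g. has_weak_gradient \<Omega> u g \<and> g \<in> Lp_set \<Omega> p}"

definition H1_norm :: "(real^'n) set \<Rightarrow> (real^'n \<Rightarrow> real) \<Rightarrow> real" where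
  "H1_norm \<Omega> u = sqrt ((Lp_norm \<Omega> 2 u)\<^sup>2 + (Lp_norm \<Omega> 2 (weak_grad \<Omega> u))\<^sup>2)"

text \<open>\<open>H\<^sub>0\<^sup>1(\<Omega>)\<close>: the closure of the test functions in \<open>H\<^sup>1(\<Omega>)\<close>\<close>

definition H10 :: "(real^'n) set \<Rightarrow> (real^'n \<Rightarrow> real) nspace" where
  "H10 \<Omega> = \<lparr>
     carr = {u \<in> W1p_set \<Omega> 2. \<forall>e>0. \<exists>\<psi>\<in>test_functions \<Omega>. H1_norm \<Omega> (u - \<psi>) < e},
     nrm = H1_norm \<Omega>\<rparr>"

definition W10inf :: "(real^'n) set \<Rightarrow> (real^'n \<Rightarrow> real) nspace" where
  "W10inf \<Omega> = \<lparr>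
     carr = W1p_set \<Omega> \<infinity> \<inter> carr (H10 \<Omega>),
     nrm = (\<lambda>u. Lp_norm \<Omega> \<infinity> u + Lp_norm \<Omega> \<infinity> (weak_grad \<Omega> u))\<rparr>"

section \<open>The operator and its Newton derivative\<close>

definition clip :: "real \<Rightarrow> real" where
  "clip t = min 1 (max 0 t)"

definition Omega_plus :: "(real^'n) set \<Rightarrow> (real^'n \<Rightarrow> real^'n) \<Rightarrow> (real^'n) set" where
  "Omega_plus \<Omega> y = {x \<in> \<Omega>. norm (y x) > 0}"

text \<open>
  The parameter \<open>Y\<close> is the space of test directions on which the functionals act, and \<open>D\<close> is
  the (weak or approximate) gradient.
\<close>

definition P_op ::
    "(real^'n) set \<Rightarrow> (real^'n \<Rightarrow> real) \<Rightarrow> ((real^'n \<Rightarrow> real) \<Rightarrow> real^'n \<Rightarrow> real^'n) \<Rightarrow>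
     (real^'n \<Rightarrow> real) nspace \<Rightarrow> (real^'n \<Rightarrow> real) \<Rightarrow> (real^'n \<Rightarrow> real) \<Rightarrow> real" where
  "P_op \<Omega> \<phi> D Y u = functional_on Y (\<lambda>w.
     LINT x:Omega_plus \<Omega> (D u)|lebesgue.
       clip (norm (D u x) - \<phi> x) * ((D u x \<bullet> D w x) / norm (D u x)))"

text \<open>The column times the row is \<open>y y\<^sup>T\<close>; the value where \<open>y x = 0\<close> is never used.\<close>

definition G_P :: "(real^'n \<Rightarrow> real) \<Rightarrow> (real^'n \<Rightarrow> real^'n) \<Rightarrow> real^'n \<Rightarrow> real^'n^'n" where
  "G_P \<phi> y x =
     (let Q = (1 / (norm (y x))\<^sup>2) *\<^sub>R ((columnvector (y x) :: real^1^'n) ** (rowvector (y x) :: real^'n^1)) in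
      indicator {0<..<1} (norm (y x) - \<phi> x) *\<^sub>R Q
      + (clip (norm (y x) - \<phi> x) * (1 / norm (y x))) *\<^sub>R (mat 1 - Q))"

definition G_op ::
    "(real^'n) set \<Rightarrow> (real^'n \<Rightarrow> real) \<Rightarrow> ((real^'n \<Rightarrow> real) \<Rightarrow> real^'n \<Rightarrow> real^'n) \<Rightarrow>
     (real^'n \<Rightarrow> real) nspace \<Rightarrow>
     (real^'n \<Rightarrow> real) \<Rightarrow> (real^'n \<Rightarrow> real) \<Rightarrow> (real^'n \<Rightarrow> real) \<Rightarrow> real" where
  "G_op \<Omega> \<phi> D Y u v = functional_on Y (\<lambda>w.
     LINT x:Omega_plus \<Omega> (D u)|lebesgue. (G_P \<phi> (D u) x *v D v x) \<bullet> D w x)"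

end

theory Submission
  imports Defs "HOL-Computational_Algebra.Polynomial"
begin

text \<open>
  Pointwise, \<open>y \<mapsto> (|y| - c)\<^sup>\<plusminus> y / |y|\<close> is piecewise smooth with kinks on the spheres \<open>|y| = c\<close> and
  \<open>|y| = c + 1\<close>. The Newton remainder at \<open>y\<close> with increment \<open>k\<close> is always \<open>O(|k|)\<close>, and it is
  \<open>O(|k|\<^sup>2)\<close>, uniformly in \<open>c \<ge> \<nu>\<close>, as soon as \<open>|k|\<close> is below the distance from \<open>|y|\<close> to the
  nearest kink that \<open>y\<close> does not lie on. That distance is positive everywhere, so for
  \<open>k \<rightarrow> 0\<close> in \<open>L\<^sup>2\<^sup>s\<close> the set where the quadratic bound fails has vanishing measure, and
  Cauchy-Schwarz makes the remainder \<open>o(\<parallel>k\<parallel>)\<close> from \<open>L\<^sup>2\<^sup>s\<close> to \<open>L\<^sup>s\<close>. The weak gradient is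
  treated with \<open>s = 1\<close>, the test gradients being bounded; the operator \<open>D\<^sub>\<mu>\<close> with \<open>s = 2\<close>, the
  required embedding \<open>H\<^sub>0\<^sup>1 \<subseteq> L\<^sup>4\<close> being Ladyzhenskaya's inequality.
\<close>

section \<open>The pointwise nonlinearity\<close>

text \<open>The superposition operator costs integrability. On the bad set only the Lipschitz bound
  O(|k|) is available, so smallness must come from the measure of that set, and it is paid for by
  the drop from exponent 2s to s. The gradient of an H1 function offers no more than L2, which
  leaves the remainder in L1 and forces bounded test gradients. An operator bounded on every L^p
  passes on the better integrability of the function itself, so the L4 bound in dimensions one and
  two puts the remainder in L2 and the whole dual of the Hilbert space can be reached. The
  derivative is evaluated at the endpoint z = y + k, so the smooth piece containing z decides which
  formula applies; for this reason y may lie on a kink. The singularity of y/|y| does no harm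
  because the clipped factor vanishes for |y| \<le> c and c \<ge> \<nu> > 0. All functions are
  representatives and \<open>weak_grad\<close> is a choice among weak gradients. Linearity of the
  gradient therefore holds only almost everywhere and rests on uniqueness of weak gradients, which
  is why the fundamental lemma appears.\<close>

definition P_pt :: "real \<Rightarrow> 'a::real_inner \<Rightarrow> 'a" where
  "P_pt c y = clip (norm y - c) *\<^sub>R sgn y"

text \<open>The derivative of y/|y| in direction \<open>k\<close>: the component of \<open>k\<close>
  orthogonal to \<open>y\<close>, divided by |y|. At the origin the convention 1/0 = 0 makes it
  vanish.\<close>

definition sgn_deriv :: "'a::real_inner \<Rightarrow> 'a \<Rightarrow> 'a" where
  "sgn_deriv y k = (1 / norm y) *\<^sub>R (k - (sgn y \<bullet> k) *\<^sub>R sgn y)"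

text \<open>The product rule for \<open>P_pt\<close>, with the indicator of the open interval as the
  derivative of \<open>clip\<close>. At both kinks this selects slope 0, which fits the closed cases
  \<open>norm z \<le> c\<close> and \<open>c + 1 \<le> norm z\<close> of the quadratic
  estimate.\<close>

definition G_pt :: "real \<Rightarrow> 'a::real_inner \<Rightarrow> 'a \<Rightarrow> 'a" where
  "G_pt c y k = (indicator {0<..<1} (norm y - c) * (sgn y \<bullet> k)) *\<^sub>R sgn y
     + clip (norm y - c) *\<^sub>R sgn_deriv y k"

lemma clip_bounds [simp]: "0 \<le> clip t" "clip t \<le> 1"
  by (auto simp: clip_def)

lemma clip_lipschitz: "\<bar>clip s - clip t\<bar> \<le> \<bar>s - t\<bar>"
  by (auto simp: clip_def)

text \<open>Tames the origin: the factor |y| gained here cancels the 1/|y| produced by differences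
  and derivatives of y/|y|, so the global bounds include y = 0 and have constants independent of
  \<open>c\<close>.\<close>

lemma clip_norm_le:
  assumes "0 \<le> c"
  shows "clip (norm y - c) \<le> norm y"
  using assms norm_ge_zero[of y] unfolding clip_def by linarith

lemma norm_sgn_le: "norm (sgn y) \<le> 1" for y :: "'a::real_normed_vector"
  by (simp add: norm_sgn)

lemma norm_P_pt_le: "norm (P_pt c y) \<le> 1"
proof -
  have "clip (norm y - c) * norm (sgn y) \<le> 1 * 1"
    by (intro mult_mono) (auto simp: norm_sgn_le)
  then show ?thesis by (simp add: P_pt_def)
qed

lemma sgn_radial_le: "\<bar>sgn y \<bullet> k\<bar> \<le> norm k" for y k :: "'a::real_inner"
  using Cauchy_Schwarz_ineq2[of "sgn y" k] norm_sgn_le[of y]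
  by (meson mult_left_le_one_le norm_ge_zero order_trans)

lemma norm_sgn_deriv_le: "norm y * norm (sgn_deriv y k) \<le> 2 * norm k"
proof -
  have "norm ((sgn y \<bullet> k) *\<^sub>R sgn y) \<le> norm k * 1"
    unfolding norm_scaleR by (intro mult_mono sgn_radial_le norm_sgn_le) auto
  then have "norm (k - (sgn y \<bullet> k) *\<^sub>R sgn y) \<le> 2 * norm k"
    using norm_triangle_ineq4[of k "(sgn y \<bullet> k) *\<^sub>R sgn y"] by simp
  then show ?thesis by (cases "y = 0") (auto simp: sgn_deriv_def)
qed

text \<open>The radial part contributes 1 and the tangential part 2, the latter because the clipped
  factor is at most |y|.\<close>

lemma norm_G_pt_le:
  assumes "0 \<le> c"
  shows "norm (G_pt c y k) \<le> 3 * norm k"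
proof -
  have "\<bar>indicator {0<..<1} (norm y - c) * (sgn y \<bullet> k)\<bar> \<le> 1 * norm k"
    unfolding abs_mult by (intro mult_mono sgn_radial_le) (auto simp: indicator_def)
  then have "norm ((indicator {0<..<1} (norm y - c) * (sgn y \<bullet> k)) *\<^sub>R sgn y) \<le> norm k * 1"
    unfolding norm_scaleR by (intro mult_mono norm_sgn_le) auto
  moreover have "clip (norm y - c) * norm (sgn_deriv y k) \<le> norm y * norm (sgn_deriv y k)"
    using assms by (intro mult_right_mono clip_norm_le) auto
  then have "norm (clip (norm y - c) *\<^sub>R sgn_deriv y k) \<le> 2 * norm k"
    using norm_sgn_deriv_le[of y k] by simp
  ultimately show ?thesis
    using norm_triangle_ineq[of "(indicator {0<..<1} (norm y - c) * (sgn y \<bullet> k)) *\<^sub>R sgn y"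
        "clip (norm y - c) *\<^sub>R sgn_deriv y k"]
    unfolding G_pt_def by linarith
qed

text \<open>Scaling by |y| turns the difference of directions into z - y plus the radial discrepancy
  (|y| - |z|) z/|z|, and each of these has norm at most |z - y|.\<close>

lemma sgn_lipschitz:
  fixes y z :: "'a::real_inner"
  assumes "z \<noteq> 0"
  shows "norm y * norm (sgn z - sgn y) \<le> 2 * norm (z - y)"
proof (cases "y = 0")
  case False
  have "norm y * norm (sgn z - sgn y) = norm (norm y *\<^sub>R (sgn z - sgn y))" by simp
  also have "norm y *\<^sub>R (sgn z - sgn y) = (z - y) + (norm y - norm z) *\<^sub>R sgn z"
    using False assms by (simp add: sgn_div_norm algebra_simps)
  also have "norm \<dots> \<le> norm (z - y) + \<bar>norm y - norm z\<bar>"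
    using norm_triangle_ineq[of "z - y" "(norm y - norm z) *\<^sub>R sgn z"] assms
    by (simp add: norm_sgn)
  also have "\<bar>norm y - norm z\<bar> \<le> norm (z - y)"
    by (metis norm_minus_commute norm_triangle_ineq3)
  finally show ?thesis by simp
qed auto

lemma P_pt_lipschitz:
  assumes "0 \<le> c"
  shows "norm (P_pt c z - P_pt c y) \<le> 3 * norm (z - y)"
proof (cases "z = 0")
  case True
  have "clip (norm y - c) * norm (sgn y) \<le> norm y * 1"
    using assms by (intro mult_mono norm_sgn_le clip_norm_le) auto
  then have "norm y * 1 \<ge> norm (P_pt c y)" by (simp add: P_pt_def)
  moreover have "P_pt c z = 0" using True by (simp add: P_pt_def)
  ultimately show ?thesis using True by (simp add: order_trans)
next
  case False
  \<comment> \<open>The splitting attaches the factor at \<open>y\<close> to the difference of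
    directions. That factor is at most |y|, the weight required by
    \<open>sgn_lipschitz\<close>.\<close>
  have "P_pt c z - P_pt c y = (clip (norm z - c) - clip (norm y - c)) *\<^sub>R sgn z
      + clip (norm y - c) *\<^sub>R (sgn z - sgn y)"
    by (simp add: P_pt_def algebra_simps)
  also have "norm \<dots> \<le> \<bar>clip (norm z - c) - clip (norm y - c)\<bar> * 1
      + clip (norm y - c) * norm (sgn z - sgn y)"
    by (rule norm_triangle_mono) (auto simp: False norm_sgn)
  also have "\<dots> \<le> norm (z - y) + 2 * norm (z - y)"
  proof (rule add_mono)
    show "\<bar>clip (norm z - c) - clip (norm y - c)\<bar> * 1 \<le> norm (z - y)"
      using clip_lipschitz[of "norm z - c" "norm y - c"] norm_triangle_ineq3[of z y] by simp
    have "clip (norm y - c) * norm (sgn z - sgn y) \<le> norm y * norm (sgn z - sgn y)"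
      using assms by (intro mult_right_mono clip_norm_le) auto
    then show "clip (norm y - c) * norm (sgn z - sgn y) \<le> 2 * norm (z - y)"
      using sgn_lipschitz[OF False, of y] by simp
  qed
  finally show ?thesis by simp
qed

text \<open>
  With \<open>a = |y|\<close>, \<open>b = |z|\<close>, \<open>k = z - y\<close> and \<open>z \<bullet> k = (b\<^sup>2 - a\<^sup>2 + |k|\<^sup>2) / 2\<close>, the remainder is an
  explicit combination of \<open>z\<close> and \<open>k\<close> with coefficients quadratic and linear in \<open>(a - b, |k|)\<close>.
\<close>

lemma sgn_taylor:
  fixes y z :: "'a::real_inner"
  assumes "y \<noteq> 0" "z \<noteq> 0"
  shows "norm (sgn z - sgn y - sgn_deriv z (z - y))
    \<le> (2 / (norm y * norm z) + 1 / (norm z)\<^sup>2) * (norm (z - y))\<^sup>2"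
proof -
  define a b k where "a = norm y" and "b = norm z" and "k = z - y"
  have pos: "a > 0" "b > 0" using assms by (auto simp: a_def b_def)
  have y: "y = z - k" by (simp add: k_def)
  have zk: "z \<bullet> k = (b\<^sup>2 - a\<^sup>2 + (norm k)\<^sup>2) / 2"
    unfolding a_def b_def power2_norm_eq_inner y
    by (simp add: inner_diff inner_commute)
  \<comment> \<open>The terms of first order cancel in \<alpha>: 1/b - 1/a and (b^2 - a^2)/(2 b^3)
    share the factor a - b, and the cofactor 2 b^2 - a b - a^2 = (b - a)(2 b + a) supplies a second
    one.\<close>
  define \<alpha> \<beta> where "\<alpha> = - ((a - b)\<^sup>2 * (2 * b + a) / (2 * a * b ^ 3)) + (norm k)\<^sup>2 / (2 * b ^ 3)"
    and "\<beta> = (b - a) / (a * b)"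
  have "sgn z - sgn y - sgn_deriv z k = (1/b) *\<^sub>R z - (1/a) *\<^sub>R (z - k) - (1/b) *\<^sub>R k + ((z \<bullet> k) / b^3) *\<^sub>R z"
    by (simp add: sgn_div_norm sgn_deriv_def a_def[symmetric] b_def[symmetric] scaleR_diff_right
        inverse_eq_divide power3_eq_cube y[symmetric])
  also have "\<dots> = (1/b - 1/a + (z \<bullet> k) / b^3) *\<^sub>R z + (1/a - 1/b) *\<^sub>R k"
    by (simp add: algebra_simps)
  also have "1/b - 1/a + (z \<bullet> k) / b^3 = \<alpha>"
    unfolding zk \<alpha>_def using pos by (simp add: field_simps power2_eq_square power3_eq_cube)
  also have "1/a - 1/b = \<beta>"
    unfolding \<beta>_def using pos by (simp add: field_simps)
  finally have eq: "sgn z - sgn y - sgn_deriv z k = \<alpha> *\<^sub>R z + \<beta> *\<^sub>R k" .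
  have ab: "\<bar>b - a\<bar> \<le> norm k"
    using norm_triangle_ineq3[of z y] by (simp add: a_def b_def k_def)
  then have ab2: "(a - b)\<^sup>2 \<le> (norm k)\<^sup>2"
    by (metis abs_le_square_iff abs_minus_commute abs_norm_cancel)
  have "\<bar>\<alpha>\<bar> \<le> (a - b)\<^sup>2 * (2 * b + a) / (2 * a * b ^ 3) + (norm k)\<^sup>2 / (2 * b ^ 3)"
    unfolding \<alpha>_def using pos by (intro order_trans[OF abs_triangle_ineq]) auto
  also have "\<dots> \<le> (norm k)\<^sup>2 * (2 * b + a) / (2 * a * b ^ 3) + (norm k)\<^sup>2 / (2 * b ^ 3)"
    using pos ab2 by (intro add_mono divide_right_mono mult_right_mono) auto
  also have "\<dots> = (1 / (a * b) + 1 / b\<^sup>2) * (norm k)\<^sup>2 / b"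
    using pos by (simp add: field_simps power2_eq_square power3_eq_cube)
  finally have \<alpha>: "\<bar>\<alpha>\<bar> * b \<le> (1 / (a * b) + 1 / b\<^sup>2) * (norm k)\<^sup>2"
    using pos by (simp add: field_simps)
  have "\<bar>\<beta>\<bar> * norm k = \<bar>b - a\<bar> * norm k / (a * b)"
    using pos by (simp add: \<beta>_def abs_mult)
  also have "\<dots> \<le> norm k * norm k / (a * b)"
    using pos ab by (intro divide_right_mono mult_right_mono) auto
  finally have \<beta>: "\<bar>\<beta>\<bar> * norm k \<le> 1 / (a * b) * (norm k)\<^sup>2"
    by (simp add: power2_eq_square)
  have "norm (\<alpha> *\<^sub>R z + \<beta> *\<^sub>R k) \<le> \<bar>\<alpha>\<bar> * b + \<bar>\<beta>\<bar> * norm k"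
    by (rule norm_triangle_mono) (auto simp: b_def)
  also have "\<dots> \<le> (1 / (a * b) + 1 / b\<^sup>2) * (norm k)\<^sup>2 + 1 / (a * b) * (norm k)\<^sup>2"
    using \<alpha> \<beta> by (rule add_mono)
  also have "\<dots> = (2 / (a * b) + 1 / b\<^sup>2) * (norm k)\<^sup>2"
    by (simp add: algebra_simps)
  finally show ?thesis using eq by (simp add: k_def a_def b_def)
qed

text \<open>
  A kink on which the point itself lies does not count: there the one-sided smooth formulas
  agree at \<open>y\<close>, and the value \<open>1\<close> only keeps the distance positive.
\<close>

definition kink_dist :: "real \<Rightarrow> real \<Rightarrow> real" where
  "kink_dist c t = min (if t = c then 1 else \<bar>t - c\<bar>) (if t = c + 1 then 1 else \<bar>t - c - 1\<bar>)"

lemma kink_dist_pos: "0 < kink_dist c t"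
  by (auto simp: kink_dist_def)

text \<open>The fallback where the increment may cross a kink; 6 is the Lipschitz constant 3 of
  \<open>P_pt\<close> plus the bound 3 of the derivative.\<close>

lemma remainder_lipschitz:
  assumes "0 \<le> c"
  shows "norm (P_pt c z - P_pt c y - G_pt c z (z - y)) \<le> 6 * norm (z - y)"
  using norm_triangle_ineq4[of "P_pt c z - P_pt c y" "G_pt c z (z - y)"]
    P_pt_lipschitz[OF assms, of z y] norm_G_pt_le[OF assms, of z "z - y"] by simp

text \<open>Applied with m = c between the two kinks and with m = 1 beyond the upper one.\<close>

lemma sgn_taylor_away:
  fixes y z :: "'a::real_inner"
  assumes "m > 0" "m \<le> norm y" "m \<le> norm z"
  shows "norm (sgn z - sgn y - sgn_deriv z (z - y)) \<le> 3 / m\<^sup>2 * (norm (z - y))\<^sup>2"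
proof -
  have nz: "y \<noteq> 0" "z \<noteq> 0" using assms by auto
  have 1: "m * m \<le> norm y * norm z" "m\<^sup>2 \<le> (norm z)\<^sup>2"
    using assms by (auto intro: mult_mono power_mono)
  have "2 / (norm y * norm z) \<le> 2 / m\<^sup>2" "1 / (norm z)\<^sup>2 \<le> 1 / m\<^sup>2"
    using 1 assms nz by (auto intro!: divide_left_mono mult_pos_pos simp: power2_eq_square)
  then have "2 / (norm y * norm z) + 1 / (norm z)\<^sup>2 \<le> 3 / m\<^sup>2"
    by simp
  then show ?thesis
    using sgn_taylor[OF nz] by (meson mult_right_mono order_trans zero_le_power2)
qed

text \<open>The cases follow the position of z, where the derivative is taken. Since |k| is below
  the kink distance of y, the point y lies in the closure of the piece containing z, and on that
  closure \<open>P_pt\<close> is given by the same smooth formula. What remains is the Taylor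
  remainder of y/|y|.\<close>

lemma remainder_quadratic:
  assumes "0 < \<nu>" "\<nu> \<le> c" and near: "norm (z - y) < kink_dist c (norm y)"
  shows "norm (P_pt c z - P_pt c y - G_pt c z (z - y)) \<le> (3 + 3 / \<nu>) * (norm (z - y))\<^sup>2"
proof -
  define k where "k = norm (z - y)"
  have k: "\<bar>norm z - norm y\<bar> \<le> k" "k < kink_dist c (norm y)" "0 \<le> k"
    using near norm_triangle_ineq3[of z y] by (auto simp: k_def)
  consider "norm z \<le> c" | "c < norm z" "norm z < c + 1" | "c + 1 \<le> norm z" by linarith
  then have "norm (P_pt c z - P_pt c y - G_pt c z (z - y)) \<le> (3 + 3 / \<nu>) * k\<^sup>2"
  proof cases
    case 1
    \<comment> \<open>Otherwise the kink at c would separate the two points and be within |k| of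
      |y|.\<close>
    then have "norm y \<le> c"
      using k by (auto simp: kink_dist_def split: if_splits)
    with 1 show ?thesis using assms by (simp add: P_pt_def G_pt_def clip_def)
  next
    case 2
    then have y: "c \<le> norm y" "norm y \<le> c + 1"
      using k by (auto simp: kink_dist_def split: if_splits)
    have pos: "0 < norm y" "0 < norm z" "0 < c" using assms y 2 by linarith+
    have *: "norm x *\<^sub>R sgn x = x" for x :: 'a by (cases "x = 0") (auto simp: sgn_div_norm)
    have e1: "G_pt c z (z - y) = (z - y) - c *\<^sub>R sgn_deriv z (z - y)"
      using 2 pos by (simp add: G_pt_def clip_def sgn_deriv_def scaleR_diff_left diff_divide_distrib)
    have e2: "P_pt c z = z - c *\<^sub>R sgn z" "P_pt c y = y - c *\<^sub>R sgn y"
      using 2 y by (auto simp: P_pt_def clip_def scaleR_diff_left *)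
    \<comment> \<open>Between the kinks \<open>P_pt\<close> is the identity minus c times the
      direction; the identity leaves no remainder.\<close>
    have "P_pt c z - P_pt c y - G_pt c z (z - y)
        = - (c *\<^sub>R (sgn z - sgn y - sgn_deriv z (z - y)))"
      unfolding e1 e2 by (simp add: algebra_simps)
    then have "norm (P_pt c z - P_pt c y - G_pt c z (z - y))
        = c * norm (sgn z - sgn y - sgn_deriv z (z - y))"
      using pos by simp
    \<comment> \<open>The factor c is outweighed by the 1/c^2 from the distance of both points to
      the origin. The resulting 3/c is uniform for \<open>c \<ge> \<nu>\<close>.\<close>
    also have "\<dots> \<le> c * (3 / c\<^sup>2 * k\<^sup>2)"
      unfolding k_def using pos y 2 by (intro mult_left_mono sgn_taylor_away) auto
    also have "\<dots> = 3 / c * k\<^sup>2"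
      using pos by (simp add: power2_eq_square)
    also have "\<dots> \<le> (3 + 3 / \<nu>) * k\<^sup>2"
    proof (rule mult_right_mono)
      have "3 / c \<le> 3 / \<nu>" using assms by (intro divide_left_mono) auto
      then show "3 / c \<le> 3 + 3 / \<nu>" by simp
    qed simp
    finally show ?thesis .
  next
    case 3
    then have y: "c + 1 \<le> norm y"
      using k by (auto simp: kink_dist_def split: if_splits)
    \<comment> \<open>Beyond the upper kink \<open>P_pt\<close> is the direction itself, and both
      points have norm at least c + 1 \<ge> 1.\<close>
    have "P_pt c z - P_pt c y - G_pt c z (z - y) = sgn z - sgn y - sgn_deriv z (z - y)"
      using 3 y assms by (simp add: P_pt_def G_pt_def clip_def)
    also have "norm \<dots> \<le> 3 / 1\<^sup>2 * (norm (z - y))\<^sup>2"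
      using 3 y assms by (intro sgn_taylor_away) auto
    also have "\<dots> \<le> (3 + 3 / \<nu>) * k\<^sup>2"
      unfolding k_def using assms by (intro mult_right_mono) auto
    finally show ?thesis .
  qed
  then show ?thesis by (simp add: k_def)
qed

section \<open>Identification of the pointwise derivative with the matrix \<open>G_P\<close>\<close>

lemma columnvector_rowvector_mult:
  "((columnvector y :: real^1^'n) ** (rowvector y :: real^'n^1)) *v k = (y \<bullet> k) *\<^sub>R y"
  by (simp add: vec_eq_iff matrix_vector_mult_def matrix_matrix_mult_def columnvector_def
      rowvector_def inner_vec_def sum_distrib_left sum_distrib_right mult_ac)

lemma G_P_mult:
  fixes y :: "real^'n \<Rightarrow> real^'n"
  assumes "y x \<noteq> 0"
  shows "G_P \<phi> y x *v k = G_pt (\<phi> x) (y x) k"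
proof -
  define Q where "Q = (1 / (norm (y x))\<^sup>2) *\<^sub>R
    ((columnvector (y x) :: real^1^'n) ** (rowvector (y x) :: real^'n^1))"
  have "Q *v k = (sgn (y x) \<bullet> k) *\<^sub>R sgn (y x)" for k
    unfolding Q_def using assms
    by (simp add: scaleR_matrix_vector_assoc[symmetric] columnvector_rowvector_mult sgn_div_norm
        power2_eq_square divide_simps)
  then show ?thesis
    unfolding G_P_def Let_def Q_def[symmetric]
    by (simp add: matrix_vector_mult_add_rdistrib matrix_vector_mult_diff_rdistrib
        scaleR_matrix_vector_assoc[symmetric] G_pt_def sgn_deriv_def)
qed

lemma G_pt_0 [simp]: "G_pt c 0 k = 0"
  by (simp add: G_pt_def sgn_deriv_def)

lemma G_pt_add: "G_pt c y (k + k') = G_pt c y k + G_pt c y k'"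
  by (simp add: G_pt_def sgn_deriv_def algebra_simps)

lemma G_pt_scaleR: "G_pt c y (r *\<^sub>R k) = r *\<^sub>R G_pt c y k"
  by (simp add: G_pt_def sgn_deriv_def algebra_simps)

section \<open>Newton differentiability of the superposition operator\<close>

lemma Cauchy_Schwarz_integral:
  fixes f g :: "'a \<Rightarrow> real"
  assumes [measurable]: "f \<in> borel_measurable M" "g \<in> borel_measurable M"
    and f2: "integrable M (\<lambda>x. (f x)\<^sup>2)" and g2: "integrable M (\<lambda>x. (g x)\<^sup>2)"
  shows "integrable M (\<lambda>x. f x * g x)"
    and "\<bar>LINT x|M. f x * g x\<bar> \<le> sqrt (LINT x|M. (f x)\<^sup>2) * sqrt (LINT x|M. (g x)\<^sup>2)"
proof -
  show fg: "integrable M (\<lambda>x. f x * g x)"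
  proof (rule Bochner_Integration.integrable_bound)
    show "integrable M (\<lambda>x. (f x)\<^sup>2 + (g x)\<^sup>2)" using f2 g2 by simp
    have "\<bar>a * b\<bar> \<le> a\<^sup>2 + b\<^sup>2" for a b :: real
    proof -
      have "2 * \<bar>a * b\<bar> \<le> a\<^sup>2 + b\<^sup>2"
        using sum_squares_bound[of "\<bar>a\<bar>" "\<bar>b\<bar>"] by (simp add: abs_mult mult.assoc)
      then show ?thesis using abs_ge_zero[of "a * b"] by linarith
    qed
    then show "AE x in M. norm (f x * g x) \<le> norm ((f x)\<^sup>2 + (g x)\<^sup>2)"
      by simp
  qed simp
  define A B C where "A = (LINT x|M. (f x)\<^sup>2)" and "B = (LINT x|M. f x * g x)"
    and "C = (LINT x|M. (g x)\<^sup>2)"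
  have A0: "0 \<le> A" and C0: "0 \<le> C" by (auto simp: A_def C_def)
  have q: "0 \<le> A * t\<^sup>2 - 2 * t * B + C" for t
  proof -
    have "0 \<le> (LINT x|M. (t * f x - g x)\<^sup>2)" by simp
    also have "(\<lambda>x. (t * f x - g x)\<^sup>2) = (\<lambda>x. t\<^sup>2 * (f x)\<^sup>2 - 2 * t * (f x * g x) + (g x)\<^sup>2)"
      by (auto simp: power2_diff power_mult_distrib)
    also have "(LINT x|M. t\<^sup>2 * (f x)\<^sup>2 - 2 * t * (f x * g x) + (g x)\<^sup>2)
        = t\<^sup>2 * A - 2 * t * B + C"
      using f2 g2 fg unfolding A_def B_def C_def by simp
    finally show ?thesis by (simp add: mult_ac)
  qed
  have "B\<^sup>2 \<le> A * C"
  proof (cases "A = 0")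
    case True
    have "B = 0"
    proof (rule ccontr)
      assume "B \<noteq> 0"
      \<comment> \<open>With A = 0 the quadratic is affine in t, and at this t it equals -1.\<close>
      with q[of "(C + 1) / (2 * B)"] True show False by simp
    qed
    with True show ?thesis by simp
  next
    case False
    \<comment> \<open>The minimiser of the quadratic.\<close>
    with q[of "B / A"] A0 show ?thesis
      by (simp add: power2_eq_square field_simps)
  qed
  then show "\<bar>B\<bar> \<le> sqrt A * sqrt C"
    by (metis real_sqrt_abs real_sqrt_le_iff real_sqrt_mult)
qed

text \<open>The dual norm is a supremum of reals, meaningful only over a nonempty set with an upper
  bound: 0 provides the element and \<open>B\<close> the bound. Nonnegativity is recorded for the
  sandwich argument in the Newton limit.\<close>

lemma dual_norm_le:
  assumes "0 \<in> carr Y" "nrm Y 0 \<le> 1" "0 \<le> B"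
    and "\<And>w. w \<in> carr Y \<Longrightarrow> \<bar>f w\<bar> \<le> B * nrm Y w"
  shows "0 \<le> nrm (dual_space Y) f" "nrm (dual_space Y) f \<le> B"
proof -
  let ?S = "{v \<in> carr Y. nrm Y v \<le> 1}"
  have b: "\<bar>f v\<bar> \<le> B" if "v \<in> ?S" for v
    using assms(3) assms(4)[of v] that mult_left_le[of "nrm Y v" B] by auto
  have ne: "0 \<in> ?S" using assms by auto
  show "nrm (dual_space Y) f \<le> B"
    unfolding dual_space_def using ne b by (auto intro!: cSUP_least)
  have "\<bar>f 0\<bar> \<le> (SUP v\<in>?S. \<bar>f v\<bar>)"
    using ne b by (intro cSUP_upper bdd_aboveI2[where M=B]) auto
  then show "0 \<le> nrm (dual_space Y) f"
    unfolding dual_space_def by auto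
qed

lemma has_newton_derivative_imp_differentiable_at:
  assumes "has_newton_derivative V Z D F G" "u \<in> D"
  shows "newton_differentiable_at V Z D F u"
  using assms unfolding has_newton_derivative_def newton_differentiable_at_def by blast

text \<open>Replaces the set \<open>Omega_plus\<close>, which depends on the argument of the
  operator, by the fixed domain, so that integrals for u and u + h can be subtracted.\<close>

lemma set_integral_subset_lebesgue_on:
  fixes f g :: "'a::euclidean_space \<Rightarrow> real"
  assumes "\<Omega> \<in> sets lebesgue" "A \<subseteq> \<Omega>"
    and "\<And>x. x \<in> A \<Longrightarrow> f x = g x" "\<And>x. x \<in> \<Omega> - A \<Longrightarrow> g x = 0"
  shows "(LINT x:A|lebesgue. f x) = (LINT x|lebesgue_on \<Omega>. g x)"
proof -
  have "(LINT x|lebesgue_on \<Omega>. g x) = (LINT x|lebesgue. indicator \<Omega> x *\<^sub>R g x)"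
    using assms(1) by (intro integral_restrict_space) auto
  also have "\<dots> = (LINT x:A|lebesgue. f x)"
    unfolding set_lebesgue_integral_def using assms(2-)
    by (intro Bochner_Integration.integral_cong) (auto simp: indicator_def)
  finally show ?thesis by simp
qed

lemma add_power_le:
  fixes a b :: real
  assumes "0 \<le> a" "0 \<le> b"
  shows "(a + b) ^ s \<le> 2 ^ s * (a ^ s + b ^ s)"
proof -
  have "(a + b) ^ s \<le> (2 * max a b) ^ s"
    using assms by (intro power_mono) auto
  also have "\<dots> = 2 ^ s * max a b ^ s" by (simp add: power_mult_distrib)
  also have "max a b ^ s \<le> a ^ s + b ^ s"
    using assms by (auto simp: max_def)
  finally show ?thesis by simp
qed

lemma borel_measurable_P_pt [measurable]:
  fixes c :: "'b \<Rightarrow> real" and y :: "'b \<Rightarrow> 'a::euclidean_space"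
  assumes [measurable]: "c \<in> borel_measurable M" "y \<in> borel_measurable M"
  shows "(\<lambda>x. P_pt (c x) (y x)) \<in> borel_measurable M"
  unfolding P_pt_def clip_def sgn_div_norm by measurable

lemma borel_measurable_G_pt [measurable]:
  fixes c :: "'b \<Rightarrow> real" and y k :: "'b \<Rightarrow> 'a::euclidean_space"
  assumes [measurable]: "c \<in> borel_measurable M" "y \<in> borel_measurable M" "k \<in> borel_measurable M"
  shows "(\<lambda>x. G_pt (c x) (y x) (k x)) \<in> borel_measurable M"
  unfolding G_pt_def sgn_deriv_def clip_def sgn_div_norm by measurable

lemma borel_measurable_kink_dist [measurable]:
  assumes [measurable]: "c \<in> borel_measurable M" "t \<in> borel_measurable M"
  shows "(\<lambda>x. kink_dist (c x) (t x)) \<in> borel_measurable M"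
  unfolding kink_dist_def by measurable

text \<open>Continuity of a finite measure from above: the sets where f < 1/(n + 1) decrease to the
  empty set because f is positive everywhere.\<close>

lemma (in finite_measure) measure_sublevel_tendsto_0:
  assumes [measurable]: "f \<in> borel_measurable M" and pos: "\<And>x. 0 < (f x :: real)" and "0 < \<epsilon>"
  obtains \<eta> where "0 < \<eta>" "measure M {x \<in> space M. f x < \<eta>} < \<epsilon>"
proof -
  let ?A = "\<lambda>n. {x \<in> space M. f x < 1 / real (Suc n)}"
  have "(\<lambda>n. measure M (?A n)) \<longlonglongrightarrow> measure M (\<Inter>n. ?A n)"
  proof (rule finite_Lim_measure_decseq)
    show "range ?A \<subseteq> sets M" by auto
    have "1 / real (Suc n) \<le> 1 / real (Suc m)" if "m \<le> n" for m n
      using that by (simp add: frac_le)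
    then show "decseq ?A"
      unfolding decseq_def by (auto intro: less_le_trans simp del: of_nat_Suc)
  qed
  also have "(\<Inter>n. ?A n) = {}"
  proof -
    have "\<exists>n. \<not> f x < 1 / real (Suc n)" for x
      using nat_approx_posE[OF pos[of x]] by (metis less_asym)
    then show ?thesis by blast
  qed
  finally have "(\<lambda>n. measure M (?A n)) \<longlonglongrightarrow> 0" by simp
  then have "\<forall>\<^sub>F n in sequentially. measure M (?A n) < \<epsilon>"
    using \<open>0 < \<epsilon>\<close> by (rule order_tendstoD)
  then obtain n where "measure M (?A n) < \<epsilon>"
    by (auto simp: eventually_sequentially)
  then show ?thesis by (intro that[of "1 / real (Suc n)"]) auto
qed

text \<open>The common frame of both cases. \<open>D\<close> maps \<open>V\<close> to L^{2s} with
  constant \<open>c\<close>; a field in L^s pairs with \<open>D w\<close>, for w in the test space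
  \<open>Y\<close>, with constant \<open>K\<close>; \<open>root s\<close> of the integral is the L^s
  norm. Everything asked of \<open>D\<close> is stable under changes on null sets.\<close>

locale superposition_setting =
  fixes \<Omega> :: "(real^'n) set" and \<phi> :: "real^'n \<Rightarrow> real" and \<nu> c K :: real and s :: nat
    and D :: "(real^'n \<Rightarrow> real) \<Rightarrow> real^'n \<Rightarrow> real^'n"
    and V Y :: "(real^'n \<Rightarrow> real) nspace"
  assumes \<Omega>: "\<Omega> \<in> lmeasurable"
    and \<phi> [measurable]: "\<phi> \<in> borel_measurable (lebesgue_on \<Omega>)"
    and \<nu>: "0 < \<nu>" and \<phi>_ge: "AE x in lebesgue_on \<Omega>. \<nu> \<le> \<phi> x"
    and s: "0 < s" and c: "0 \<le> c" and K: "0 \<le> K"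
    and V: "subspace (carr V)" and nrm_V: "\<And>v. 0 \<le> nrm V v"
    and Y: "subspace (carr Y)" "carr Y \<subseteq> carr V" and nrm_Y: "nrm Y 0 = 0"
    and D_meas: "\<And>v. v \<in> carr V \<Longrightarrow> D v \<in> borel_measurable (lebesgue_on \<Omega>)"
    and D_add: "\<And>v w. v \<in> carr V \<Longrightarrow> w \<in> carr V \<Longrightarrow>
      AE x in lebesgue_on \<Omega>. D (v + w) x = D v x + D w x"
    and D_scaleR: "\<And>r v. v \<in> carr V \<Longrightarrow> AE x in lebesgue_on \<Omega>. D (r *\<^sub>R v) x = r *\<^sub>R D v x"
    and D_integrable: "\<And>v. v \<in> carr V \<Longrightarrow> integrable (lebesgue_on \<Omega>) (\<lambda>x. norm (D v x) ^ (2 * s))"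
    and D_bound: "\<And>v. v \<in> carr V \<Longrightarrow>
      (LINT x|lebesgue_on \<Omega>. norm (D v x) ^ (2 * s)) \<le> (c * nrm V v) ^ (2 * s)"
    and pairing_integrable: "\<And>w g. w \<in> carr Y \<Longrightarrow> g \<in> borel_measurable (lebesgue_on \<Omega>) \<Longrightarrow>
      integrable (lebesgue_on \<Omega>) (\<lambda>x. norm (g x) ^ s) \<Longrightarrow>
      integrable (lebesgue_on \<Omega>) (\<lambda>x. g x \<bullet> D w x)"
    and pairing_bound: "\<And>w g. w \<in> carr Y \<Longrightarrow> g \<in> borel_measurable (lebesgue_on \<Omega>) \<Longrightarrow>
      integrable (lebesgue_on \<Omega>) (\<lambda>x. norm (g x) ^ s) \<Longrightarrow>
      \<bar>LINT x|lebesgue_on \<Omega>. g x \<bullet> D w x\<bar>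
        \<le> K * root s (LINT x|lebesgue_on \<Omega>. norm (g x) ^ s) * nrm Y w"
begin

abbreviation "M \<equiv> lebesgue_on \<Omega>"

lemma finite_M: "finite_measure M"
  using \<Omega> by (simp add: finite_measure_lebesgue_on)

interpretation M: finite_measure M by (rule finite_M)

text \<open>Cauchy-Schwarz of the s-th power against an indicator. The factor
  \<open>sqrt (measure M A)\<close> is the source of smallness when \<open>A\<close> is the
  exceptional set, and the embedding of L^{2s} into L^s when \<open>A\<close> is everything.\<close>

lemma D_power_s:
  assumes v: "v \<in> carr V"
  shows "integrable M (\<lambda>x. norm (D v x) ^ s)"
    and "A \<in> sets M \<Longrightarrow> (LINT x|M. norm (D v x) ^ s * indicator A x)
      \<le> sqrt (LINT x|M. norm (D v x) ^ (2 * s)) * sqrt (measure M A)"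
    and "A \<in> sets M \<Longrightarrow> integrable M (\<lambda>x. norm (D v x) ^ s * indicator A x)"
proof -
  note [measurable] = D_meas[OF v]
  have pw: "(norm (D v x) ^ s)\<^sup>2 = norm (D v x) ^ (2 * s)" for x
    by (simp add: power_mult[symmetric] mult.commute)
  have i2: "(indicator A x)\<^sup>2 = (indicator A x :: real)" for A x
    by (simp add: indicator_def)
  {
    fix A assume [measurable]: "A \<in> sets M"
    have "integrable M (indicator A :: _ \<Rightarrow> real)"
      by (auto simp: less_top[symmetric])
    note CS = Cauchy_Schwarz_integral[of "\<lambda>x. norm (D v x) ^ s" M "indicator A", unfolded pw i2,
        OF _ _ D_integrable[OF v] this]
    from CS(2) show "(LINT x|M. norm (D v x) ^ s * indicator A x)
      \<le> sqrt (LINT x|M. norm (D v x) ^ (2 * s)) * sqrt (measure M A)"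
      using sets.sets_into_space[OF \<open>A \<in> sets M\<close>] by (simp add: Int_absorb2)
    from CS(1) show "integrable M (\<lambda>x. norm (D v x) ^ s * indicator A x)" by simp
  }
  from this[of "space M"]
  have "integrable M (\<lambda>x. norm (D v x) ^ s * indicator (space M) x)" by simp
  then show "integrable M (\<lambda>x. norm (D v x) ^ s)"
    by (rule Bochner_Integration.integrable_cong[THEN iffD1, rotated 2]) auto
qed

text \<open>Values, derivatives and remainders of the operator are all of this form, so membership
  in the dual and the norm bound are settled once for a general field \<open>g\<close>. Additivity
  and homogeneity in w come from those of \<open>D\<close> almost everywhere.\<close>

lemma pairing_functional:
  assumes g: "g \<in> borel_measurable M" "integrable M (\<lambda>x. norm (g x) ^ s)"
  shows "functional_on Y (\<lambda>w. LINT x|M. g x \<bullet> D w x) \<in> carr (dual_space Y)" (is "?f \<in> _")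
    and "0 \<le> nrm (dual_space Y) (functional_on Y (\<lambda>w. LINT x|M. g x \<bullet> D w x))"
    and "nrm (dual_space Y) (functional_on Y (\<lambda>w. LINT x|M. g x \<bullet> D w x))
      \<le> K * root s (LINT x|M. norm (g x) ^ s)"
proof -
  note [measurable] = g(1)
  define B where "B = K * root s (LINT x|M. norm (g x) ^ s)"
  have B0: "0 \<le> B" using K s by (auto simp: B_def)
  have Dm [measurable]: "D w \<in> borel_measurable M" if "w \<in> carr Y" for w
    using that Y by (intro D_meas) auto
  have bd: "\<bar>?f w\<bar> \<le> B * nrm Y w" if "w \<in> carr Y" for w
    using pairing_bound[OF that g] that by (simp add: functional_on_def B_def)
  note sub = subspace_0[OF Y(1)] subspace_add[OF Y(1)] subspace_scale[OF Y(1)]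
  have add: "?f (v + w) = ?f v + ?f w" if vw: "v \<in> carr Y" "w \<in> carr Y" for v w
  proof -
    have "(LINT x|M. g x \<bullet> D (v + w) x) = (LINT x|M. g x \<bullet> D v x + g x \<bullet> D w x)"
    proof (rule integral_cong_AE)
      have "AE x in M. D (v + w) x = D v x + D w x" using vw Y by (intro D_add) auto
      then show "AE x in M. g x \<bullet> D (v + w) x = g x \<bullet> D v x + g x \<bullet> D w x"
        by (auto simp: inner_add_right)
    qed (use Dm[OF vw(1)] Dm[OF vw(2)] Dm[OF sub(2)[OF vw]] in measurable)
    also have "\<dots> = (LINT x|M. g x \<bullet> D v x) + (LINT x|M. g x \<bullet> D w x)"
      by (intro Bochner_Integration.integral_add pairing_integrable vw g)
    finally show ?thesis using vw sub by (simp add: functional_on_def)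
  qed
  have scale: "?f (r *\<^sub>R w) = r * ?f w" if w: "w \<in> carr Y" for r w
  proof -
    have "(LINT x|M. g x \<bullet> D (r *\<^sub>R w) x) = (LINT x|M. r * (g x \<bullet> D w x))"
    proof (rule integral_cong_AE)
      have "AE x in M. D (r *\<^sub>R w) x = r *\<^sub>R D w x" using w Y by (intro D_scaleR) auto
      then show "AE x in M. g x \<bullet> D (r *\<^sub>R w) x = r * (g x \<bullet> D w x)"
        by auto
    qed (use Dm[OF w] Dm[OF sub(3)[OF w]] in measurable)
    then show ?thesis using w sub by (simp add: functional_on_def)
  qed
  show "?f \<in> carr (dual_space Y)"
    unfolding dual_space_def bounded_linear_maps_def using add scale bd
    by (auto simp: functional_on_def intro: exI[of _ B])
  show "0 \<le> nrm (dual_space Y) ?f" "nrm (dual_space Y) ?f \<le> K * root s (LINT x|M. norm (g x) ^ s)"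
    using dual_norm_le[OF sub(1) _ B0 bd] nrm_Y by (simp_all add: B_def)
qed

text \<open>Since \<open>sgn 0 = 0\<close>, the field \<open>P_pt\<close> vanishes off
  \<open>Omega_plus\<close>, and the integral may be taken over the whole domain.\<close>

lemma P_op_eq: "P_op \<Omega> \<phi> D Y u = functional_on Y (\<lambda>w. LINT x|M. P_pt (\<phi> x) (D u x) \<bullet> D w x)"
  unfolding P_op_def
proof (rule arg_cong[where f = "functional_on Y"], rule ext)
  fix w
  show "(LINT x:Omega_plus \<Omega> (D u)|lebesgue.
      clip (norm (D u x) - \<phi> x) * ((D u x \<bullet> D w x) / norm (D u x)))
    = (LINT x|M. P_pt (\<phi> x) (D u x) \<bullet> D w x)"
    using \<Omega> by (intro set_integral_subset_lebesgue_on)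
      (auto simp: Omega_plus_def P_pt_def sgn_div_norm divide_inverse)
qed

lemma G_op_eq: "G_op \<Omega> \<phi> D Y u v =
  functional_on Y (\<lambda>w. LINT x|M. G_pt (\<phi> x) (D u x) (D v x) \<bullet> D w x)"
  unfolding G_op_def
proof (rule arg_cong[where f = "functional_on Y"], rule ext)
  fix w
  show "(LINT x:Omega_plus \<Omega> (D u)|lebesgue. (G_P \<phi> (D u) x *v D v x) \<bullet> D w x)
    = (LINT x|M. G_pt (\<phi> x) (D u x) (D v x) \<bullet> D w x)"
    using \<Omega> by (intro set_integral_subset_lebesgue_on) (auto simp: Omega_plus_def G_P_mult)
qed

lemma integrable_P_pt:
  assumes "u \<in> carr V"
  shows "integrable M (\<lambda>x. norm (P_pt (\<phi> x) (D u x)) ^ s)"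
proof (rule M.integrable_const_bound[where B = 1])
  note [measurable] = D_meas[OF assms]
  show "(\<lambda>x. norm (P_pt (\<phi> x) (D u x)) ^ s) \<in> borel_measurable M" by measurable
  show "AE x in M. norm (norm (P_pt (\<phi> x) (D u x)) ^ s) \<le> 1"
    by (simp add: norm_P_pt_le power_le_one)
qed

lemma G_pt_power_bound:
  "AE x in M. norm (G_pt (\<phi> x) (D u x) (D v x)) ^ s \<le> 3 ^ s * norm (D v x) ^ s"
  using \<phi>_ge
proof eventually_elim
  case (elim x)
  then have "norm (G_pt (\<phi> x) (D u x) (D v x)) ^ s \<le> (3 * norm (D v x)) ^ s"
    using \<nu> by (intro power_mono norm_G_pt_le) auto
  then show ?case by (simp add: power_mult_distrib)
qed

lemma integrable_G_pt:
  assumes "u \<in> carr V" "v \<in> carr V"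
  shows "integrable M (\<lambda>x. norm (G_pt (\<phi> x) (D u x) (D v x)) ^ s)"
proof (rule Bochner_Integration.integrable_bound)
  note [measurable] = D_meas[OF assms(1)] D_meas[OF assms(2)]
  show "integrable M (\<lambda>x. 3 ^ s * norm (D v x) ^ s)"
    using D_power_s(1)[OF assms(2)] by simp
  show "(\<lambda>x. norm (G_pt (\<phi> x) (D u x) (D v x)) ^ s) \<in> borel_measurable M" by measurable
  show "AE x in M. norm (norm (G_pt (\<phi> x) (D u x) (D v x)) ^ s) \<le> norm (3 ^ s * norm (D v x) ^ s)"
    using G_pt_power_bound by (auto simp: power_abs)
qed

lemma sqrt_D_bound:
  assumes "v \<in> carr V"
  shows "sqrt (LINT x|M. norm (D v x) ^ (2 * s)) \<le> (c * nrm V v) ^ s"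
proof -
  have "sqrt (LINT x|M. norm (D v x) ^ (2 * s)) \<le> sqrt (((c * nrm V v) ^ s)\<^sup>2)"
    using D_bound[OF assms] by (intro real_sqrt_le_mono) (simp add: power_mult[symmetric] mult.commute)
  then show ?thesis using c nrm_V[of v] by simp
qed

lemma P_op_in_dual: "u \<in> carr V \<Longrightarrow> P_op \<Omega> \<phi> D Y u \<in> carr (dual_space Y)"
  unfolding P_op_eq
  by (intro pairing_functional(1) integrable_P_pt borel_measurable_P_pt D_meas \<phi>)

lemma G_op_bounded_linear:
  assumes u: "u \<in> carr V"
  shows "G_op \<Omega> \<phi> D Y u \<in> bounded_linear_maps V (dual_space Y)"
proof -
  have gm: "(\<lambda>x. G_pt (\<phi> x) (D u x) (D v x)) \<in> borel_measurable M" if "v \<in> carr V" for v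
    using u that by (intro borel_measurable_G_pt D_meas \<phi>)
  note pf = pairing_functional[OF gm integrable_G_pt[OF u], folded G_op_eq]
  note V' = subspace_add[OF V] subspace_scale[OF V]
  have meas: "(\<lambda>x. G_pt (\<phi> x) (D u x) (D v x) \<bullet> D w x) \<in> borel_measurable M"
    if "v \<in> carr V" "w \<in> carr Y" for v w
  proof -
    have [measurable]: "D w \<in> borel_measurable M" using that Y by (intro D_meas) auto
    note [measurable] = gm[OF that(1)]
    show ?thesis by measurable
  qed
  have "G_op \<Omega> \<phi> D Y u (v + v') = G_op \<Omega> \<phi> D Y u v + G_op \<Omega> \<phi> D Y u v'"
    if v: "v \<in> carr V" "v' \<in> carr V" for v v'
  proof
    fix w
    show "G_op \<Omega> \<phi> D Y u (v + v') w = (G_op \<Omega> \<phi> D Y u v + G_op \<Omega> \<phi> D Y u v') w"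
    proof (cases "w \<in> carr Y")
      case w: True
      note int = pairing_integrable[OF w gm[OF v(1)] integrable_G_pt[OF u v(1)]]
        pairing_integrable[OF w gm[OF v(2)] integrable_G_pt[OF u v(2)]]
      have "(LINT x|M. G_pt (\<phi> x) (D u x) (D (v + v') x) \<bullet> D w x)
        = (LINT x|M. G_pt (\<phi> x) (D u x) (D v x) \<bullet> D w x + G_pt (\<phi> x) (D u x) (D v' x) \<bullet> D w x)"
        using D_add[OF v] by (intro integral_cong_AE)
          (auto intro!: meas borel_measurable_add V' v w simp: G_pt_add inner_add_left)
      then show ?thesis using w int by (simp add: G_op_eq functional_on_def)
    qed (simp add: G_op_eq functional_on_def)
  qed
  moreover have "G_op \<Omega> \<phi> D Y u (r *\<^sub>R v) = r *\<^sub>R G_op \<Omega> \<phi> D Y u v" if v: "v \<in> carr V" for r v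
  proof
    fix w
    show "G_op \<Omega> \<phi> D Y u (r *\<^sub>R v) w = (r *\<^sub>R G_op \<Omega> \<phi> D Y u v) w"
    proof (cases "w \<in> carr Y")
      case w: True
      have "(LINT x|M. G_pt (\<phi> x) (D u x) (D (r *\<^sub>R v) x) \<bullet> D w x)
        = (LINT x|M. r * (G_pt (\<phi> x) (D u x) (D v x) \<bullet> D w x))"
        using D_scaleR[OF v, of r] by (intro integral_cong_AE)
          (auto intro!: meas borel_measurable_times V' v w simp: G_pt_scaleR)
      then show ?thesis using w by (simp add: G_op_eq functional_on_def scaleR_fun_def)
    qed (simp add: G_op_eq functional_on_def scaleR_fun_def)
  qed
  moreover have "nrm (dual_space Y) (G_op \<Omega> \<phi> D Y u v)
      \<le> K * root s (3 ^ s * sqrt (measure M (space M))) * c * nrm V v" if v: "v \<in> carr V" for v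
  proof -
    note [measurable] = gm[OF v] D_meas[OF v]
    have "(LINT x|M. norm (G_pt (\<phi> x) (D u x) (D v x)) ^ s) \<le> (LINT x|M. 3 ^ s * norm (D v x) ^ s)"
      using D_power_s(1)[OF v]
      by (intro integral_mono_AE integrable_G_pt u v G_pt_power_bound) auto
    \<comment> \<open>The indicator of the whole space is inserted to match
      \<open>D_power_s\<close>.\<close>
    also have "\<dots> = 3 ^ s * (LINT x|M. norm (D v x) ^ s * indicator (space M) x)"
      by (auto intro!: Bochner_Integration.integral_cong)
    also have "\<dots> \<le> 3 ^ s * ((c * nrm V v) ^ s * sqrt (measure M (space M)))"
      by (intro mult_left_mono order_trans[OF D_power_s(2)[OF v sets.top]] mult_right_mono
          sqrt_D_bound v) auto
    finally have "root s (LINT x|M. norm (G_pt (\<phi> x) (D u x) (D v x)) ^ s)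
        \<le> root s ((3 ^ s * sqrt (measure M (space M))) * (c * nrm V v) ^ s)"
      using s by (simp add: mult_ac)
    also have "\<dots> = root s (3 ^ s * sqrt (measure M (space M))) * (c * nrm V v)"
      using s c nrm_V[of v] by (simp add: real_root_mult real_root_power_cancel)
    finally have "K * root s (LINT x|M. norm (G_pt (\<phi> x) (D u x) (D v x)) ^ s)
        \<le> K * (root s (3 ^ s * sqrt (measure M (space M))) * (c * nrm V v))"
      using K by (rule mult_left_mono)
    then show ?thesis using pf(3)[OF v v] by (simp add: mult_ac)
  qed
  ultimately show ?thesis
    using pf(1) unfolding bounded_linear_maps_def by blast
qed

section \<open>The exceptional set, the remainder estimate and the Newton limit\<close>

definition far :: "(real^'n \<Rightarrow> real) \<Rightarrow> (real^'n \<Rightarrow> real) \<Rightarrow> (real^'n) set" where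
  "far u h = {x \<in> space M. kink_dist (\<phi> x) (norm (D u x)) \<le> norm (D h x)}"

lemma far_measurable [measurable]:
  assumes "u \<in> carr V" "h \<in> carr V"
  shows "far u h \<in> sets M"
proof -
  note [measurable] = D_meas[OF assms(1)] D_meas[OF assms(2)]
  show ?thesis unfolding far_def by measurable
qed

text \<open>With k = |D h|, both pointwise bounds are contained in |R| \<le> C k (k + 1_far). Taking
  s-th powers and integrating gives a multiple of \<open>J\<close> plus the integral of k^s over
  \<open>far\<close>, and Cauchy-Schwarz extracts \<open>sqrt J\<close> from the latter.\<close>

lemma remainder_estimate:
  assumes u: "u \<in> carr V" and h: "h \<in> carr V"
  defines "J \<equiv> (LINT x|M. norm (D h x) ^ (2 * s))"
  shows "0 \<le> nrm (dual_space Y) (P_op \<Omega> \<phi> D Y (u + h) - P_op \<Omega> \<phi> D Y u - G_op \<Omega> \<phi> D Y (u + h) h)"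
    and "nrm (dual_space Y) (P_op \<Omega> \<phi> D Y (u + h) - P_op \<Omega> \<phi> D Y u - G_op \<Omega> \<phi> D Y (u + h) h)
      \<le> K * (2 * (6 + 3 / \<nu>)) * c * nrm V h * root s (sqrt J + sqrt (measure M (far u h)))"
proof -
  define R where "R x = P_pt (\<phi> x) (D (u + h) x) - P_pt (\<phi> x) (D u x)
    - G_pt (\<phi> x) (D (u + h) x) (D h x)" for x
  \<comment> \<open>Dominates both the Lipschitz constant 6 and the quadratic constant 3 +
    3/\<nu>.\<close>
  define C where "C = 6 + 3 / \<nu>"
  have C: "0 < C" using \<nu> by (simp add: C_def add_pos_pos)
  have uh: "u + h \<in> carr V" using V u h by (rule subspace_add)
  note [measurable] = D_meas[OF u] D_meas[OF h] D_meas[OF uh]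
  have B [measurable]: "far u h \<in> sets M" using u h by measurable
  have Rm [measurable]: "R \<in> borel_measurable M" unfolding R_def by measurable
  have J0: "0 \<le> J" by (simp add: J_def)
  have Rb: "AE x in M. norm (R x) ^ s
      \<le> (2 * C) ^ s * (norm (D h x) ^ (2 * s) + norm (D h x) ^ s * indicator (far u h) x)"
    using \<phi>_ge D_add[OF u h] AE_space
  proof eventually_elim
    case (elim x)
    define k where "k = norm (D h x)"
    have k0: "0 \<le> k" by (simp add: k_def)
    \<comment> \<open>The increment is written as a difference of two points, the shape of the
      pointwise estimates; this uses additivity of \<open>D\<close> at almost every x.\<close>
    have Rx: "R x = P_pt (\<phi> x) (D u x + D h x) - P_pt (\<phi> x) (D u x)
        - G_pt (\<phi> x) (D u x + D h x) (D u x + D h x - D u x)"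
      using elim by (simp add: R_def)
    have "norm (R x) \<le> C * k * (k + indicator (far u h) x)"
    proof (cases "x \<in> far u h")
      case True
      have "norm (R x) \<le> 6 * k"
        unfolding Rx k_def using \<nu> elim
        by (intro order_trans[OF remainder_lipschitz]) auto
      also have "\<dots> \<le> C * k * (k + 1)"
        using \<nu> k0 unfolding C_def mult.assoc by (intro mult_mono) (auto simp: distrib_left)
      finally show ?thesis using True by simp
    next
      case False
      then have "k < kink_dist (\<phi> x) (norm (D u x))"
        using elim by (auto simp: far_def k_def)
      then have "norm (R x) \<le> (3 + 3 / \<nu>) * k\<^sup>2"
        unfolding Rx using \<nu> elim by (intro order_trans[OF remainder_quadratic]) (auto simp: k_def)
      also have "\<dots> \<le> C * k\<^sup>2"
        unfolding C_def by (intro mult_right_mono) auto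
      finally show ?thesis using False by (simp add: power2_eq_square mult.assoc)
    qed
    then have "norm (R x) ^ s \<le> (C * k * (k + indicator (far u h) x)) ^ s"
      by (intro power_mono) auto
    also have "\<dots> = C ^ s * k ^ s * (k + indicator (far u h) x) ^ s"
      by (simp add: power_mult_distrib)
    also have "\<dots> \<le> C ^ s * k ^ s * (2 ^ s * (k ^ s + indicator (far u h) x ^ s))"
      using C k0 by (intro mult_left_mono add_power_le) auto
    also have "indicator (far u h) x ^ s = (indicator (far u h) x :: real)"
      using s by (simp add: indicator_def)
    finally show ?case
      unfolding k_def mult_2 power_add by (simp add: algebra_simps power_mult_distrib)
  qed
  have int: "integrable M (\<lambda>x. norm (D h x) ^ (2 * s))"
    "integrable M (\<lambda>x. norm (D h x) ^ s * indicator (far u h) x)"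
    using D_integrable[OF h] D_power_s(3)[OF h B] by auto
  have Rint: "integrable M (\<lambda>x. norm (R x) ^ s)"
  proof (rule Bochner_Integration.integrable_bound)
    show "integrable M (\<lambda>x. (2 * C) ^ s *
        (norm (D h x) ^ (2 * s) + norm (D h x) ^ s * indicator (far u h) x))"
      using int by simp
    show "AE x in M. norm (norm (R x) ^ s) \<le> norm ((2 * C) ^ s *
        (norm (D h x) ^ (2 * s) + norm (D h x) ^ s * indicator (far u h) x))"
      using Rb by eventually_elim (simp add: abs_of_nonneg)
  qed measurable
  have "(LINT x|M. norm (R x) ^ s) \<le> (LINT x|M. (2 * C) ^ s *
      (norm (D h x) ^ (2 * s) + norm (D h x) ^ s * indicator (far u h) x))"
    using int by (intro integral_mono_AE Rint Rb) simp
  also have "\<dots> = (2 * C) ^ s * (J + (LINT x|M. norm (D h x) ^ s * indicator (far u h) x))"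
    using int by (simp add: J_def)
  also have "\<dots> \<le> (2 * C) ^ s * (J + sqrt J * sqrt (measure M (far u h)))"
    using C D_power_s(2)[OF h B] by (simp add: J_def)
  \<comment> \<open>The s-th root of the factor \<open>sqrt J\<close> is of the order of the norm of
    h; the bracket only has to tend to 0.\<close>
  also have "J + sqrt J * sqrt (measure M (far u h)) = sqrt J * (sqrt J + sqrt (measure M (far u h)))"
    using J0 by (simp add: distrib_left)
  finally have "root s (LINT x|M. norm (R x) ^ s)
      \<le> root s ((2 * C) ^ s * (sqrt J * (sqrt J + sqrt (measure M (far u h)))))"
    using s by simp
  also have "\<dots> = 2 * C * root s (sqrt J) * root s (sqrt J + sqrt (measure M (far u h)))"
    using s C by (simp add: real_root_mult real_root_power_cancel mult.assoc)
  also have "\<dots> \<le> 2 * C * (c * nrm V h) * root s (sqrt J + sqrt (measure M (far u h)))"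
  proof (intro mult_right_mono mult_left_mono)
    have "root s (sqrt J) \<le> root s ((c * nrm V h) ^ s)"
      using s sqrt_D_bound[OF h] by (simp add: J_def)
    then show "root s (sqrt J) \<le> c * nrm V h"
      using s c nrm_V[of h] by (simp add: real_root_power_cancel)
  qed (use C s J0 in auto)
  finally have Rroot: "root s (LINT x|M. norm (R x) ^ s)
    \<le> 2 * C * (c * nrm V h) * root s (sqrt J + sqrt (measure M (far u h)))" .
  have eq: "P_op \<Omega> \<phi> D Y (u + h) - P_op \<Omega> \<phi> D Y u - G_op \<Omega> \<phi> D Y (u + h) h
      = functional_on Y (\<lambda>w. LINT x|M. R x \<bullet> D w x)"
  proof
    fix w
    show "(P_op \<Omega> \<phi> D Y (u + h) - P_op \<Omega> \<phi> D Y u - G_op \<Omega> \<phi> D Y (u + h) h) w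
      = functional_on Y (\<lambda>w. LINT x|M. R x \<bullet> D w x) w"
    proof (cases "w \<in> carr Y")
      case True
      have "integrable M (\<lambda>x. P_pt (\<phi> x) (D (u + h) x) \<bullet> D w x)"
        "integrable M (\<lambda>x. P_pt (\<phi> x) (D u x) \<bullet> D w x)"
        "integrable M (\<lambda>x. G_pt (\<phi> x) (D (u + h) x) (D h x) \<bullet> D w x)"
        by (auto intro!: pairing_integrable True integrable_P_pt integrable_G_pt u h uh)
      then show ?thesis
        using True by (simp add: P_op_eq G_op_eq functional_on_def R_def inner_diff_left)
    qed (simp add: P_op_eq G_op_eq functional_on_def)
  qed
  show "0 \<le> nrm (dual_space Y) (P_op \<Omega> \<phi> D Y (u + h) - P_op \<Omega> \<phi> D Y u - G_op \<Omega> \<phi> D Y (u + h) h)"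
    unfolding eq by (rule pairing_functional(2)[OF Rm Rint])
  show "nrm (dual_space Y) (P_op \<Omega> \<phi> D Y (u + h) - P_op \<Omega> \<phi> D Y u - G_op \<Omega> \<phi> D Y (u + h) h)
      \<le> K * (2 * (6 + 3 / \<nu>)) * c * nrm V h * root s (sqrt J + sqrt (measure M (far u h)))"
    unfolding eq C_def[symmetric]
    using pairing_functional(3)[OF Rm Rint] mult_left_mono[OF Rroot K] by (simp add: mult_ac)
qed

text \<open>On \<open>far\<close> either the kink distance is below \<eta> or |D h| is at least
  \<eta>. The second event is handled by Markov's inequality for the power 2s, the one that
  \<open>D_bound\<close> controls.\<close>

lemma measure_far_le:
  assumes u: "u \<in> carr V" and h: "h \<in> carr V" and \<eta>: "0 < \<eta>"
  shows "measure M (far u h) \<le> measure M {x \<in> space M. kink_dist (\<phi> x) (norm (D u x)) < \<eta>}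
    + (LINT x|M. norm (D h x) ^ (2 * s)) / \<eta> ^ (2 * s)"
proof -
  note [measurable] = D_meas[OF u] D_meas[OF h]
  let ?A = "{x \<in> space M. kink_dist (\<phi> x) (norm (D u x)) < \<eta>}"
  let ?E = "{x \<in> space M. \<eta> ^ (2 * s) \<le> norm (D h x) ^ (2 * s)}"
  have AE [measurable]: "?A \<in> sets M" "?E \<in> sets M" by measurable
  have "far u h \<subseteq> ?A \<union> ?E"
    using \<eta> by (auto simp: far_def intro!: power_mono)
  then have "measure M (far u h) \<le> measure M (?A \<union> ?E)"
    by (rule M.finite_measure_mono) (rule sets.Un[OF AE])
  also have "\<dots> \<le> measure M ?A + measure M ?E"
    by (rule measure_Un_le[OF AE])
  also have "measure M ?E \<le> (LINT x|M. norm (D h x) ^ (2 * s)) / \<eta> ^ (2 * s)"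
    using \<eta> by (intro integral_Markov_inequality_measure[where A = "space M"] D_integrable h) auto
  finally show ?thesis by simp
qed

lemma newton_limit_P_op:
  assumes u: "u \<in> carr V"
  shows "newton_limit V (dual_space Y) (carr V) (P_op \<Omega> \<phi> D Y) (G_op \<Omega> \<phi> D Y) u"
proof -
  note [measurable] = D_meas[OF u]
  define F where "F = inf (filtercomap (nrm V) (at_right 0)) (principal {h \<in> carr V. u + h \<in> carr V})"
  define J where "J h = (LINT x|M. norm (D h x) ^ (2 * s))" for h
  define N where "N h = nrm (dual_space Y)
    (P_op \<Omega> \<phi> D Y (u + h) - P_op \<Omega> \<phi> D Y u - G_op \<Omega> \<phi> D Y (u + h) h)" for h
  have inV: "\<forall>\<^sub>F h in F. h \<in> carr V"
    unfolding F_def by (auto simp: eventually_inf_principal)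
  \<comment> \<open>The filter excludes increments of norm 0, so the quotient can be cleared of its
    denominator.\<close>
  have pos: "\<forall>\<^sub>F h in F. 0 < nrm V h"
  proof -
    have "\<forall>\<^sub>F h in filtercomap (nrm V) (at_right 0). 0 < nrm V h"
      by (intro eventually_filtercomapI) (auto simp: eventually_at_filter)
    then show ?thesis unfolding F_def by (simp add: eventually_inf_principal eventually_mono)
  qed
  have lim: "((nrm V) \<longlongrightarrow> 0) F"
  proof -
    have "filterlim (nrm V) (at_right 0) (filtercomap (nrm V) (at_right 0))"
      by (rule filterlim_filtercomap)
    then have "filterlim (nrm V) (nhds 0) (filtercomap (nrm V) (at_right 0))"
      by (rule filterlim_mono) (auto simp: at_within_le_nhds)
    then show ?thesis unfolding F_def by (rule filterlim_mono) auto
  qed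
  have J0: "0 \<le> J h" for h by (simp add: J_def)
  have limJ: "(J \<longlongrightarrow> 0) F"
  proof (rule tendsto_sandwich)
    show "\<forall>\<^sub>F h in F. 0 \<le> J h" using J0 by simp
    show "\<forall>\<^sub>F h in F. J h \<le> (c * nrm V h) ^ (2 * s)"
      using inV by eventually_elim (simp add: J_def D_bound)
    have "((\<lambda>h. (c * nrm V h) ^ (2 * s)) \<longlongrightarrow> (c * 0) ^ (2 * s)) F"
      by (intro tendsto_intros lim)
    moreover have "(c * (0::real)) ^ (2 * s) = 0" using s by simp
    ultimately show "((\<lambda>h. (c * nrm V h) ^ (2 * s)) \<longlongrightarrow> 0) F" by (simp only:)
  qed simp
  \<comment> \<open>The threshold \<eta> depends on u alone and is fixed before h becomes small;
    each of the two contributions takes half of \<epsilon>.\<close>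
  have limB: "((\<lambda>h. measure M (far u h)) \<longlongrightarrow> 0) F"
  proof (rule order_tendstoI)
    fix \<epsilon> :: real assume "0 < \<epsilon>"
    then obtain \<eta> where \<eta>: "0 < \<eta>"
      "measure M {x \<in> space M. kink_dist (\<phi> x) (norm (D u x)) < \<eta>} < \<epsilon> / 2"
      using M.measure_sublevel_tendsto_0[of "\<lambda>x. kink_dist (\<phi> x) (norm (D u x))" "\<epsilon> / 2"]
      by (auto simp: kink_dist_pos)
    have "((\<lambda>h. J h / \<eta> ^ (2 * s)) \<longlongrightarrow> 0 / \<eta> ^ (2 * s)) F"
      using \<eta> by (intro tendsto_intros limJ) auto
    then have "\<forall>\<^sub>F h in F. J h / \<eta> ^ (2 * s) < \<epsilon> / 2"
      using \<open>0 < \<epsilon>\<close> by (intro order_tendstoD) auto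
    with inV show "\<forall>\<^sub>F h in F. measure M (far u h) < \<epsilon>"
    proof eventually_elim
      case (elim h)
      then show ?case using measure_far_le[OF u elim(1) \<eta>(1)] \<eta>(2) unfolding J_def by linarith
    qed
  next
    fix a :: real assume "a < 0"
    then show "\<forall>\<^sub>F h in F. a < measure M (far u h)"
      by (intro always_eventually allI) (meson less_le_trans measure_nonneg)
  qed
  define E where "E h = root s (sqrt (J h) + sqrt (measure M (far u h)))" for h
  have "((\<lambda>h. K * (2 * (6 + 3 / \<nu>)) * c * E h) \<longlongrightarrow>
      K * (2 * (6 + 3 / \<nu>)) * c * root s (sqrt 0 + sqrt 0)) F"
    unfolding E_def by (intro tendsto_intros limJ limB)
  then have limE: "((\<lambda>h. K * (2 * (6 + 3 / \<nu>)) * c * E h) \<longlongrightarrow> 0) F" using s by simp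
  have "((\<lambda>h. N h / nrm V h) \<longlongrightarrow> 0) F"
  proof (rule tendsto_sandwich[OF _ _ _ limE])
    show "\<forall>\<^sub>F h in F. 0 \<le> N h / nrm V h"
      using inV by eventually_elim (auto simp: N_def intro!: divide_nonneg_nonneg remainder_estimate(1) u nrm_V)
    show "\<forall>\<^sub>F h in F. N h / nrm V h \<le> K * (2 * (6 + 3 / \<nu>)) * c * E h"
      using inV pos
    proof eventually_elim
      case (elim h)
      then show ?case
        using remainder_estimate(2)[OF u elim(1)]
        by (simp add: N_def E_def J_def pos_divide_le_eq mult_ac)
    qed
  qed simp
  then show ?thesis unfolding newton_limit_def F_def N_def .
qed

theorem has_newton_derivative_P_op:
  "has_newton_derivative V (dual_space Y) (carr V) (P_op \<Omega> \<phi> D Y) (G_op \<Omega> \<phi> D Y)"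
  unfolding has_newton_derivative_def
proof (intro conjI ballI)
  show "open_subset V (carr V)" unfolding open_subset_def by (auto intro: exI[of _ 1])
qed (use P_op_in_dual G_op_bounded_linear newton_limit_P_op in auto)

end

section \<open>Smooth bump functions and the fundamental lemma of the calculus of variations\<close>

lemma poly_times_exp_tendsto_0:
  fixes q :: "real poly"
  shows "((\<lambda>t. poly q t * exp (- t)) \<longlongrightarrow> 0) at_top"
proof -
  have "((\<lambda>t. \<Sum>i\<le>degree q. coeff q i * (t ^ i / exp t)) \<longlongrightarrow> (\<Sum>i\<le>degree q. coeff q i * 0)) at_top"
    by (intro tendsto_intros tendsto_power_div_exp_0)
  then show ?thesis
    by (simp add: poly_altdef exp_minus divide_inverse sum_distrib_right mult.assoc)
qed

text \<open>These functions are closed under differentiation, which yields smoothness of all orders at once.\<close>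

definition exp_pole :: "real poly \<Rightarrow> real \<Rightarrow> real" where
  "exp_pole p s = (if s \<le> 0 then 0 else poly p (1 / s) * exp (- (1 / s)))"

text \<open>Differentiating p(1/s) exp(-1/s) gives (p - p')(1/s) exp(-1/s) / s^2; the factor 1/s^2
  is absorbed by multiplying the polynomial by X^2. At 0 the exponential beats every power.\<close>

lemma DERIV_exp_pole:
  "(exp_pole p has_real_derivative exp_pole ([:0, 0, 1:] * (p - pderiv p)) s) (at s)"
proof -
  consider "s < 0" | "s = 0" | "0 < s" by linarith
  then show ?thesis
  proof cases
    case 1
    have "((\<lambda>_. 0) has_real_derivative 0) (at s)" by simp
    then have "(exp_pole p has_real_derivative 0) (at s)"
      by (rule has_field_derivative_transform_within[where d = "- s"]) (use 1 in \<open>auto simp: exp_pole_def dist_real_def\<close>)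
    then show ?thesis using 1 by (simp add: exp_pole_def)
  next
    case 2
    have "filterlim (\<lambda>h::real. 1 / h) at_top (at_right 0)"
      by (simp add: divide_inverse filterlim_inverse_at_top_right)
    \<comment> \<open>\<open>pCons 0 p\<close> is X p, which absorbs the division by h in the
      difference quotient.\<close>
    then have "((\<lambda>h. poly (pCons 0 p) (1 / h) * exp (- (1 / h))) \<longlongrightarrow> 0) (at_right 0)"
      by (rule filterlim_compose[OF poly_times_exp_tendsto_0])
    then have r: "((\<lambda>h. exp_pole p h / h) \<longlongrightarrow> 0) (at_right 0)"
      by (rule Lim_transform_eventually)
        (auto simp: eventually_at_filter exp_pole_def intro!: always_eventually)
    have l: "((\<lambda>h. exp_pole p h / h) \<longlongrightarrow> 0) (at_left 0)"
      by (rule Lim_transform_eventually[OF tendsto_const])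
        (auto simp: eventually_at_filter exp_pole_def intro!: always_eventually)
    have "((\<lambda>h. exp_pole p h / h) \<longlongrightarrow> 0) (at 0)"
      using l r by (rule filterlim_split_at)
    then show ?thesis using 2 by (simp add: DERIV_def exp_pole_def)
  next
    case 3
    have "((\<lambda>s. poly p (1 / s) * exp (- (1 / s))) has_real_derivative
        (poly (pderiv p) (1 / s) * (- 1 / s\<^sup>2)) * exp (- (1 / s))
        + (exp (- (1 / s)) * (1 / s\<^sup>2)) * poly p (1 / s)) (at s)"
    proof (rule DERIV_mult)
      have inv: "((\<lambda>s. 1 / s) has_real_derivative - 1 / s\<^sup>2) (at s)"
        using 3 by (auto intro!: derivative_eq_intros simp: power2_eq_square)
      show "((\<lambda>s. poly p (1 / s)) has_real_derivative poly (pderiv p) (1 / s) * (- 1 / s\<^sup>2)) (at s)"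
        by (rule DERIV_chain2[OF poly_DERIV inv])
      show "((\<lambda>s. exp (- (1 / s))) has_real_derivative exp (- (1 / s)) * (1 / s\<^sup>2)) (at s)"
        using 3 by (auto intro!: derivative_eq_intros simp: power2_eq_square)
    qed
    then have "(exp_pole p has_real_derivative
        (poly (pderiv p) (1 / s) * (- 1 / s\<^sup>2)) * exp (- (1 / s))
        + (exp (- (1 / s)) * (1 / s\<^sup>2)) * poly p (1 / s)) (at s)"
      by (rule has_field_derivative_transform_within[where d = s]) (use 3 in \<open>auto simp: exp_pole_def dist_real_def\<close>)
    then show ?thesis
      by (rule DERIV_cong) (use 3 in \<open>simp add: exp_pole_def power2_eq_square algebra_simps\<close>)
  qed
qed

lemma exp_pole_1_pos_iff: "exp_pole 1 s \<noteq> 0 \<longleftrightarrow> 0 < s"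
  by (auto simp: exp_pole_def)

lemma exp_pole_1_bounds: "0 \<le> exp_pole 1 s" "exp_pole 1 s \<le> 1"
  by (auto simp: exp_pole_def)

lemma exp_pole_1_tendsto:
  "(\<lambda>n. exp_pole 1 (real (Suc n) * t)) \<longlonglongrightarrow> (if 0 < t then 1 else 0)"
proof (cases "0 < t")
  case True
  have "(\<lambda>n. exp (- (inverse (real (Suc n)) * (1 / t)))) \<longlonglongrightarrow> exp (- (0 * (1 / t)))"
    by (intro tendsto_intros LIMSEQ_inverse_real_of_nat)
  moreover have "exp_pole 1 (real (Suc n) * t) = exp (- (inverse (real (Suc n)) * (1 / t)))" for n
    using True by (auto simp: exp_pole_def divide_inverse mult_le_0_iff)
  ultimately show ?thesis using True by simp
next
  case False
  then have "exp_pole 1 (real (Suc n) * t) = 0" for n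
    by (simp add: exp_pole_def mult_le_0_iff)
  then show ?thesis using False by simp
qed

text \<open>A coinduction principle for smoothness: it suffices to exhibit a class of differentiable
  functions closed under partial derivatives, and no rule for \<open>Ck\<close> under products or
  compositions is needed.\<close>

lemma Ck_coinduct:
  assumes "\<And>f. f \<in> S \<Longrightarrow> (\<forall>x. f differentiable (at x)) \<and> (\<forall>i. partial i f \<in> S)" "f \<in> S"
  shows "Ck k f"
  using assms(2)
proof (induction k arbitrary: f)
  case 0
  then show ?case
    using assms(1) by (auto intro!: differentiable_imp_continuous_on simp: differentiable_on_def differentiable_at_withinI)
next
  case (Suc k)
  then show ?case using assms(1) by auto
qed

lemma Ck_all_unfold:
  assumes "\<forall>k. Ck k f"
  shows "f differentiable (at x)" "\<forall>k. Ck k (partial i f)"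
proof -
  have "Ck (Suc k) f" for k using assms by blast
  then show "f differentiable (at x)" "\<forall>k. Ck k (partial i f)" by auto
qed

lemma partial_eq: "(f has_derivative f') (at x) \<Longrightarrow> partial i f x = f' (axis i 1)"
  unfolding partial_def by (simp add: frechet_derivative_at[symmetric])

text \<open>Tailored to \<open>Ck_coinduct\<close>: arbitrary polynomials in \<open>exp_pole\<close>
  keep the generators closed under differentiation, constants serve as inner derivatives, and the
  product rule needs sums and products.\<close>

inductive_set smooth_class :: "(real^'n \<Rightarrow> real) set" where
  coord: "(\<lambda>x. exp_pole p (c * x $ i + d)) \<in> smooth_class"
| const: "(\<lambda>x. r) \<in> smooth_class"
| add: "f \<in> smooth_class \<Longrightarrow> g \<in> smooth_class \<Longrightarrow> (\<lambda>x. f x + g x) \<in> smooth_class"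
| mult: "f \<in> smooth_class \<Longrightarrow> g \<in> smooth_class \<Longrightarrow> (\<lambda>x. f x * g x) \<in> smooth_class"

lemma smooth_class_closed:
  fixes f :: "real^'n \<Rightarrow> real"
  assumes "f \<in> smooth_class"
  shows "(\<forall>x. f differentiable (at x)) \<and> (\<forall>i. partial i f \<in> smooth_class)"
  using assms
proof induction
  case (coord p c j d)
  define q where "q = [:0, 0, 1:] * (p - pderiv p)"
  have D: "((\<lambda>x::real^'n. exp_pole p (c * x $ j + d)) has_derivative
      (\<lambda>h. exp_pole q (c * x $ j + d) * (c * h $ j))) (at x)" for x
  proof -
    have "((\<lambda>x::real^'n. c * x $ j + d) has_derivative (\<lambda>h. c * h $ j)) (at x)"
      by (auto intro!: derivative_eq_intros bounded_linear.has_derivative[OF bounded_linear_vec_nth])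
    then show ?thesis
      using DERIV_exp_pole[of p "c * x $ j + d", folded q_def]
      unfolding has_field_derivative_def by (rule has_derivative_compose[of _ _ _ UNIV, simplified])
  qed
  have "partial i (\<lambda>x::real^'n. exp_pole p (c * x $ j + d))
      = (\<lambda>x. (c * axis i 1 $ j) * exp_pole q (c * x $ j + d))" for i
    using partial_eq[OF D] by (auto simp: mult_ac)
  moreover have "(\<lambda>x::real^'n. (c * axis i 1 $ j) * exp_pole q (c * x $ j + d)) \<in> smooth_class" for i
    by (intro smooth_class.intros)
  ultimately show ?case using D by (auto simp: differentiable_def)
next
  case (const r)
  have "partial i (\<lambda>x::real^'n. r) = (\<lambda>x. 0)" for i
    using partial_eq[OF has_derivative_const[of r]] by auto
  then show ?case using smooth_class.const[of 0] by simp
next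
  case (add f g)
  have D: "(f has_derivative frechet_derivative f (at x)) (at x)"
    "(g has_derivative frechet_derivative g (at x)) (at x)" for x
    using add.IH by (auto simp: frechet_derivative_works[symmetric])
  have "partial i (\<lambda>x. f x + g x) = (\<lambda>x. partial i f x + partial i g x)" for i
    using partial_eq[OF has_derivative_add[OF D]] by (auto simp: partial_def)
  then show ?case using add.IH by (auto intro: smooth_class.intros)
next
  case (mult f g)
  have D: "(f has_derivative frechet_derivative f (at x)) (at x)"
    "(g has_derivative frechet_derivative g (at x)) (at x)" for x
    using mult.IH by (auto simp: frechet_derivative_works[symmetric])
  have "partial i (\<lambda>x. f x * g x) = (\<lambda>x. f x * partial i g x + partial i f x * g x)" for i
    using partial_eq[OF has_derivative_mult[OF D]] by (auto simp: partial_def)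
  then show ?case using mult.IH mult.hyps by (auto intro!: smooth_class.intros)
qed

lemma smooth_class_prod:
  "finite A \<Longrightarrow> (\<And>i. i \<in> A \<Longrightarrow> f i \<in> smooth_class) \<Longrightarrow> (\<lambda>x. \<Prod>i\<in>A. f i x) \<in> smooth_class"
  by (induction A rule: finite_induct) (auto intro: smooth_class.intros)

text \<open>The factor \<open>Suc n\<close> in the arguments makes the bumps converge to the indicator of the box.\<close>

definition box_bump :: "real^'n \<Rightarrow> real^'n \<Rightarrow> nat \<Rightarrow> real^'n \<Rightarrow> real" where
  "box_bump a b n x = (\<Prod>i\<in>UNIV. exp_pole 1 (real (Suc n) * (x $ i - a $ i))
     * exp_pole 1 (real (Suc n) * (b $ i - x $ i)))"

lemma box_bump_nonzero_iff: "box_bump a b n x \<noteq> 0 \<longleftrightarrow> x \<in> box a b"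
  by (auto simp: box_bump_def mem_box_cart exp_pole_1_pos_iff zero_less_mult_iff simp del: of_nat_Suc)

lemma box_bump_bounds: "0 \<le> box_bump a b n x" "box_bump a b n x \<le> 1"
  unfolding box_bump_def
  by (auto intro!: prod_nonneg prod_le_1 mult_nonneg_nonneg mult_le_one exp_pole_1_bounds)

lemma box_bump_tendsto: "(\<lambda>n. box_bump a b n x) \<longlonglongrightarrow> indicator (box a b) x"
proof -
  define L :: real where
    "L = (\<Prod>i\<in>UNIV. (if 0 < x $ i - a $ i then 1 else 0) * (if 0 < b $ i - x $ i then 1 else 0))"
  have "(\<lambda>n. box_bump a b n x) \<longlonglongrightarrow> L"
    unfolding box_bump_def L_def by (intro tendsto_prod tendsto_mult exp_pole_1_tendsto)
  moreover have "L = indicator (box a b) x"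
    by (auto simp: L_def indicator_def mem_box_cart)
  ultimately show ?thesis by simp
qed

lemma box_bump_test_function:
  assumes "cbox a b \<subseteq> \<Omega>"
  shows "box_bump a b n \<in> test_functions \<Omega>"
proof -
  \<comment> \<open>The arguments are rewritten as affine functions of one coordinate, the form of
    the rule \<open>coord\<close>.\<close>
  have "box_bump a b n = (\<lambda>x. \<Prod>i\<in>UNIV. exp_pole 1 (real (Suc n) * x $ i + - (real (Suc n) * a $ i))
      * exp_pole 1 (- real (Suc n) * x $ i + real (Suc n) * b $ i))"
    by (auto simp: box_bump_def fun_eq_iff algebra_simps)
  also have "\<dots> \<in> smooth_class"
    by (intro smooth_class_prod smooth_class.intros) auto
  finally have "Ck k (box_bump a b n)" for k
    by (intro Ck_coinduct[of smooth_class] smooth_class_closed)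
  moreover have "{x. box_bump a b n x \<noteq> 0} = box a b"
    using box_bump_nonzero_iff by blast
  moreover have "closure (box a b) \<subseteq> cbox a b"
    by (intro closure_minimal box_subset_cbox closed_cbox)
  moreover from this have "compact (closure (box a b))"
    by (meson bounded_cbox bounded_subset closed_closure compact_eq_bounded_closed)
  ultimately show ?thesis using assms by (auto simp: test_functions_def)
qed

section \<open>From vanishing test integrals to vanishing almost everywhere\<close>

lemma borel_measurable_continuous_lebesgue:
  fixes f :: "'a::euclidean_space \<Rightarrow> 'b::{second_countable_topology, t2_space}"
  assumes "continuous_on UNIV f"
  shows "f \<in> borel_measurable lebesgue"
  by (rule measurable_completion) (simp add: borel_measurable_continuous_onI[OF assms])

lemma compact_support_bounded:
  fixes f :: "'a::euclidean_space \<Rightarrow> real"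
  assumes "continuous_on UNIV f" "compact K" "\<And>x. x \<notin> K \<Longrightarrow> f x = 0"
  obtains B where "0 \<le> B" "\<And>x. \<bar>f x\<bar> \<le> B"
proof -
  have "bounded (f ` K)"
    using assms by (meson compact_continuous_image compact_imp_bounded continuous_on_subset subset_UNIV)
  then obtain B where B: "\<And>x. x \<in> K \<Longrightarrow> \<bar>f x\<bar> \<le> B"
    by (auto simp: bounded_iff)
  have "\<bar>f x\<bar> \<le> max 0 B" for x
    by (cases "x \<in> K") (auto simp: assms(3) le_max_iff_disj dest: B)
  then show ?thesis by (intro that[of "max 0 B"]) simp_all
qed

text \<open>\<open>f\<close> is integrable only on compact subsets; the bounded factor \<psi>
  confines the product to such a set.\<close>

lemma integrable_mult_compact_support:
  fixes f \<psi> :: "real^'n \<Rightarrow> real"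
  assumes "open \<Omega>" and f: "locally_integrable \<Omega> f"
    and \<psi>: "continuous_on UNIV \<psi>" "compact K" "K \<subseteq> \<Omega>" "\<And>x. x \<notin> K \<Longrightarrow> \<psi> x = 0"
  shows "integrable (lebesgue_on \<Omega>) (\<lambda>x. f x * \<psi> x)"
proof -
  obtain B where B: "0 \<le> B" "\<And>x. \<bar>\<psi> x\<bar> \<le> B" using compact_support_bounded[OF \<psi>(1,2,4)] by blast
  have fK: "integrable lebesgue (\<lambda>x. indicator K x *\<^sub>R f x)"
    using f \<psi> by (auto simp: locally_integrable_def set_integrable_def)
  have [measurable]: "\<psi> \<in> borel_measurable lebesgue"
    by (rule borel_measurable_continuous_lebesgue[OF \<psi>(1)])
  have eq: "(\<lambda>x. indicator \<Omega> x *\<^sub>R (f x * \<psi> x)) = (\<lambda>x. (indicator K x *\<^sub>R f x) * \<psi> x)"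
    using \<psi> by (fastforce simp: indicator_def fun_eq_iff)
  have "integrable lebesgue (\<lambda>x. (indicator K x *\<^sub>R f x) * \<psi> x)"
  proof (rule Bochner_Integration.integrable_bound)
    show "integrable lebesgue (\<lambda>x. B * (indicator K x *\<^sub>R f x))" using fK by (rule integrable_mult_right)
    show "(\<lambda>x. (indicator K x *\<^sub>R f x) * \<psi> x) \<in> borel_measurable lebesgue"
      using fK by measurable
    show "AE x in lebesgue. norm ((indicator K x *\<^sub>R f x) * \<psi> x) \<le> norm (B * (indicator K x *\<^sub>R f x))"
    proof (rule AE_I2)
      fix x
      have "\<bar>indicator K x * f x\<bar> * \<bar>\<psi> x\<bar> \<le> \<bar>indicator K x * f x\<bar> * \<bar>B\<bar>"
        using B by (intro mult_left_mono) (auto intro: order_trans)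
      then show "norm ((indicator K x *\<^sub>R f x) * \<psi> x) \<le> norm (B * (indicator K x *\<^sub>R f x))"
        by (simp add: abs_mult mult_ac)
    qed
  qed
  then have "integrable lebesgue (\<lambda>x. indicator \<Omega> x *\<^sub>R (f x * \<psi> x))" unfolding eq .
  then show ?thesis
    using \<open>open \<Omega>\<close> by (subst integrable_restrict_space) auto
qed

text \<open>Boxes are stable under intersection and generate the Borel sets, so a Dynkin argument
  makes all Borel integrals vanish; the density of the zero signed measure is then 0.\<close>

lemma AE_eq_0_if_box_integrals_0:
  fixes f :: "'a::euclidean_space \<Rightarrow> real"
  assumes f: "integrable lebesgue f"
    and box: "\<And>a b. (LINT x:box a b|lebesgue. f x) = 0"
  shows "AE x in lebesgue. f x = 0"
proof (rule density_unique_real[OF f, of "\<lambda>_. 0"])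
  have fS: "set_integrable lebesgue A f" if "A \<in> sets lebesgue" for A
    unfolding set_integrable_def using that f by (rule integrable_mult_indicator)
  \<comment> \<open>Needed for the complement step of the Dynkin argument; the whole space is
    exhausted by growing boxes.\<close>
  have UNIV0: "(LINT x:UNIV|lebesgue. f x) = 0"
  proof -
    let ?A = "\<lambda>n::nat. box (- (real n *\<^sub>R One)) (real n *\<^sub>R One) :: 'a set"
    have "(\<lambda>n. (LINT x:?A n|lebesgue. f x)) \<longlonglongrightarrow> (LINT x:(\<Union>n. ?A n)|lebesgue. f x)"
    proof (rule set_integral_cont_up)
      show "incseq ?A"
        unfolding incseq_def by (auto intro!: subset_box_imp)
      show "set_integrable lebesgue (\<Union>n. ?A n) f" by (intro fS) auto
    qed auto
    then have "(\<lambda>n. 0) \<longlonglongrightarrow> (LINT x:UNIV|lebesgue. f x)"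
      unfolding box UN_box_eq_UNIV .
    then show ?thesis by (simp add: LIMSEQ_const_iff)
  qed
  have borel0: "(LINT x:A|lebesgue. f x) = 0" if "A \<in> sets borel" for A
  proof -
    let ?E = "range (\<lambda>(a, b). box a b :: 'a set)"
    have E: "sigma_sets UNIV ?E = sets borel" by (simp add: borel_eq_box)
    have leb: "B \<in> sets lebesgue" if "B \<in> sigma_sets UNIV ?E" for B
      using that unfolding E by (intro sets_completionI_sets) simp
    have "Int_stable ?E" by (auto simp: Int_stable_def box_Int_box)
    moreover have "?E \<subseteq> Pow UNIV" by auto
    moreover have "A \<in> sigma_sets UNIV ?E" using that E by simp
    ultimately show ?thesis
    proof (induction rule: sigma_sets_induct_disjoint)
      case (basic A)
      then show ?case using box by auto
    next
      case empty
      then show ?case by (simp add: set_lebesgue_integral_def)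
    next
      case (compl A)
      have "(LINT x:A \<union> (UNIV - A)|lebesgue. f x)
          = (LINT x:A|lebesgue. f x) + (LINT x:UNIV - A|lebesgue. f x)"
        using leb[OF compl.hyps] by (intro set_integral_Un fS) auto
      then show ?case using UNIV0 compl.IH by simp
    next
      case (union A)
      have "(LINT x:(\<Union>i. A i)|lebesgue. f x) = (\<Sum>i. (LINT x:A i|lebesgue. f x))"
      proof (rule lebesgue_integral_countable_add)
        show "A i \<in> sets lebesgue" for i using union by (intro leb) auto
        then show "set_integrable lebesgue (\<Union>i. A i) f" by (intro fS) auto
      qed (use union in \<open>auto simp: disjoint_family_on_def\<close>)
      then show ?case using union by simp
    qed
  qed
  \<comment> \<open>A Lebesgue set is a Borel set up to a null set, which does not change the
    integral.\<close>
  fix A :: "'a set" assume A: "A \<in> sets lebesgue"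
  then obtain S N N' where SN: "A = S \<union> N" "S \<in> sets lborel" "N' \<in> null_sets lborel" "N \<subseteq> N'"
    by (elim sets_completionE)
  have S: "S \<in> sets lebesgue" using SN(2) by simp
  have "AE x in lebesgue. x \<notin> N'"
    using SN(3) null_sets_completionI by (intro AE_not_in) auto
  then have "(LINT x:A|lebesgue. f x) = (LINT x:S|lebesgue. f x)"
    using SN A S f unfolding set_lebesgue_integral_def
    by (intro integral_cong_AE borel_measurable_scaleR borel_measurable_indicator)
      (auto simp: indicator_def)
  then show "(LINT x:A|lebesgue. f x) = (LINT x:A|lebesgue. 0)" using borel0 SN(2) by simp
qed simp

text \<open>The bumps of a box are admissible and converge boundedly to its indicator, so by
  dominated convergence \<open>f\<close> integrates to 0 over every box whose closed box lies in the
  domain. The box criterion and a countable cover finish.\<close>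

lemma fundamental_lemma_variations:
  fixes f :: "real^'n \<Rightarrow> real"
  assumes "open \<Omega>" and f: "locally_integrable \<Omega> f"
    and zero: "\<And>\<psi>. \<psi> \<in> test_functions \<Omega> \<Longrightarrow> (LINT x|lebesgue_on \<Omega>. f x * \<psi> x) = 0"
  shows "AE x in lebesgue_on \<Omega>. f x = 0"
proof -
  have box0: "(LINT x:box a b|lebesgue. f x) = 0" if ab: "cbox a b \<subseteq> \<Omega>" for a b
  proof -
    have fK: "integrable lebesgue (\<lambda>x. indicator (cbox a b) x *\<^sub>R f x)"
      using f ab by (auto simp: locally_integrable_def set_integrable_def)
    have bump0: "box_bump a b n x = 0" if "x \<notin> cbox a b" for n x
      using box_bump_nonzero_iff[of a b n x] box_subset_cbox[of a b] that by auto
    have [measurable]: "box_bump a b n \<in> borel_measurable lebesgue" for n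
    proof (rule borel_measurable_continuous_lebesgue)
      have "Ck 0 (box_bump a b n)"
        using box_bump_test_function[OF ab, of n] unfolding test_functions_def by blast
      then show "continuous_on UNIV (box_bump a b n)" by simp
    qed
    have "(\<lambda>n. (LINT x|lebesgue. (indicator (cbox a b) x *\<^sub>R f x) * box_bump a b n x))
        \<longlonglongrightarrow> (LINT x|lebesgue. (indicator (cbox a b) x *\<^sub>R f x) * indicator (box a b) x)"
    proof (rule integral_dominated_convergence)
      show "integrable lebesgue (\<lambda>x. \<bar>indicator (cbox a b) x *\<^sub>R f x\<bar>)" using fK by simp
      show "AE x in lebesgue. (\<lambda>n. (indicator (cbox a b) x *\<^sub>R f x) * box_bump a b n x)
          \<longlonglongrightarrow> (indicator (cbox a b) x *\<^sub>R f x) * indicator (box a b) x"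
        by (intro AE_I2 tendsto_intros box_bump_tendsto)
      show "AE x in lebesgue. norm ((indicator (cbox a b) x *\<^sub>R f x) * box_bump a b n x)
          \<le> \<bar>indicator (cbox a b) x *\<^sub>R f x\<bar>" for n
        using box_bump_bounds[of a b n] by (auto simp: abs_mult intro!: AE_I2 mult_left_le)
    next
      note [measurable] = borel_measurable_integrable[OF fK]
      show "(\<lambda>x. (indicator (cbox a b) x *\<^sub>R f x) * indicator (box a b) x) \<in> borel_measurable lebesgue"
        by (intro borel_measurable_times borel_measurable_indicator borel_measurable_integrable[OF fK]) auto
      show "(\<lambda>x. (indicator (cbox a b) x *\<^sub>R f x) * box_bump a b n x) \<in> borel_measurable lebesgue" for n
        by measurable
    qed
    moreover have "(LINT x|lebesgue. (indicator (cbox a b) x *\<^sub>R f x) * box_bump a b n x) = 0" for n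
    proof -
      have "(LINT x|lebesgue_on \<Omega>. f x * box_bump a b n x)
          = (LINT x|lebesgue. indicator \<Omega> x *\<^sub>R (f x * box_bump a b n x))"
        using \<open>open \<Omega>\<close> by (intro integral_restrict_space) auto
      also have "(\<lambda>x. indicator \<Omega> x *\<^sub>R (f x * box_bump a b n x))
          = (\<lambda>x. (indicator (cbox a b) x *\<^sub>R f x) * box_bump a b n x)"
        using ab bump0 by (auto simp: fun_eq_iff indicator_def)
      finally show ?thesis using zero[OF box_bump_test_function[OF ab]] by simp
    qed
    ultimately have "(\<lambda>n. 0) \<longlonglongrightarrow> (LINT x|lebesgue. (indicator (cbox a b) x *\<^sub>R f x) * indicator (box a b) x)"
      by simp
    then have "(LINT x|lebesgue. (indicator (cbox a b) x *\<^sub>R f x) * indicator (box a b) x) = 0"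
      by (simp add: LIMSEQ_const_iff)
    also have "(\<lambda>x. (indicator (cbox a b) x *\<^sub>R f x) * indicator (box a b) x)
        = (\<lambda>x. indicator (box a b) x *\<^sub>R f x)"
      using box_subset_cbox[of a b] by (auto simp: fun_eq_iff indicator_def)
    finally show ?thesis by (simp add: set_lebesgue_integral_def)
  qed
  \<comment> \<open>The box criterion asks for an integrable function on the whole space, so
    \<open>f\<close> is first cut off by \<open>box a b\<close>; the faces of the closed box form a
    null set.\<close>
  have cbox_AE: "AE x in lebesgue. x \<in> cbox a b \<longrightarrow> f x = 0" if ab: "cbox a b \<subseteq> \<Omega>" for a b
  proof -
    have fK: "integrable lebesgue (\<lambda>x. indicator (cbox a b) x *\<^sub>R f x)"
      using f ab by (auto simp: locally_integrable_def set_integrable_def)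
    have "integrable lebesgue (\<lambda>x. indicator (box a b) x *\<^sub>R (indicator (cbox a b) x *\<^sub>R f x))"
      by (intro integrable_mult_indicator fK) auto
    also have "(\<lambda>x. indicator (box a b) x *\<^sub>R (indicator (cbox a b) x *\<^sub>R f x))
        = (\<lambda>x. indicator (box a b) x *\<^sub>R f x)"
      using box_subset_cbox[of a b] by (auto simp: fun_eq_iff indicator_def)
    finally have fB: "integrable lebesgue (\<lambda>x. indicator (box a b) x *\<^sub>R f x)" .
    have null: "AE x in lebesgue. x \<notin> cbox a b - box a b"
      using negligible_frontier_interval[of a b] by (intro AE_not_in) (auto simp: negligible_iff_null_sets)
    have "AE x in lebesgue. indicator (box a b) x *\<^sub>R f x = 0"
    proof (rule AE_eq_0_if_box_integrals_0[OF fB])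
      fix c d
      define l u where "l = (\<Sum>i\<in>Basis. max (c\<bullet>i) (a\<bullet>i) *\<^sub>R i)"
        and "u = (\<Sum>i\<in>Basis. min (d\<bullet>i) (b\<bullet>i) *\<^sub>R i)"
      \<comment> \<open>The cut-off turns an arbitrary test box into its intersection with
        \<open>box a b\<close>, again a box with its closed box inside the domain.\<close>
      have lu: "box c d \<inter> box a b = box l u"
        unfolding box_Int_box l_def u_def ..
      have "cbox l u \<subseteq> cbox a b" by (auto simp: mem_box l_def u_def)
      then have "(LINT x:box l u|lebesgue. f x) = 0" using ab by (intro box0) auto
      then show "(LINT x:box c d|lebesgue. indicator (box a b) x *\<^sub>R f x) = 0"
        unfolding set_lebesgue_integral_def lu[symmetric]
        by (simp add: indicator_inter_arith mult.assoc)
    qed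
    with null show ?thesis by eventually_elim (auto simp: indicator_def split: if_splits)
  qed
  obtain \<D> where \<D>: "countable \<D>" "\<D> \<subseteq> Pow \<Omega>" "\<And>X. X \<in> \<D> \<Longrightarrow> \<exists>a b. X = cbox a b" "\<Union>\<D> = \<Omega>"
    using open_countable_Union_open_cbox[OF \<open>open \<Omega>\<close>] by blast
  have "AE x in lebesgue. \<forall>X\<in>\<D>. x \<in> X \<longrightarrow> f x = 0"
  proof (rule AE_ball_countable'[OF _ \<D>(1)])
    fix X assume "X \<in> \<D>"
    then obtain a b where "X = cbox a b" "cbox a b \<subseteq> \<Omega>" using \<D>(2,3) by blast
    then show "AE x in lebesgue. x \<in> X \<longrightarrow> f x = 0" using cbox_AE by simp
  qed
  then have "AE x in lebesgue. x \<in> \<Omega> \<longrightarrow> f x = 0"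
    by eventually_elim (use \<D>(4) in blast)
  then show ?thesis
    using \<open>open \<Omega>\<close> by (subst AE_restrict_space_iff) auto
qed

section \<open>Integration by parts and weak gradients\<close>

lemma partial_0_if_0_off_closed:
  assumes "closed K" "\<And>x. x \<notin> K \<Longrightarrow> f x = 0" "x \<notin> K"
  shows "partial i f x = 0"
proof -
  have "(f has_derivative (\<lambda>_. 0)) (at x)"
    by (rule has_derivative_transform_within_open[of "\<lambda>_. 0" _ _ UNIV "- K"]) (use assms in auto)
  then show ?thesis by (rule partial_eq)
qed

lemma test_function_props:
  assumes "\<psi> \<in> test_functions \<Omega>"
  obtains K where "compact K" "K \<subseteq> \<Omega>" "\<And>x. x \<notin> K \<Longrightarrow> \<psi> x = 0" "\<And>i x. x \<notin> K \<Longrightarrow> partial i \<psi> x = 0"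
    "\<And>x. \<psi> differentiable (at x)" "continuous_on UNIV \<psi>" "\<And>i. continuous_on UNIV (partial i \<psi>)"
proof (rule that[of "closure {x. \<psi> x \<noteq> 0}"])
  have C: "\<forall>k. Ck k \<psi>" using assms by (auto simp: test_functions_def)
  show "compact (closure {x. \<psi> x \<noteq> 0})" "closure {x. \<psi> x \<noteq> 0} \<subseteq> \<Omega>"
    using assms by (auto simp: test_functions_def)
  show z: "\<psi> x = 0" if "x \<notin> closure {x. \<psi> x \<noteq> 0}" for x
    using that closure_subset[of "{x. \<psi> x \<noteq> 0}"] by blast
  show "partial i \<psi> x = 0" if "x \<notin> closure {x. \<psi> x \<noteq> 0}" for i x
    using partial_0_if_0_off_closed[OF closed_closure z that] .
  show "\<psi> differentiable (at x)" for x using Ck_all_unfold(1)[OF C] .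
  show "continuous_on UNIV \<psi>" using C[rule_format, of 0] by simp
  show "continuous_on UNIV (partial i \<psi>)" for i
    using Ck_all_unfold(2)[OF C, of i, rule_format, of 0] by simp
qed

text \<open>Combinations of two smooth functions form a class closed under partial derivatives, so
  \<open>Ck_coinduct\<close> applies to the class as a whole.\<close>

lemma test_functions_linear_combination:
  fixes \<Omega> :: "(real^'n) set"
  assumes "f \<in> test_functions \<Omega>" "g \<in> test_functions \<Omega>"
  shows "f + c *\<^sub>R g \<in> test_functions \<Omega>"
proof -
  let ?S = "{\<lambda>x::real^'n. f x + c * g x | f g c. (\<forall>k. Ck k f) \<and> (\<forall>k. Ck k g)}"
  have S: "(\<forall>x. h differentiable (at x)) \<and> (\<forall>i. partial i h \<in> ?S)" if "h \<in> ?S" for h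
  proof -
    from that obtain f g :: "real^'n \<Rightarrow> real" and c
      where h: "h = (\<lambda>x. f x + c * g x)" and Ck: "\<forall>k. Ck k f" "\<forall>k. Ck k g" by blast
    have D: "(f has_derivative frechet_derivative f (at x)) (at x)"
      "(g has_derivative frechet_derivative g (at x)) (at x)" for x
      using Ck by (auto simp: frechet_derivative_works[symmetric] Ck_all_unfold)
    have Dh: "(h has_derivative (\<lambda>k. frechet_derivative f (at x) k + c * frechet_derivative g (at x) k)) (at x)" for x
      unfolding h by (intro has_derivative_add D has_derivative_mult_right)
    have "partial i h = (\<lambda>x. partial i f x + c * partial i g x)" for i
      using partial_eq[OF Dh] by (auto simp: partial_def)
    moreover have "(\<lambda>x. partial i f x + c * partial i g x) \<in> ?S" for i
      using Ck_all_unfold(2)[OF Ck(1)] Ck_all_unfold(2)[OF Ck(2)] by blast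
    ultimately have "\<forall>i. partial i h \<in> ?S" by (simp only:) blast
    moreover have "\<forall>x. h differentiable (at x)" using Dh unfolding differentiable_def by blast
    ultimately show ?thesis by blast
  qed
  have "f + c *\<^sub>R g \<in> ?S"
    using assms by (auto simp: test_functions_def scaleR_fun_def plus_fun_def)
  then have "Ck k (f + c *\<^sub>R g)" for k
    using Ck_coinduct[of ?S] S by blast
  moreover
  have "{x. (f + c *\<^sub>R g) x \<noteq> 0} \<subseteq> {x. f x \<noteq> 0} \<union> {x. g x \<noteq> 0}"
    by (auto simp: plus_fun_def scaleR_fun_def)
  then have "closure {x. (f + c *\<^sub>R g) x \<noteq> 0} \<subseteq> closure {x. f x \<noteq> 0} \<union> closure {x. g x \<noteq> 0}"
    by (metis closure_Un closure_mono)
  moreover from this have "compact (closure {x. (f + c *\<^sub>R g) x \<noteq> 0})"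
    using assms unfolding test_functions_def
    by (metis (mono_tags, lifting) mem_Collect_eq bounded_Un bounded_subset closed_closure compact_eq_bounded_closed)
  ultimately show ?thesis using assms unfolding test_functions_def by auto
qed

lemma zero_test_function: "0 \<in> test_functions (\<Omega> :: (real^'n) set)"
proof -
  have "Ck k (\<lambda>x::real^'n. 0)" for k
    by (intro Ck_coinduct[of smooth_class] smooth_class_closed smooth_class.const)
  then show ?thesis by (simp add: test_functions_def zero_fun_def)
qed

lemma DERIV_along_axis:
  assumes "p differentiable (at (x + t *\<^sub>R axis i 1))"
  shows "((\<lambda>t. p (x + t *\<^sub>R axis i 1)) has_real_derivative partial i p (x + t *\<^sub>R axis i 1)) (at t)"
proof -
  define p' where "p' = frechet_derivative p (at (x + t *\<^sub>R axis i 1))"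
  have p: "(p has_derivative p') (at (x + t *\<^sub>R axis i 1))"
    using assms by (simp add: p'_def frechet_derivative_works[symmetric])
  have "((\<lambda>t. x + t *\<^sub>R axis i 1) has_derivative (\<lambda>h. h *\<^sub>R axis i 1)) (at t)"
    by (auto intro!: derivative_eq_intros)
  from has_derivative_compose[OF this p]
  have "((\<lambda>t. p (x + t *\<^sub>R axis i 1)) has_derivative (\<lambda>h. p' (h *\<^sub>R axis i 1))) (at t)" .
  moreover have "p' (h *\<^sub>R axis i 1) = partial i p (x + t *\<^sub>R axis i 1) * h" for h
    using linear_scale[OF has_derivative_linear[OF p]] partial_eq[OF p] by simp
  ultimately show ?thesis unfolding has_field_derivative_def by simp
qed

lemma integrable_continuous_compact_support:
  fixes f :: "'a::euclidean_space \<Rightarrow> real"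
  assumes "continuous_on UNIV f" "compact K" "\<And>x. x \<notin> K \<Longrightarrow> f x = 0"
  shows "integrable lborel f"
proof -
  have "set_integrable lborel K f"
    unfolding set_integrable_def
    using assms(1,2) by (intro borel_integrable_compact) (auto intro: continuous_on_subset)
  moreover have "(\<lambda>x. indicator K x *\<^sub>R f x) = f"
    using assms(3) by (auto simp: fun_eq_iff indicator_def)
  ultimately show ?thesis by (simp add: set_integrable_def)
qed

text \<open>
  The integral of \<open>p\<close> is translation invariant, so the difference quotients of \<open>p\<close> in direction
  \<open>i\<close> have integral zero; they converge boundedly to the partial derivative.
\<close>

lemma integral_partial_eq_0:
  fixes p :: "real^'n \<Rightarrow> real"
  assumes diff: "\<And>x. p differentiable (at x)" and cont: "continuous_on UNIV (partial i p)"
    and K: "compact K" "\<And>x. x \<notin> K \<Longrightarrow> p x = 0"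
  shows "(LINT x|lborel. partial i p x) = 0"
proof -
  define e :: "real^'n" where "e = axis i 1"
  define t where "t n = inverse (real (Suc n))" for n
  have t: "0 < t n" "t n \<le> 1" for n by (auto simp: t_def divide_simps)
  define q where "q n x = (p (x + t n *\<^sub>R e) - p x) / t n" for n x
  have cont_p: "continuous_on UNIV p"
    using diff by (auto intro!: differentiable_imp_continuous_on simp: differentiable_on_def differentiable_at_withinI)
  have p_int: "integrable lborel p"
    by (rule integrable_continuous_compact_support[OF cont_p K])
  have part0: "\<And>x. x \<notin> K \<Longrightarrow> partial i p x = 0"
    by (rule partial_0_if_0_off_closed[OF compact_imp_closed[OF K(1)] K(2)])
  obtain B where B: "0 \<le> B" "\<And>x. \<bar>partial i p x\<bar> \<le> B"
    using compact_support_bounded[OF cont K(1) part0] by blast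
  obtain r where r: "\<And>x. x \<in> K \<Longrightarrow> norm x \<le> r"
    using compact_imp_bounded[OF K(1)] by (auto simp: bounded_iff)
  have shift: "integrable lborel (\<lambda>x. p (c + x))" "(LINT x|lborel. p (c + x)) = (LINT x|lborel. p x)" for c
  proof -
    have "integrable (distr lborel borel ((+) c)) p" using p_int by (simp add: lborel_distr_plus)
    then show "integrable lborel (\<lambda>x. p (c + x))"
      by (subst (asm) integrable_distr_eq) (use cont_p in \<open>auto intro: borel_measurable_continuous_onI\<close>)
    have "(LINT x|distr lborel borel ((+) c). p x) = (LINT x|lborel. p (c + x))"
      using cont_p by (intro integral_distr) (auto intro: borel_measurable_continuous_onI)
    then show "(LINT x|lborel. p (c + x)) = (LINT x|lborel. p x)" by (simp add: lborel_distr_plus)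
  qed
  have q0: "(LINT x|lborel. q n x) = 0" for n
    using shift[of "t n *\<^sub>R e"] p_int unfolding q_def by (simp add: add.commute)
  have [measurable]: "p \<in> borel_measurable borel" "partial i p \<in> borel_measurable borel"
    using cont_p cont by (auto intro: borel_measurable_continuous_onI)
  have "(\<lambda>n. (LINT x|lborel. q n x)) \<longlonglongrightarrow> (LINT x|lborel. partial i p x)"
  proof (rule integral_dominated_convergence)
    \<comment> \<open>Steps are at most 1 and K lies in the ball of radius r, so every difference
      quotient vanishes outside radius r + 1; inside, the mean value theorem bounds it by B.\<close>
    show "integrable lborel (\<lambda>x. B * indicator (cball 0 (r + 1)) x :: real)"
      using emeasure_bounded_finite[OF bounded_cball]
      by (intro integrable_mult_right integrable_real_indicator) auto
    show "AE x in lborel. (\<lambda>n. q n x) \<longlonglongrightarrow> partial i p x"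
    proof (rule AE_I2)
      fix x
      have "((\<lambda>t. p (x + t *\<^sub>R e)) has_real_derivative partial i p (x + 0 *\<^sub>R e)) (at 0)"
        unfolding e_def by (intro DERIV_along_axis diff)
      then have "((\<lambda>t. (p (x + t *\<^sub>R e) - p x) / t) \<longlongrightarrow> partial i p x) (at 0)"
        by (simp add: DERIV_def)
      moreover have "filterlim t (at 0) sequentially"
        unfolding t_def filterlim_at by (auto intro: LIMSEQ_inverse_real_of_nat simp del: of_nat_Suc)
      ultimately show "(\<lambda>n. q n x) \<longlonglongrightarrow> partial i p x"
        unfolding q_def by (rule filterlim_compose)
    qed
    show "AE x in lborel. norm (q n x) \<le> B * indicator (cball 0 (r + 1)) x" for n
    proof (rule AE_I2)
      fix x
      have "\<exists>z>0. z < t n \<and> p (x + t n *\<^sub>R e) - p (x + 0 *\<^sub>R e) = (t n - 0) * partial i p (x + z *\<^sub>R e)"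
        unfolding e_def using t by (intro MVT2 DERIV_along_axis diff) auto
      then obtain z where z: "p (x + t n *\<^sub>R e) - p x = t n * partial i p (x + z *\<^sub>R e)" by auto
      show "norm (q n x) \<le> B * indicator (cball 0 (r + 1)) x"
      proof (cases "x \<in> cball 0 (r + 1)")
        case True
        then show ?thesis using z t[of n] B by (simp add: q_def)
      next
        case False
        then have "r + 1 < norm x" by simp
        moreover have "norm x \<le> norm (x + t n *\<^sub>R e) + 1"
          using norm_triangle_ineq4[of "x + t n *\<^sub>R e" "t n *\<^sub>R e"] t[of n] by (simp add: e_def)
        ultimately have "x \<notin> K" "x + t n *\<^sub>R e \<notin> K" using r by force+
        then show ?thesis using K(2) B by (simp add: q_def)
      qed
    qed
  qed (simp_all add: q_def)
  then show ?thesis unfolding q0 by (simp add: LIMSEQ_const_iff)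
qed

lemma integral_lebesgue_on_compact_support:
  fixes f :: "real^'n \<Rightarrow> real"
  assumes "open \<Omega>" "continuous_on UNIV f" "K \<subseteq> \<Omega>" "\<And>x. x \<notin> K \<Longrightarrow> f x = 0"
  shows "(LINT x|lebesgue_on \<Omega>. f x) = (LINT x|lborel. f x)"
proof -
  have eq: "(\<lambda>x. indicator \<Omega> x *\<^sub>R f x) = f"
    using assms(3,4) by (fastforce simp: fun_eq_iff indicator_def)
  have "(LINT x|lebesgue_on \<Omega>. f x) = (LINT x|lebesgue. indicator \<Omega> x *\<^sub>R f x)"
    using assms(1) by (intro integral_restrict_space) auto
  also have "\<dots> = (LINT x|lebesgue. f x)" unfolding eq ..
  also have "\<dots> = (LINT x|lborel. f x)"
    by (rule integral_completion) (simp add: borel_measurable_continuous_onI[OF assms(2)])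
  finally show ?thesis .
qed

section \<open>Weak gradients: test functions, linear combinations, uniqueness\<close>

lemma locally_integrable_continuous:
  fixes f :: "real^'n \<Rightarrow> 'b::euclidean_space"
  assumes "continuous_on UNIV f"
  shows "locally_integrable \<Omega> f"
  unfolding locally_integrable_def
proof (intro allI impI)
  fix K assume "compact K \<and> K \<subseteq> \<Omega>"
  then have "set_integrable lborel K f"
    unfolding set_integrable_def
    using assms by (intro borel_integrable_compact) (auto intro: continuous_on_subset)
  then show "set_integrable lebesgue K f"
    unfolding set_integrable_def by (subst integrable_completion) auto
qed

text \<open>The product of \<eta> and \<psi> inherits compact support from \<eta>, so its partial
  derivative has integral 0; the product rule turns this into integration by parts.\<close>

lemma test_function_has_weak_gradient:
  assumes "open \<Omega>" and \<eta>: "\<eta> \<in> test_functions \<Omega>"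
  shows "has_weak_gradient \<Omega> \<eta> (\<lambda>x. \<chi> i. partial i \<eta> x)"
proof -
  from \<eta> obtain K where K: "compact K" "K \<subseteq> \<Omega>" "\<And>x. x \<notin> K \<Longrightarrow> \<eta> x = 0"
    "\<And>i x. x \<notin> K \<Longrightarrow> partial i \<eta> x = 0" "\<And>x. \<eta> differentiable (at x)"
    "continuous_on UNIV \<eta>" "\<And>i. continuous_on UNIV (partial i \<eta>)"
    by (rule test_function_props) blast
  have "(LINT x|lebesgue_on \<Omega>. \<eta> x * partial i \<psi> x)
      = - (LINT x|lebesgue_on \<Omega>. (\<chi> i. partial i \<eta> x) $ i * \<psi> x)"
    if \<psi>: "\<psi> \<in> test_functions \<Omega>" for \<psi> i
  proof -
    from \<psi> obtain L where L: "\<And>x. \<psi> differentiable (at x)"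
      "continuous_on UNIV \<psi>" "\<And>i. continuous_on UNIV (partial i \<psi>)"
      by (rule test_function_props) blast
    have D: "(\<eta> has_derivative frechet_derivative \<eta> (at x)) (at x)"
      "(\<psi> has_derivative frechet_derivative \<psi> (at x)) (at x)" for x
      using K L by (auto simp: frechet_derivative_works[symmetric])
    let ?p = "\<lambda>x. \<eta> x * \<psi> x"
    have part: "partial i ?p = (\<lambda>x. \<eta> x * partial i \<psi> x + partial i \<eta> x * \<psi> x)"
      using partial_eq[OF has_derivative_mult[OF D]] by (auto simp: partial_def)
    have c: "continuous_on UNIV (\<lambda>x. \<eta> x * partial i \<psi> x)" "continuous_on UNIV (\<lambda>x. partial i \<eta> x * \<psi> x)"
      using K L by (auto intro!: continuous_on_mult)
    have "(LINT x|lborel. partial i ?p x) = 0"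
    proof (rule integral_partial_eq_0[OF _ _ K(1)])
      show "?p differentiable at x" for x using has_derivative_mult[OF D] by (auto simp: differentiable_def)
      show "continuous_on UNIV (partial i ?p)" unfolding part using c by (rule continuous_on_add)
    qed (use K in auto)
    also have "(LINT x|lborel. partial i ?p x)
        = (LINT x|lborel. \<eta> x * partial i \<psi> x) + (LINT x|lborel. partial i \<eta> x * \<psi> x)"
      unfolding part using c K
      by (intro Bochner_Integration.integral_add integrable_continuous_compact_support[where K=K]) auto
    also have "(LINT x|lborel. \<eta> x * partial i \<psi> x) = (LINT x|lebesgue_on \<Omega>. \<eta> x * partial i \<psi> x)"
      by (rule integral_lebesgue_on_compact_support[OF \<open>open \<Omega>\<close> c(1) K(2), symmetric]) (simp add: K(3))
    also have "(LINT x|lborel. partial i \<eta> x * \<psi> x) = (LINT x|lebesgue_on \<Omega>. partial i \<eta> x * \<psi> x)"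
      by (rule integral_lebesgue_on_compact_support[OF \<open>open \<Omega>\<close> c(2) K(2), symmetric]) (simp add: K(4))
    finally show ?thesis by simp
  qed
  moreover have "continuous_on UNIV (\<lambda>x. \<chi> i. partial i \<eta> x)"
    using K(7) by (intro continuous_on_vec_lambda) auto
  ultimately show ?thesis
    using K(6) by (auto simp: has_weak_gradient_def intro: locally_integrable_continuous)
qed

lemma locally_integrable_component:
  fixes g :: "real^'n \<Rightarrow> real^'m"
  assumes "locally_integrable \<Omega> g"
  shows "locally_integrable \<Omega> (\<lambda>x. g x $ i)"
  using assms unfolding locally_integrable_def set_integrable_def
proof (intro allI impI)
  fix K assume "\<forall>K. compact K \<and> K \<subseteq> \<Omega> \<longrightarrow> integrable lebesgue (\<lambda>x. indicator K x *\<^sub>R g x)"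
    and K: "compact K \<and> K \<subseteq> \<Omega>"
  then have "integrable lebesgue (\<lambda>x. indicator K x *\<^sub>R g x)" by blast
  then have "integrable lebesgue (\<lambda>x. (indicator K x *\<^sub>R g x) $ i)"
    by (rule integrable_bounded_linear[OF bounded_linear_vec_nth])
  then show "integrable lebesgue (\<lambda>x. indicator K x *\<^sub>R g x $ i)" by simp
qed

lemma locally_integrable_add:
  "locally_integrable \<Omega> f \<Longrightarrow> locally_integrable \<Omega> g \<Longrightarrow> locally_integrable \<Omega> (\<lambda>x. f x + g x)"
  unfolding locally_integrable_def by (auto intro!: set_integral_add)

lemma locally_integrable_scaleR:
  "locally_integrable \<Omega> f \<Longrightarrow> locally_integrable \<Omega> (\<lambda>x. c *\<^sub>R f x)"
  unfolding locally_integrable_def by (auto intro!: set_integrable_scaleR_right)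

lemma has_weak_gradient_linear_combination:
  assumes "open \<Omega>" and u: "has_weak_gradient \<Omega> u g" and v: "has_weak_gradient \<Omega> v h"
  shows "has_weak_gradient \<Omega> (u + c *\<^sub>R v) (\<lambda>x. g x + c *\<^sub>R h x)"
proof -
  note lu = u[unfolded has_weak_gradient_def, THEN conjunct1]
    u[unfolded has_weak_gradient_def, THEN conjunct2, THEN conjunct1]
  note lv = v[unfolded has_weak_gradient_def, THEN conjunct1]
    v[unfolded has_weak_gradient_def, THEN conjunct2, THEN conjunct1]
  have "(LINT x|lebesgue_on \<Omega>. (u x + c * v x) * partial i \<psi> x)
      = - (LINT x|lebesgue_on \<Omega>. (g x + c *\<^sub>R h x) $ i * \<psi> x)"
    if \<psi>: "\<psi> \<in> test_functions \<Omega>" for \<psi> i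
  proof -
    from \<psi> obtain K where K: "compact K" "K \<subseteq> \<Omega>" "\<And>x. x \<notin> K \<Longrightarrow> \<psi> x = 0"
      "\<And>i x. x \<notin> K \<Longrightarrow> partial i \<psi> x = 0"
      "continuous_on UNIV \<psi>" "\<And>i. continuous_on UNIV (partial i \<psi>)"
      by (rule test_function_props) blast
    have int: "integrable (lebesgue_on \<Omega>) (\<lambda>x. u x * partial i \<psi> x)"
      "integrable (lebesgue_on \<Omega>) (\<lambda>x. v x * partial i \<psi> x)"
      "integrable (lebesgue_on \<Omega>) (\<lambda>x. g x $ i * \<psi> x)"
      "integrable (lebesgue_on \<Omega>) (\<lambda>x. h x $ i * \<psi> x)"
      by (rule integrable_mult_compact_support[OF \<open>open \<Omega>\<close> lu(1) K(6,1,2,4)]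
          integrable_mult_compact_support[OF \<open>open \<Omega>\<close> lv(1) K(6,1,2,4)]
          integrable_mult_compact_support[OF \<open>open \<Omega>\<close> locally_integrable_component[OF lu(2)] K(5,1,2,3)]
          integrable_mult_compact_support[OF \<open>open \<Omega>\<close> locally_integrable_component[OF lv(2)] K(5,1,2,3)]; assumption)+
    have "(LINT x|lebesgue_on \<Omega>. (u x + c * v x) * partial i \<psi> x)
        = (LINT x|lebesgue_on \<Omega>. u x * partial i \<psi> x) + c * (LINT x|lebesgue_on \<Omega>. v x * partial i \<psi> x)"
      using int by (simp add: distrib_right mult.assoc)
    also have "\<dots> = - ((LINT x|lebesgue_on \<Omega>. g x $ i * \<psi> x) + c * (LINT x|lebesgue_on \<Omega>. h x $ i * \<psi> x))"
      using u v \<psi> by (simp add: has_weak_gradient_def)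
    also have "(LINT x|lebesgue_on \<Omega>. g x $ i * \<psi> x) + c * (LINT x|lebesgue_on \<Omega>. h x $ i * \<psi> x)
        = (LINT x|lebesgue_on \<Omega>. (g x + c *\<^sub>R h x) $ i * \<psi> x)"
      using int by (simp add: distrib_right mult.assoc)
    finally show ?thesis .
  qed
  moreover have "u + c *\<^sub>R v = (\<lambda>x. u x + c * v x)"
    by (simp add: fun_eq_iff plus_fun_def scaleR_fun_def)
  ultimately show ?thesis
    using locally_integrable_add[OF lu(1) locally_integrable_scaleR[OF lv(1), of c]]
      locally_integrable_add[OF lu(2) locally_integrable_scaleR[OF lv(2), of c]]
    unfolding has_weak_gradient_def by (simp only: real_scaleR_def) blast
qed

text \<open>The difference of the i-th components integrates to 0 against every test function, and
  finitely many components share one null set. This makes the choice in \<open>weak_grad\<close>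
  immaterial.\<close>

lemma has_weak_gradient_unique:
  assumes "open \<Omega>" and g: "has_weak_gradient \<Omega> u g" and h: "has_weak_gradient \<Omega> u h"
  shows "AE x in lebesgue_on \<Omega>. g x = h x"
proof -
  note lg = g[unfolded has_weak_gradient_def, THEN conjunct2, THEN conjunct1]
  note lh = h[unfolded has_weak_gradient_def, THEN conjunct2, THEN conjunct1]
  have "AE x in lebesgue_on \<Omega>. g x $ i + (-1) *\<^sub>R h x $ i = 0" for i
  proof (rule fundamental_lemma_variations[OF \<open>open \<Omega>\<close>])
    show "locally_integrable \<Omega> (\<lambda>x. g x $ i + (-1) *\<^sub>R h x $ i)"
      by (intro locally_integrable_add locally_integrable_scaleR locally_integrable_component lg lh)
    fix \<psi> assume \<psi>: "\<psi> \<in> test_functions \<Omega>"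
    then obtain K where K: "compact K" "K \<subseteq> \<Omega>" "\<And>x. x \<notin> K \<Longrightarrow> \<psi> x = 0" "continuous_on UNIV \<psi>"
      by (rule test_function_props) blast
    have "integrable (lebesgue_on \<Omega>) (\<lambda>x. g x $ i * \<psi> x)"
      "integrable (lebesgue_on \<Omega>) (\<lambda>x. h x $ i * \<psi> x)"
      by (rule integrable_mult_compact_support[OF \<open>open \<Omega>\<close> locally_integrable_component[OF lg] K(4,1,2,3)]
          integrable_mult_compact_support[OF \<open>open \<Omega>\<close> locally_integrable_component[OF lh] K(4,1,2,3)]; assumption)+
    moreover have "(LINT x|lebesgue_on \<Omega>. g x $ i * \<psi> x) = (LINT x|lebesgue_on \<Omega>. h x $ i * \<psi> x)"
      using g[unfolded has_weak_gradient_def, THEN conjunct2, THEN conjunct2, rule_format, OF \<psi>, of i]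
        h[unfolded has_weak_gradient_def, THEN conjunct2, THEN conjunct2, rule_format, OF \<psi>, of i]
      by linarith
    ultimately show "(LINT x|lebesgue_on \<Omega>. (g x $ i + (-1) *\<^sub>R h x $ i) * \<psi> x) = 0"
      by (simp add: left_diff_distrib)
  qed
  then have "AE x in lebesgue_on \<Omega>. \<forall>i. g x $ i + (-1) *\<^sub>R h x $ i = 0"
    by (simp add: AE_all_countable)
  then show ?thesis by eventually_elim (simp add: vec_eq_iff)
qed

lemma has_weak_gradient_weak_grad:
  "has_weak_gradient \<Omega> u g \<Longrightarrow> has_weak_gradient \<Omega> u (weak_grad \<Omega> u)"
  unfolding weak_grad_def by (rule someI[of "has_weak_gradient \<Omega> u"])

section \<open>Lebesgue and Sobolev spaces\<close>

text \<open>Completeness of Lebesgue measure, transferred to the restricted measure through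
  extension by zero.\<close>

lemma borel_measurable_lebesgue_on_AE:
  fixes f g :: "'a::euclidean_space \<Rightarrow> 'b::euclidean_space"
  assumes "f \<in> borel_measurable (lebesgue_on \<Omega>)" "\<Omega> \<in> sets lebesgue"
    and "AE x in lebesgue_on \<Omega>. f x = g x"
  shows "g \<in> borel_measurable (lebesgue_on \<Omega>)"
proof -
  have \<Omega>: "\<Omega> \<inter> space lebesgue \<in> sets lebesgue" using assms(2) by simp
  have "AE x in lebesgue. x \<in> \<Omega> \<longrightarrow> f x = g x"
    using assms(3) by (simp add: AE_restrict_space_iff[OF \<Omega>])
  then have "AE x in lebesgue. indicator \<Omega> x *\<^sub>R f x = indicator \<Omega> x *\<^sub>R g x"
    by eventually_elim (auto simp: indicator_def)
  moreover have "(\<lambda>x. indicator \<Omega> x *\<^sub>R f x) \<in> borel_measurable lebesgue"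
    using assms(1) unfolding borel_measurable_restrict_space_iff[OF \<Omega>] .
  ultimately have "(\<lambda>x. indicator \<Omega> x *\<^sub>R g x) \<in> borel_measurable lebesgue"
    by (rule borel_measurable_AE[rotated])
  then show ?thesis unfolding borel_measurable_restrict_space_iff[OF \<Omega>] .
qed

section \<open>Lebesgue norms on the domain\<close>

lemma Lp_set_numeral:
  "f \<in> Lp_set \<Omega> (numeral k) \<longleftrightarrow> f \<in> borel_measurable (lebesgue_on \<Omega>) \<and>
    integrable (lebesgue_on \<Omega>) (\<lambda>x. norm (f x) ^ numeral k)"
  unfolding Lp_set_def by (simp add: powr_numeral)

lemma Lp_norm_numeral:
  "Lp_norm \<Omega> (numeral k) f = (LINT x|lebesgue_on \<Omega>. norm (f x) ^ numeral k) powr (1 / numeral k)"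
  unfolding Lp_norm_def by (simp add: powr_numeral)

lemma Lp_norm_nonneg: "0 \<le> Lp_norm \<Omega> p f"
  unfolding Lp_norm_def by auto

lemma Lp_norm_numeral_power:
  "Lp_norm \<Omega> (numeral k) f ^ numeral k = (LINT x|lebesgue_on \<Omega>. norm (f x) ^ numeral k)"
proof -
  have "0 \<le> (LINT x|lebesgue_on \<Omega>. norm (f x) ^ numeral k)" by simp
  then show ?thesis
    unfolding Lp_norm_numeral by (simp add: powr_powr flip: powr_numeral)
qed

lemma Lp_norm_2: "Lp_norm \<Omega> 2 f = sqrt (LINT x|lebesgue_on \<Omega>. (norm (f x))\<^sup>2)"
  by (metis Lp_norm_nonneg Lp_norm_numeral_power real_sqrt_abs abs_of_nonneg)

lemma Lp_cong_AE:
  fixes f g :: "real^'n \<Rightarrow> 'b::euclidean_space"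
  assumes "f \<in> Lp_set \<Omega> p" "\<Omega> \<in> sets lebesgue" "AE x in lebesgue_on \<Omega>. f x = g x"
  shows "g \<in> Lp_set \<Omega> p" "Lp_norm \<Omega> p g = Lp_norm \<Omega> p f"
proof -
  have f [measurable]: "f \<in> borel_measurable (lebesgue_on \<Omega>)" using assms(1) by (simp add: Lp_set_def)
  have g [measurable]: "g \<in> borel_measurable (lebesgue_on \<Omega>)"
    using borel_measurable_lebesgue_on_AE[OF f assms(2,3)] .
  have e: "esssup (lebesgue_on \<Omega>) (\<lambda>x. ennreal (norm (g x))) = esssup (lebesgue_on \<Omega>) (\<lambda>x. ennreal (norm (f x)))"
    using assms(3) by (intro esssup_AE_cong) auto
  have i: "integrable (lebesgue_on \<Omega>) (\<lambda>x. norm (g x) powr r)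
      \<longleftrightarrow> integrable (lebesgue_on \<Omega>) (\<lambda>x. norm (f x) powr r)" for r
    using assms(3) by (intro integrable_cong_AE) auto
  have I: "(LINT x|lebesgue_on \<Omega>. norm (g x) powr r) = (LINT x|lebesgue_on \<Omega>. norm (f x) powr r)" for r
    using assms(3) by (intro integral_cong_AE) auto
  show "g \<in> Lp_set \<Omega> p" using assms(1) g unfolding Lp_set_def mem_Collect_eq e i by blast
  show "Lp_norm \<Omega> p g = Lp_norm \<Omega> p f" by (simp add: Lp_norm_def e I)
qed

text \<open>Minkowski's inequality for exponent 2, by expanding the square and applying
  Cauchy-Schwarz. The form f + c g treats sums, multiples and differences together.\<close>

lemma L2_linear_combination:
  fixes f g :: "real^'n \<Rightarrow> 'b::euclidean_space"
  assumes f: "f \<in> Lp_set \<Omega> 2" and g: "g \<in> Lp_set \<Omega> 2"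
  shows "(\<lambda>x. f x + c *\<^sub>R g x) \<in> Lp_set \<Omega> 2"
    and "Lp_norm \<Omega> 2 (\<lambda>x. f x + c *\<^sub>R g x) \<le> Lp_norm \<Omega> 2 f + \<bar>c\<bar> * Lp_norm \<Omega> 2 g"
proof -
  let ?M = "lebesgue_on \<Omega>"
  have [measurable]: "f \<in> borel_measurable ?M" "g \<in> borel_measurable ?M"
    and f2: "integrable ?M (\<lambda>x. (norm (f x))\<^sup>2)" and g2: "integrable ?M (\<lambda>x. (norm (g x))\<^sup>2)"
    using f g by (auto simp: Lp_set_numeral)
  have fg: "integrable ?M (\<lambda>x. norm (f x) * norm (g x))"
    and cs: "\<bar>LINT x|?M. norm (f x) * norm (g x)\<bar> \<le> Lp_norm \<Omega> 2 f * Lp_norm \<Omega> 2 g"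
    using Cauchy_Schwarz_integral[of "\<lambda>x. norm (f x)" ?M "\<lambda>x. norm (g x)"] f2 g2
    by (auto simp: Lp_norm_2)
  have le: "(norm (f x + c *\<^sub>R g x))\<^sup>2
      \<le> (norm (f x))\<^sup>2 + 2 * \<bar>c\<bar> * (norm (f x) * norm (g x)) + c\<^sup>2 * (norm (g x))\<^sup>2" for x
  proof -
    have "norm (f x + c *\<^sub>R g x) \<le> norm (f x) + \<bar>c\<bar> * norm (g x)"
      using norm_triangle_ineq[of "f x" "c *\<^sub>R g x"] by simp
    then have "(norm (f x + c *\<^sub>R g x))\<^sup>2 \<le> (norm (f x) + \<bar>c\<bar> * norm (g x))\<^sup>2"
      by (rule power_mono) simp
    then show ?thesis by (simp add: power2_sum power_mult_distrib mult_ac)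
  qed
  have bd: "integrable ?M (\<lambda>x. (norm (f x))\<^sup>2 + 2 * \<bar>c\<bar> * (norm (f x) * norm (g x)) + c\<^sup>2 * (norm (g x))\<^sup>2)"
    using f2 g2 fg by auto
  have int: "integrable ?M (\<lambda>x. (norm (f x + c *\<^sub>R g x))\<^sup>2)"
    by (rule Bochner_Integration.integrable_bound[OF bd]) (use le in \<open>auto intro: order_trans\<close>)
  then show "(\<lambda>x. f x + c *\<^sub>R g x) \<in> Lp_set \<Omega> 2" by (simp add: Lp_set_numeral)
  have "(LINT x|?M. (norm (f x + c *\<^sub>R g x))\<^sup>2)
      \<le> (LINT x|?M. (norm (f x))\<^sup>2 + 2 * \<bar>c\<bar> * (norm (f x) * norm (g x)) + c\<^sup>2 * (norm (g x))\<^sup>2)"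
    by (intro integral_mono int bd le)
  also have "\<dots> = (Lp_norm \<Omega> 2 f)\<^sup>2 + 2 * \<bar>c\<bar> * (LINT x|?M. norm (f x) * norm (g x))
      + c\<^sup>2 * (Lp_norm \<Omega> 2 g)\<^sup>2"
    using f2 g2 fg by (simp add: Lp_norm_numeral_power)
  also have "\<dots> \<le> (Lp_norm \<Omega> 2 f)\<^sup>2 + 2 * \<bar>c\<bar> * (Lp_norm \<Omega> 2 f * Lp_norm \<Omega> 2 g)
      + c\<^sup>2 * (Lp_norm \<Omega> 2 g)\<^sup>2"
    using cs by (intro add_mono mult_left_mono order_refl) auto
  also have "\<dots> = (Lp_norm \<Omega> 2 f + \<bar>c\<bar> * Lp_norm \<Omega> 2 g)\<^sup>2"
    by (simp add: power2_sum power_mult_distrib mult_ac)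
  finally have "sqrt (LINT x|?M. (norm (f x + c *\<^sub>R g x))\<^sup>2) \<le> Lp_norm \<Omega> 2 f + \<bar>c\<bar> * Lp_norm \<Omega> 2 g"
    by (intro real_le_lsqrt) (auto intro!: add_nonneg_nonneg mult_nonneg_nonneg Lp_norm_nonneg)
  then show "Lp_norm \<Omega> 2 (\<lambda>x. f x + c *\<^sub>R g x) \<le> Lp_norm \<Omega> 2 f + \<bar>c\<bar> * Lp_norm \<Omega> 2 g"
    by (simp add: Lp_norm_2)
qed

lemma AE_le_Lp_norm_infinity:
  assumes "f \<in> Lp_set \<Omega> \<infinity>"
  shows "AE x in lebesgue_on \<Omega>. norm (f x) \<le> Lp_norm \<Omega> \<infinity> f"
  using esssup_AE[of "\<lambda>x. ennreal (norm (f x))" "lebesgue_on \<Omega>"]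
proof eventually_elim
  case (elim x)
  have fin: "esssup (lebesgue_on \<Omega>) (\<lambda>x. ennreal (norm (f x))) < top"
    using assms by (simp add: Lp_set_def)
  then show ?case
    using enn2real_mono[OF elim fin] by (simp add: Lp_norm_def)
qed

lemma Lp_set_infinityI:
  assumes [measurable]: "f \<in> borel_measurable (lebesgue_on \<Omega>)"
    and "AE x in lebesgue_on \<Omega>. norm (f x) \<le> B"
  shows "f \<in> Lp_set \<Omega> \<infinity>"
proof -
  have "esssup (lebesgue_on \<Omega>) (\<lambda>x. ennreal (norm (f x))) \<le> ennreal B"
    using assms(2) by (intro esssup_I) (auto intro: ennreal_leI)
  then show ?thesis by (auto simp: Lp_set_def intro: le_less_trans)
qed

lemma Linf_linear_combination:
  fixes f g :: "real^'n \<Rightarrow> 'b::euclidean_space"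
  assumes f: "f \<in> Lp_set \<Omega> \<infinity>" and g: "g \<in> Lp_set \<Omega> \<infinity>"
  shows "(\<lambda>x. f x + c *\<^sub>R g x) \<in> Lp_set \<Omega> \<infinity>"
proof (rule Lp_set_infinityI)
  have [measurable]: "f \<in> borel_measurable (lebesgue_on \<Omega>)" "g \<in> borel_measurable (lebesgue_on \<Omega>)"
    using f g by (auto simp: Lp_set_def)
  show "(\<lambda>x. f x + c *\<^sub>R g x) \<in> borel_measurable (lebesgue_on \<Omega>)" by measurable
  show "AE x in lebesgue_on \<Omega>. norm (f x + c *\<^sub>R g x) \<le> Lp_norm \<Omega> \<infinity> f + \<bar>c\<bar> * Lp_norm \<Omega> \<infinity> g"
    using AE_le_Lp_norm_infinity[OF f] AE_le_Lp_norm_infinity[OF g]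
    by eventually_elim (intro norm_triangle_mono, auto intro: mult_left_mono)
qed

lemma bounded_in_L2:
  fixes f :: "real^'n \<Rightarrow> 'b::euclidean_space"
  assumes "\<Omega> \<in> lmeasurable" "f \<in> borel_measurable (lebesgue_on \<Omega>)" "\<And>x. norm (f x) \<le> B"
  shows "f \<in> Lp_set \<Omega> 2"
proof -
  interpret finite_measure "lebesgue_on \<Omega>" using assms(1) by (rule finite_measure_lebesgue_on)
  have "integrable (lebesgue_on \<Omega>) (\<lambda>x. (norm (f x))\<^sup>2)"
    using assms(2,3) by (intro integrable_const_bound[where B = "B\<^sup>2"]) (auto intro!: power_mono)
  then show ?thesis using assms(2) by (simp add: Lp_set_numeral)
qed

text \<open>Both sides are weak gradients of the same function, the left one by choice and the right
  one by linearity of the defining identity.\<close>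

lemma weak_grad_linear_combination:
  assumes "open \<Omega>" "has_weak_gradient \<Omega> u g" "has_weak_gradient \<Omega> v h"
  shows "AE x in lebesgue_on \<Omega>. weak_grad \<Omega> (u + c *\<^sub>R v) x = weak_grad \<Omega> u x + c *\<^sub>R weak_grad \<Omega> v x"
proof -
  have "has_weak_gradient \<Omega> (u + c *\<^sub>R v) (\<lambda>x. weak_grad \<Omega> u x + c *\<^sub>R weak_grad \<Omega> v x)"
    by (intro has_weak_gradient_linear_combination has_weak_gradient_weak_grad[OF assms(2)]
        has_weak_gradient_weak_grad[OF assms(3)] assms(1))
  from has_weak_gradient_unique[OF assms(1) has_weak_gradient_weak_grad[OF this] this]
  show ?thesis .
qed

text \<open>Membership only provides some weak gradient in L^p; uniqueness passes its integrability
  on to the chosen one.\<close>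

lemma W1p_weak_grad:
  assumes "open \<Omega>" "u \<in> W1p_set \<Omega> p"
  shows "has_weak_gradient \<Omega> u (weak_grad \<Omega> u)" "weak_grad \<Omega> u \<in> Lp_set \<Omega> p"
proof -
  from assms obtain g where g: "has_weak_gradient \<Omega> u g" "g \<in> Lp_set \<Omega> p"
    by (auto simp: W1p_set_def)
  then show w: "has_weak_gradient \<Omega> u (weak_grad \<Omega> u)"
    by (blast intro: has_weak_gradient_weak_grad)
  have "AE x in lebesgue_on \<Omega>. g x = weak_grad \<Omega> u x"
    by (rule has_weak_gradient_unique[OF assms(1) g(1) w])
  then show "weak_grad \<Omega> u \<in> Lp_set \<Omega> p"
    by (rule Lp_cong_AE(1)[OF g(2), rotated]) (use \<open>open \<Omega>\<close> in simp)
qed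

section \<open>The H1 norm and the Sobolev spaces as vector spaces\<close>

lemma test_function_W12:
  fixes \<Omega> :: "(real^'n) set"
  assumes "open \<Omega>" "bounded \<Omega>" "\<psi> \<in> test_functions \<Omega>"
  shows "\<psi> \<in> W1p_set \<Omega> 2"
proof -
  from assms(3) obtain K where K: "compact K" "\<And>x. x \<notin> K \<Longrightarrow> \<psi> x = 0"
    "\<And>i x. x \<notin> K \<Longrightarrow> partial i \<psi> x = 0"
    "continuous_on UNIV \<psi>" "\<And>i. continuous_on UNIV (partial i \<psi>)"
    by (rule test_function_props) blast
  have \<Omega>: "\<Omega> \<in> lmeasurable" using assms by (simp add: lmeasurable_open)
  have cm: "f \<in> borel_measurable (lebesgue_on \<Omega>)" if "continuous_on UNIV f"
    for f :: "real^'n \<Rightarrow> 'c::euclidean_space"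
    using borel_measurable_continuous_lebesgue[OF that] by (rule measurable_restrict_space1)
  obtain B where B: "\<And>x. \<bar>\<psi> x\<bar> \<le> B" using compact_support_bounded[OF K(4,1,2)] by metis
  have "\<exists>B. \<forall>x. \<bar>partial i \<psi> x\<bar> \<le> B" for i
    using compact_support_bounded[OF K(5)[of i] K(1) K(3)[of _ i]] by metis
  then obtain C where C: "\<And>i x. \<bar>partial i \<psi> x\<bar> \<le> C i" by metis
  have "norm (\<chi> i. partial i \<psi> x) \<le> (\<Sum>i\<in>UNIV. C i)" for x
    by (rule order_trans[OF norm_le_l1_cart]) (auto intro!: sum_mono C)
  moreover have "continuous_on UNIV (\<lambda>x. \<chi> i. partial i \<psi> x)"
    using K(5) by (intro continuous_on_vec_lambda) auto
  ultimately have "(\<lambda>x. \<chi> i. partial i \<psi> x) \<in> Lp_set \<Omega> 2"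
    by (intro bounded_in_L2[OF \<Omega>] cm)
  moreover have "\<psi> \<in> Lp_set \<Omega> 2"
    using B by (intro bounded_in_L2[OF \<Omega> cm[OF K(4)]]) auto
  ultimately show ?thesis
    using test_function_has_weak_gradient[OF assms(1,3)] by (auto simp: W1p_set_def)
qed

lemma W12_linear_combination:
  assumes "open \<Omega>" and u: "u \<in> W1p_set \<Omega> 2" and v: "v \<in> W1p_set \<Omega> 2"
  shows "u + c *\<^sub>R v \<in> W1p_set \<Omega> 2"
    and "H1_norm \<Omega> (u + c *\<^sub>R v) \<le> H1_norm \<Omega> u + \<bar>c\<bar> * H1_norm \<Omega> v"
proof -
  note wu = W1p_weak_grad[OF assms(1) u] and wv = W1p_weak_grad[OF assms(1) v]
  have L: "u \<in> Lp_set \<Omega> 2" "v \<in> Lp_set \<Omega> 2" using u v by (auto simp: W1p_set_def)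
  have eq: "u + c *\<^sub>R v = (\<lambda>x. u x + c *\<^sub>R v x)" by (auto simp: plus_fun_def scaleR_fun_def)
  have wL: "(\<lambda>x. weak_grad \<Omega> u x + c *\<^sub>R weak_grad \<Omega> v x) \<in> Lp_set \<Omega> 2"
    using L2_linear_combination(1)[OF wu(2) wv(2)] .
  show "u + c *\<^sub>R v \<in> W1p_set \<Omega> 2"
    using has_weak_gradient_linear_combination[OF assms(1) wu(1) wv(1), of c] wL
      L2_linear_combination(1)[OF L, of c] unfolding eq by (auto simp: W1p_set_def)
  have "AE x in lebesgue_on \<Omega>. weak_grad \<Omega> u x + c *\<^sub>R weak_grad \<Omega> v x = weak_grad \<Omega> (u + c *\<^sub>R v) x"
    using weak_grad_linear_combination[OF assms(1) wu(1) wv(1), of c] by eventually_elim simp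
  then have "Lp_norm \<Omega> 2 (weak_grad \<Omega> (u + c *\<^sub>R v))
      = Lp_norm \<Omega> 2 (\<lambda>x. weak_grad \<Omega> u x + c *\<^sub>R weak_grad \<Omega> v x)"
    using assms(1) by (intro Lp_cong_AE(2)[OF wL]) auto
  then have "Lp_norm \<Omega> 2 (weak_grad \<Omega> (u + c *\<^sub>R v))
      \<le> Lp_norm \<Omega> 2 (weak_grad \<Omega> u) + \<bar>c\<bar> * Lp_norm \<Omega> 2 (weak_grad \<Omega> v)"
    using L2_linear_combination(2)[OF wu(2) wv(2), of c] by simp
  moreover have "Lp_norm \<Omega> 2 (u + c *\<^sub>R v) \<le> Lp_norm \<Omega> 2 u + \<bar>c\<bar> * Lp_norm \<Omega> 2 v"
    unfolding eq by (rule L2_linear_combination(2)[OF L])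
  ultimately have "H1_norm \<Omega> (u + c *\<^sub>R v) \<le>
      sqrt ((Lp_norm \<Omega> 2 u + \<bar>c\<bar> * Lp_norm \<Omega> 2 v)\<^sup>2
        + (Lp_norm \<Omega> 2 (weak_grad \<Omega> u) + \<bar>c\<bar> * Lp_norm \<Omega> 2 (weak_grad \<Omega> v))\<^sup>2)"
    unfolding H1_norm_def by (intro real_sqrt_le_mono add_mono power_mono Lp_norm_nonneg)
  \<comment> \<open>The triangle inequality of the Euclidean plane, for the pairs of L2 norms of
    function and gradient.\<close>
  also have "\<dots> \<le> H1_norm \<Omega> u + sqrt ((\<bar>c\<bar> * Lp_norm \<Omega> 2 v)\<^sup>2 + (\<bar>c\<bar> * Lp_norm \<Omega> 2 (weak_grad \<Omega> v))\<^sup>2)"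
    unfolding H1_norm_def by (rule real_sqrt_sum_squares_triangle_ineq)
  also have "sqrt ((\<bar>c\<bar> * Lp_norm \<Omega> 2 v)\<^sup>2 + (\<bar>c\<bar> * Lp_norm \<Omega> 2 (weak_grad \<Omega> v))\<^sup>2) = \<bar>c\<bar> * H1_norm \<Omega> v"
    unfolding H1_norm_def by (simp add: power_mult_distrib real_sqrt_mult flip: distrib_left)
  finally show "H1_norm \<Omega> (u + c *\<^sub>R v) \<le> H1_norm \<Omega> u + \<bar>c\<bar> * H1_norm \<Omega> v" .
qed

lemma H1_norm_nonneg: "0 \<le> H1_norm \<Omega> u"
  by (simp add: H1_norm_def)

text \<open>The gradient chosen for 0 need not be the zero function. Writing 0 as 0 - 0 shows that
  it equals its difference with itself almost everywhere, hence vanishes there.\<close>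

lemma H1_norm_0:
  assumes "open \<Omega>" "bounded \<Omega>"
  shows "H1_norm \<Omega> 0 = 0"
proof -
  have 0: "0 \<in> W1p_set \<Omega> 2" by (rule test_function_W12[OF assms zero_test_function])
  have "H1_norm \<Omega> (0 + (-1) *\<^sub>R 0) \<le> H1_norm \<Omega> 0 + \<bar>-1\<bar> * H1_norm \<Omega> 0"
    by (rule W12_linear_combination(2)[OF assms(1) 0 0])
  note wg = test_function_has_weak_gradient[OF assms(1) zero_test_function]
  have "AE x in lebesgue_on \<Omega>. weak_grad \<Omega> (0 + (-1) *\<^sub>R 0) x = weak_grad \<Omega> 0 x + (-1) *\<^sub>R weak_grad \<Omega> 0 x"
    by (rule weak_grad_linear_combination[OF assms(1) wg wg])
  then have ae: "AE x in lebesgue_on \<Omega>. weak_grad \<Omega> 0 x = 0" by simp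
  then have "(LINT x|lebesgue_on \<Omega>. (norm (weak_grad \<Omega> 0 x))\<^sup>2) = 0"
    by (intro integral_eq_zero_AE) auto
  then show ?thesis by (simp add: H1_norm_def Lp_norm_2)
qed

lemma H10_subspace:
  assumes "open \<Omega>" "bounded \<Omega>"
  shows "subspace (carr (H10 \<Omega>))"
proof -
  have comb: "u + c *\<^sub>R v \<in> carr (H10 \<Omega>)" if uv: "u \<in> carr (H10 \<Omega>)" "v \<in> carr (H10 \<Omega>)" for u v c
  proof -
    have W: "u \<in> W1p_set \<Omega> 2" "v \<in> W1p_set \<Omega> 2" using uv by (auto simp: H10_def)
    have "\<exists>\<psi>\<in>test_functions \<Omega>. H1_norm \<Omega> (u + c *\<^sub>R v - \<psi>) < e" if "0 < e" for e
    proof -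
      \<comment> \<open>The combined error is at most (1 + |c|) d = e/2, which keeps the final
        inequality strict.\<close>
      define q where "q = 1 + \<bar>c\<bar>"
      define d where "d = e / (2 * q)"
      have q: "0 < q" using abs_ge_zero[of c] by (simp add: q_def)
      then have d: "0 < d" using that by (simp add: d_def)
      obtain \<psi> \<eta> where \<psi>: "\<psi> \<in> test_functions \<Omega>" "H1_norm \<Omega> (u - \<psi>) < d"
        and \<eta>: "\<eta> \<in> test_functions \<Omega>" "H1_norm \<Omega> (v - \<eta>) < d"
        using uv d by (fastforce simp: H10_def)
      have D: "u - \<psi> \<in> W1p_set \<Omega> 2" "v - \<eta> \<in> W1p_set \<Omega> 2"
        using W12_linear_combination(1)[OF assms(1) W(1) test_function_W12[OF assms \<psi>(1)], of "-1"]
          W12_linear_combination(1)[OF assms(1) W(2) test_function_W12[OF assms \<eta>(1)], of "-1"]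
        by simp_all
      have "H1_norm \<Omega> (u + c *\<^sub>R v - (\<psi> + c *\<^sub>R \<eta>)) = H1_norm \<Omega> ((u - \<psi>) + c *\<^sub>R (v - \<eta>))"
        by (simp add: algebra_simps)
      also have "\<dots> \<le> H1_norm \<Omega> (u - \<psi>) + \<bar>c\<bar> * H1_norm \<Omega> (v - \<eta>)"
        by (rule W12_linear_combination(2)[OF assms(1) D])
      also have "\<dots> \<le> d + \<bar>c\<bar> * d"
        using \<psi> \<eta> by (intro add_mono mult_left_mono) auto
      also have "\<dots> = q * d" by (simp add: q_def algebra_simps)
      also have "\<dots> = e / 2" using q by (simp add: d_def)
      also have "\<dots> < e" using that by simp
      finally show ?thesis using test_functions_linear_combination[OF \<psi>(1) \<eta>(1)] by blast
    qed
    then show ?thesis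
      using W12_linear_combination(1)[OF assms(1) W] by (simp add: H10_def)
  qed
  have z: "0 \<in> carr (H10 \<Omega>)"
    using test_function_W12[OF assms zero_test_function] H1_norm_0[OF assms] zero_test_function[of \<Omega>]
    by (auto simp: H10_def intro!: bexI[of _ 0])
  show ?thesis
    unfolding subspace_def
    using z comb[of _ _ 1] comb[OF z] by (metis add_0 scaleR_one)
qed

lemma W10inf_subspace:
  fixes \<Omega> :: "(real^'n) set"
  assumes "open \<Omega>" "bounded \<Omega>"
  shows "subspace (carr (W10inf \<Omega>))"
proof -
  have comb: "u + c *\<^sub>R v \<in> W1p_set \<Omega> \<infinity>" if uv: "u \<in> W1p_set \<Omega> \<infinity>" "v \<in> W1p_set \<Omega> \<infinity>" for u v c
  proof -
    note wu = W1p_weak_grad[OF assms(1) uv(1)] and wv = W1p_weak_grad[OF assms(1) uv(2)]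
    have L: "u \<in> Lp_set \<Omega> \<infinity>" "v \<in> Lp_set \<Omega> \<infinity>" using uv by (auto simp: W1p_set_def)
    have eq: "u + c *\<^sub>R v = (\<lambda>x. u x + c *\<^sub>R v x)" by (auto simp: plus_fun_def scaleR_fun_def)
    show ?thesis
      using has_weak_gradient_linear_combination[OF assms(1) wu(1) wv(1), of c]
        Linf_linear_combination[OF L, of c] Linf_linear_combination[OF wu(2) wv(2), of c]
      unfolding eq by (auto simp: W1p_set_def)
  qed
  have z: "0 \<in> W1p_set \<Omega> \<infinity>"
  proof -
    have "has_weak_gradient \<Omega> 0 (\<lambda>x. 0)"
      by (simp add: has_weak_gradient_def locally_integrable_def set_integrable_def)
    moreover have "(\<lambda>x. 0 :: real^'n) \<in> Lp_set \<Omega> \<infinity>"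
      by (rule Lp_set_infinityI[where B = 0]) auto
    moreover have "(0 :: real^'n \<Rightarrow> real) \<in> Lp_set \<Omega> \<infinity>"
      unfolding zero_fun_def by (rule Lp_set_infinityI[where B = 0]) auto
    ultimately show ?thesis by (auto simp: W1p_set_def)
  qed
  note sub = H10_subspace[OF assms]
  show ?thesis
    unfolding subspace_def W10inf_def
    using z comb[of _ _ 1] comb[OF z] subspace_0[OF sub] subspace_add[OF sub] subspace_scale[OF sub]
    by auto
qed

lemma H10_grad_bound:
  shows "(LINT x|lebesgue_on \<Omega>. (norm (weak_grad \<Omega> u x))\<^sup>2) \<le> (H1_norm \<Omega> u)\<^sup>2"
    and "(LINT x|lebesgue_on \<Omega>. (norm (u x))\<^sup>2) \<le> (H1_norm \<Omega> u)\<^sup>2"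
  by (auto simp: H1_norm_def Lp_norm_numeral_power)

section \<open>Ladyzhenskaya's inequality\<close>

text \<open>The fundamental theorem of calculus along a coordinate line, started at a point outside
  the support.\<close>

lemma compact_support_le_line_integral:
  fixes p :: "real^'n \<Rightarrow> real"
  assumes diff: "\<And>x. p differentiable (at x)" and cont: "continuous_on UNIV (partial i p)"
    and K: "compact K" "\<And>x. x \<notin> K \<Longrightarrow> p x = 0"
  shows "ennreal \<bar>p (a + s *\<^sub>R axis i 1)\<bar> \<le> (\<integral>\<^sup>+ t. ennreal \<bar>partial i p (a + t *\<^sub>R axis i 1)\<bar> \<partial>lborel)"
proof -
  let ?e = "axis i 1 :: real^'n"
  let ?f = "\<lambda>t. partial i p (a + t *\<^sub>R ?e)"
  obtain r where r: "\<And>x. x \<in> K \<Longrightarrow> norm x \<le> r"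
    using compact_imp_bounded[OF K(1)] by (auto simp: bounded_iff)
  \<comment> \<open>Large enough that -T \<le> s and that the starting point has norm above r. The
    absolute value covers a negative r, which is possible when K is empty.\<close>
  define T where "T = max \<bar>s\<bar> (norm a + \<bar>r\<bar> + 1)"
  have "norm a + \<bar>r\<bar> + 1 \<le> norm (T *\<^sub>R ?e)" by (simp add: T_def)
  also have "\<dots> \<le> norm (a + (- T) *\<^sub>R ?e) + norm a"
    using norm_triangle_ineq4[of a "a + (- T) *\<^sub>R ?e"] by simp
  finally have "r < norm (a + (- T) *\<^sub>R ?e)" by linarith
  then have p0: "p (a + (- T) *\<^sub>R ?e) = 0" using K(2) r by fastforce
  have le: "- T \<le> s" by (simp add: T_def)
  have cf: "continuous_on UNIV ?f"
    by (intro continuous_on_compose2[OF cont] continuous_intros) auto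
  have FTC: "has_bochner_integral lborel (\<lambda>t. ?f t * indicator {-T..s} t)
      (p (a + s *\<^sub>R ?e) - p (a + (- T) *\<^sub>R ?e))"
    using le cf
    by (intro has_bochner_integral_FTC_Icc_real DERIV_along_axis diff)
      (auto simp: continuous_on_eq_continuous_at)
  then have I: "integrable lborel (\<lambda>t. ?f t * indicator {-T..s} t)"
    "(LINT t|lborel. ?f t * indicator {-T..s} t) = p (a + s *\<^sub>R ?e)"
    using p0 by (auto simp: has_bochner_integral_iff)
  have "ennreal (norm (p (a + s *\<^sub>R ?e))) \<le> (\<integral>\<^sup>+ t. ennreal (norm (?f t * indicator {-T..s} t)) \<partial>lborel)"
    using integral_norm_bound_ennreal[OF I(1)] unfolding I(2) .
  also have "\<dots> \<le> (\<integral>\<^sup>+ t. ennreal \<bar>?f t\<bar> \<partial>lborel)"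
    by (intro nn_integral_mono ennreal_leI) (auto simp: indicator_def)
  finally show ?thesis by simp
qed

text \<open>The image of \<open>lborel\<close> on the reals under the parametrisation has the right
  value on boxes, and these values determine \<open>lborel\<close>.\<close>

lemma nn_integral_line:
  fixes F :: "real^'n \<Rightarrow> ennreal"
  assumes U: "UNIV = {i::'n}" and [measurable]: "F \<in> borel_measurable borel"
  shows "(\<integral>\<^sup>+ x. F x \<partial>lborel) = (\<integral>\<^sup>+ s. F (s *\<^sub>R axis i 1) \<partial>lborel)"
proof -
  let ?T = "\<lambda>s::real. s *\<^sub>R axis i 1 :: real^'n"
  have B: "Basis = {axis i 1 :: real^'n}" by (simp add: Basis_vec_def U)
  have [measurable]: "?T \<in> borel \<rightarrow>\<^sub>M borel" by measurable
  have "lborel = distr lborel borel ?T"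
  proof (rule lborel_eqI)
    fix l u :: "real^'n" assume "\<And>b. b \<in> Basis \<Longrightarrow> l \<bullet> b \<le> u \<bullet> b"
    then have le: "l $ i \<le> u $ i" by (simp add: B inner_axis)
    have "?T -` box l u = box (l $ i) (u $ i)"
      by (auto simp: mem_box B inner_axis inner_axis_axis)
    then show "emeasure (distr lborel borel ?T) (box l u) = (\<Prod>b\<in>Basis. (u - l) \<bullet> b)"
      using le by (simp add: emeasure_distr B inner_axis)
  qed simp
  then have "(\<integral>\<^sup>+ x. F x \<partial>lborel) = (\<integral>\<^sup>+ x. F x \<partial>distr lborel borel ?T)" by simp
  also have "\<dots> = (\<integral>\<^sup>+ s. F (?T s) \<partial>lborel)" by (rule nn_integral_distr) simp_all
  finally show ?thesis .
qed

text \<open>Tonelli's theorem for an abstract index type with two elements. As i and j can be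
  exchanged, it provides both orders of integration.\<close>

lemma nn_integral_plane:
  fixes F :: "real^'n \<Rightarrow> ennreal"
  assumes U: "UNIV = {i, j::'n}" "i \<noteq> j" and [measurable]: "F \<in> borel_measurable borel"
  shows "(\<integral>\<^sup>+ x. F x \<partial>lborel) = (\<integral>\<^sup>+ s. \<integral>\<^sup>+ t. F (s *\<^sub>R axis i 1 + t *\<^sub>R axis j 1) \<partial>lborel \<partial>lborel)"
proof -
  let ?T = "\<lambda>(s::real, t::real). s *\<^sub>R axis i 1 + t *\<^sub>R axis j 1 :: real^'n"
  have B: "Basis = {axis i 1, axis j 1 :: real^'n}" by (auto simp: Basis_vec_def U(1))
  have ne: "axis i 1 \<noteq> (axis j 1 :: real^'n)" using U(2) by (simp add: axis_eq_axis)
  have [measurable]: "?T \<in> borel_measurable (lborel \<Otimes>\<^sub>M lborel)"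
    by measurable
  have "lborel = distr (lborel \<Otimes>\<^sub>M lborel) borel ?T"
  proof (rule lborel_eqI)
    fix l u :: "real^'n" assume *: "\<And>b. b \<in> Basis \<Longrightarrow> l \<bullet> b \<le> u \<bullet> b"
    have le: "l $ i \<le> u $ i" "l $ j \<le> u $ j"
      using *[of "axis i 1"] *[of "axis j 1"] by (simp_all add: B inner_axis)
    have "?T -` box l u = box (l $ i) (u $ i) \<times> box (l $ j) (u $ j)"
    proof -
      have "z \<in> box l u \<longleftrightarrow> (\<forall>k\<in>UNIV. l $ k < z $ k \<and> z $ k < u $ k)" for z
        by (simp add: mem_box_cart)
      then have box: "z \<in> box l u \<longleftrightarrow> (l $ i < z $ i \<and> z $ i < u $ i) \<and> (l $ j < z $ j \<and> z $ j < u $ j)" for z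
        unfolding U(1) by simp
      have T: "?T (s, t) $ i = s" "?T (s, t) $ j = t" for s t
        using U(2) by (simp_all add: axis_def)
      have "(s, t) \<in> ?T -` box l u \<longleftrightarrow> (s, t) \<in> box (l $ i) (u $ i) \<times> box (l $ j) (u $ j)" for s t
        unfolding vimage_eq box T by simp
      then show ?thesis by (intro set_eqI) (metis surj_pair)
    qed
    then have "emeasure (distr (lborel \<Otimes>\<^sub>M lborel) borel ?T) (box l u)
        = emeasure (lborel \<Otimes>\<^sub>M lborel) (box (l $ i) (u $ i) \<times> box (l $ j) (u $ j))"
      by (simp add: emeasure_distr space_pair_measure)
    also have "\<dots> = emeasure lborel (box (l $ i) (u $ i)) * emeasure lborel (box (l $ j) (u $ j))"
      by (rule lborel.emeasure_pair_measure_Times) simp_all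
    also have "\<dots> = (\<Prod>b\<in>Basis. (u - l) \<bullet> b)"
      using le ne by (simp add: B inner_axis ennreal_mult)
    finally show "emeasure (distr (lborel \<Otimes>\<^sub>M lborel) borel ?T) (box l u) = (\<Prod>b\<in>Basis. (u - l) \<bullet> b)" .
  qed simp
  then have "(\<integral>\<^sup>+ x. F x \<partial>lborel) = (\<integral>\<^sup>+ x. F x \<partial>distr (lborel \<Otimes>\<^sub>M lborel) borel ?T)" by simp
  also have "\<dots> = (\<integral>\<^sup>+ z. F (?T z) \<partial>(lborel \<Otimes>\<^sub>M lborel))" by (rule nn_integral_distr) simp_all
  also have "\<dots> = (\<integral>\<^sup>+ s. \<integral>\<^sup>+ t. F (?T (s, t)) \<partial>lborel \<partial>lborel)"
    by (rule lborel.nn_integral_fst[symmetric]) measurable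
  finally show ?thesis by simp
qed

text \<open>
  One factor \<open>|p|\<close> is bounded by a function of the second coordinate alone and the other by a
  function of the first alone, so the integral of their product factorizes.
\<close>

lemma nn_integral_square_le_plane:
  fixes p :: "real^'n \<Rightarrow> real"
  assumes U: "UNIV = {i, j::'n}" "i \<noteq> j"
    and diff: "\<And>x. p differentiable (at x)" and cont: "\<And>i. continuous_on UNIV (partial i p)"
    and K: "compact K" "\<And>x. x \<notin> K \<Longrightarrow> p x = 0"
  shows "(\<integral>\<^sup>+ x. ennreal ((p x)\<^sup>2) \<partial>lborel)
    \<le> (\<integral>\<^sup>+ x. ennreal \<bar>partial i p x\<bar> \<partial>lborel) * (\<integral>\<^sup>+ x. ennreal \<bar>partial j p x\<bar> \<partial>lborel)"
proof -
  let ?x = "\<lambda>s t. s *\<^sub>R axis i 1 + t *\<^sub>R axis j 1 :: real^'n"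
  have cont_p: "continuous_on UNIV p"
    using diff by (auto intro!: differentiable_imp_continuous_on simp: differentiable_on_def differentiable_at_withinI)
  have [measurable]: "p \<in> borel_measurable borel" "\<And>i. partial i p \<in> borel_measurable borel"
    using cont_p cont by (auto intro: borel_measurable_continuous_onI)
  define A where "A t = (\<integral>\<^sup>+ s. ennreal \<bar>partial i p (?x s t)\<bar> \<partial>lborel)" for t
  define B where "B s = (\<integral>\<^sup>+ t. ennreal \<bar>partial j p (?x s t)\<bar> \<partial>lborel)" for s
  have [measurable]: "A \<in> borel_measurable borel" "B \<in> borel_measurable borel"
    unfolding A_def B_def by measurable
  have U': "UNIV = {j, i}" "j \<noteq> i" using U by auto
  have pA: "ennreal \<bar>p (?x s t)\<bar> \<le> A t" for s t
    using compact_support_le_line_integral[OF diff cont K, of "t *\<^sub>R axis j 1" s i]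
    by (simp add: A_def add.commute)
  have pB: "ennreal \<bar>p (?x s t)\<bar> \<le> B s" for s t
    using compact_support_le_line_integral[OF diff cont K, of "s *\<^sub>R axis i 1" t j]
    by (simp add: B_def)
  have "(\<integral>\<^sup>+ x. ennreal ((p x)\<^sup>2) \<partial>lborel) = (\<integral>\<^sup>+ s. \<integral>\<^sup>+ t. ennreal ((p (?x s t))\<^sup>2) \<partial>lborel \<partial>lborel)"
    by (rule nn_integral_plane[OF U]) measurable
  also have "\<dots> \<le> (\<integral>\<^sup>+ s. \<integral>\<^sup>+ t. B s * A t \<partial>lborel \<partial>lborel)"
  proof (intro nn_integral_mono)
    fix s t
    have "ennreal ((p (?x s t))\<^sup>2) = ennreal \<bar>p (?x s t)\<bar> * ennreal \<bar>p (?x s t)\<bar>"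
      by (simp add: power2_eq_square flip: ennreal_mult)
    also have "\<dots> \<le> B s * A t" by (intro mult_mono pA pB) auto
    finally show "ennreal ((p (?x s t))\<^sup>2) \<le> B s * A t" .
  qed
  also have "\<dots> = (\<integral>\<^sup>+ s. B s \<partial>lborel) * (\<integral>\<^sup>+ t. A t \<partial>lborel)"
    by (simp add: nn_integral_cmult nn_integral_multc)
  also have "(\<integral>\<^sup>+ s. B s \<partial>lborel) = (\<integral>\<^sup>+ x. ennreal \<bar>partial j p x\<bar> \<partial>lborel)"
    unfolding B_def by (rule nn_integral_plane[OF U, symmetric]) measurable
  also have "(\<integral>\<^sup>+ t. A t \<partial>lborel) = (\<integral>\<^sup>+ x. ennreal \<bar>partial i p x\<bar> \<partial>lborel)"
    unfolding A_def add.commute[of "_ *\<^sub>R axis i 1"]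
    by (rule nn_integral_plane[OF U', symmetric]) measurable
  finally show ?thesis by (simp add: mult.commute)
qed

text \<open>On a line one factor |p| is bounded by the constant L1 norm of the derivative and the
  other is simply integrated.\<close>

lemma nn_integral_square_le_line:
  fixes p :: "real^'n \<Rightarrow> real"
  assumes U: "UNIV = {i::'n}"
    and diff: "\<And>x. p differentiable (at x)" and cont: "\<And>i. continuous_on UNIV (partial i p)"
    and K: "compact K" "\<And>x. x \<notin> K \<Longrightarrow> p x = 0"
  shows "(\<integral>\<^sup>+ x. ennreal ((p x)\<^sup>2) \<partial>lborel)
    \<le> (\<integral>\<^sup>+ x. ennreal \<bar>partial i p x\<bar> \<partial>lborel) * (\<integral>\<^sup>+ x. ennreal \<bar>p x\<bar> \<partial>lborel)"
proof -
  have cont_p: "continuous_on UNIV p"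
    using diff by (auto intro!: differentiable_imp_continuous_on simp: differentiable_on_def differentiable_at_withinI)
  have [measurable]: "p \<in> borel_measurable borel" "\<And>i. partial i p \<in> borel_measurable borel"
    using cont_p cont by (auto intro: borel_measurable_continuous_onI)
  define A where "A = (\<integral>\<^sup>+ x. ennreal \<bar>partial i p x\<bar> \<partial>lborel)"
  have A: "A = (\<integral>\<^sup>+ s. ennreal \<bar>partial i p (s *\<^sub>R axis i 1)\<bar> \<partial>lborel)"
    unfolding A_def by (rule nn_integral_line[OF U]) measurable
  have pA: "ennreal \<bar>p x\<bar> \<le> A" for x
  proof -
    have x: "x = 0 + (x $ i) *\<^sub>R axis i 1"
      using U by (auto simp: vec_eq_iff axis_def)
    show ?thesis
      using compact_support_le_line_integral[OF diff cont K, of 0 "x $ i" i] x by (simp add: A)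
  qed
  have "(\<integral>\<^sup>+ x. ennreal ((p x)\<^sup>2) \<partial>lborel) \<le> (\<integral>\<^sup>+ x. A * ennreal \<bar>p x\<bar> \<partial>lborel)"
  proof (rule nn_integral_mono)
    fix x
    have "ennreal ((p x)\<^sup>2) = ennreal \<bar>p x\<bar> * ennreal \<bar>p x\<bar>"
      by (simp add: power2_eq_square flip: ennreal_mult)
    also have "\<dots> \<le> A * ennreal \<bar>p x\<bar>" by (intro mult_right_mono pA) auto
    finally show "ennreal ((p x)\<^sup>2) \<le> A * ennreal \<bar>p x\<bar>" .
  qed
  then show ?thesis by (simp add: nn_integral_cmult A_def)
qed

text \<open>The estimates on the line and in the plane are applied to the square of \<psi>: the L1
  norm of 2 \<psi> times a partial derivative is at most 2 sqrt (a b) by Cauchy-Schwarz, and 2 sqrt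
  (a b) \<le> a + b, where a + b is the squared H1 norm. The constant 4 leaves slack.\<close>

lemma ladyzhenskaya_test_function:
  fixes \<Omega> :: "(real^'n) set"
  assumes card: "CARD('n) \<in> {1, 2}" and \<Omega>: "open \<Omega>" "bounded \<Omega>" and \<psi>: "\<psi> \<in> test_functions \<Omega>"
  shows "integrable (lebesgue_on \<Omega>) (\<lambda>x. \<psi> x ^ 4)"
    and "(LINT x|lebesgue_on \<Omega>. \<psi> x ^ 4) \<le> 4 * H1_norm \<Omega> \<psi> ^ 4"
proof -
  from \<psi> obtain K where K: "compact K" "K \<subseteq> \<Omega>" "\<And>x. x \<notin> K \<Longrightarrow> \<psi> x = 0"
    "\<And>i x. x \<notin> K \<Longrightarrow> partial i \<psi> x = 0" "\<And>x. \<psi> differentiable (at x)"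
    "continuous_on UNIV \<psi>" "\<And>i. continuous_on UNIV (partial i \<psi>)"
    by (rule test_function_props) blast
  have c4: "continuous_on UNIV (\<lambda>x. \<psi> x ^ 4)" using K(6) by (intro continuous_intros)
  have "integrable (lebesgue_on \<Omega>) (\<lambda>x. 1 * \<psi> x ^ 4)"
    by (rule integrable_mult_compact_support[OF \<Omega>(1) locally_integrable_continuous c4 K(1,2)])
      (simp_all add: K(3))
  then show "integrable (lebesgue_on \<Omega>) (\<lambda>x. \<psi> x ^ 4)" by simp
  define d\<psi> where "d\<psi> x = (\<chi> i. partial i \<psi> x)" for x
  define a b where "a = (LINT x|lborel. (\<psi> x)\<^sup>2)" and "b = (LINT x|lborel. (norm (d\<psi> x))\<^sup>2)"
  have c: "continuous_on UNIV (\<lambda>x. (\<psi> x)\<^sup>2)" "continuous_on UNIV (\<lambda>x. (norm (d\<psi> x))\<^sup>2)"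
    unfolding d\<psi>_def by (intro continuous_intros continuous_on_vec_lambda K(6,7))+
  have z: "(\<psi> x)\<^sup>2 = 0" "(norm (d\<psi> x))\<^sup>2 = 0" if "x \<notin> K" for x
    using K(3,4)[OF that] by (auto simp: d\<psi>_def vec_eq_iff)
  have int: "integrable lborel (\<lambda>x. (\<psi> x)\<^sup>2)" "integrable lborel (\<lambda>x. (norm (d\<psi> x))\<^sup>2)"
    by (rule integrable_continuous_compact_support[OF c(1) K(1) z(1)]
        integrable_continuous_compact_support[OF c(2) K(1) z(2)]; assumption)+
  have ab: "0 \<le> a" "0 \<le> b" by (auto simp: a_def b_def)
  have H1: "(H1_norm \<Omega> \<psi>)\<^sup>2 = a + b"
  proof -
    have wg: "has_weak_gradient \<Omega> \<psi> d\<psi>"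
      using test_function_has_weak_gradient[OF \<Omega>(1) \<psi>] unfolding d\<psi>_def .
    have W: "\<psi> \<in> W1p_set \<Omega> 2" by (rule test_function_W12[OF \<Omega> \<psi>])
    have "AE x in lebesgue_on \<Omega>. weak_grad \<Omega> \<psi> x = d\<psi> x"
      by (rule has_weak_gradient_unique[OF \<Omega>(1) has_weak_gradient_weak_grad[OF wg] wg])
    then have "Lp_norm \<Omega> 2 d\<psi> = Lp_norm \<Omega> 2 (weak_grad \<Omega> \<psi>)"
      by (rule Lp_cong_AE(2)[OF W1p_weak_grad(2)[OF \<Omega>(1) W], rotated]) (use \<Omega>(1) in simp)
    then have "(Lp_norm \<Omega> 2 (weak_grad \<Omega> \<psi>))\<^sup>2 = (LINT x|lebesgue_on \<Omega>. (norm (d\<psi> x))\<^sup>2)"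
      by (simp add: Lp_norm_numeral_power[symmetric])
    also have "\<dots> = b" unfolding b_def
      by (rule integral_lebesgue_on_compact_support[OF \<Omega>(1) c(2) K(2) z(2)])
    finally have 1: "(Lp_norm \<Omega> 2 (weak_grad \<Omega> \<psi>))\<^sup>2 = b" .
    have "(Lp_norm \<Omega> 2 \<psi>)\<^sup>2 = (LINT x|lebesgue_on \<Omega>. (\<psi> x)\<^sup>2)"
      by (simp add: Lp_norm_numeral_power)
    also have "\<dots> = a" unfolding a_def
      by (rule integral_lebesgue_on_compact_support[OF \<Omega>(1) c(1) K(2) z(1)])
    finally show ?thesis using 1 ab by (simp add: H1_norm_def)
  qed
  let ?p = "\<lambda>x. (\<psi> x)\<^sup>2"
  have D: "(\<psi> has_derivative frechet_derivative \<psi> (at x)) (at x)" for x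
    using K(5) by (simp add: frechet_derivative_works[symmetric])
  have Dp: "(?p has_derivative (\<lambda>h. \<psi> x * frechet_derivative \<psi> (at x) h
      + frechet_derivative \<psi> (at x) h * \<psi> x)) (at x)" for x
    using has_derivative_mult[OF D D, of x] by (simp add: power2_eq_square)
  have part: "partial i ?p = (\<lambda>x. 2 * (\<psi> x * partial i \<psi> x))" for i
    using partial_eq[OF Dp] by (auto simp: partial_def)
  have dp: "?p differentiable (at x)" for x using Dp unfolding differentiable_def by blast
  have cp: "continuous_on UNIV (partial i ?p)" for i
    unfolding part using K(6,7) by (intro continuous_intros)
  have p_le: "(\<integral>\<^sup>+ x. ennreal \<bar>partial i ?p x\<bar> \<partial>lborel) \<le> ennreal (2 * (sqrt a * sqrt b))" for i
  proof -
    have [measurable]: "\<psi> \<in> borel_measurable lborel" "(\<lambda>x. norm (d\<psi> x)) \<in> borel_measurable lborel"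
      using K(6,7) unfolding d\<psi>_def
      by (auto intro!: borel_measurable_continuous_onI continuous_on_norm continuous_on_vec_lambda)
    have int': "integrable lborel (\<lambda>x. (\<bar>\<psi> x\<bar>)\<^sup>2)" using int(1) by simp
    note CS = Cauchy_Schwarz_integral[of "\<lambda>x. \<bar>\<psi> x\<bar>" lborel "\<lambda>x. norm (d\<psi> x)", OF _ _ int' int(2)]
    have i: "integrable lborel (\<lambda>x. 2 * (\<bar>\<psi> x\<bar> * norm (d\<psi> x)))" using CS(1) by simp
    have "(\<integral>\<^sup>+ x. ennreal \<bar>partial i ?p x\<bar> \<partial>lborel) \<le> (\<integral>\<^sup>+ x. ennreal (2 * (\<bar>\<psi> x\<bar> * norm (d\<psi> x))) \<partial>lborel)"
    proof (intro nn_integral_mono ennreal_leI)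
      fix x
      have "\<bar>partial i \<psi> x\<bar> \<le> norm (d\<psi> x)"
        using component_le_norm_cart[of "d\<psi> x" i] by (simp add: d\<psi>_def)
      then have "\<bar>\<psi> x\<bar> * \<bar>partial i \<psi> x\<bar> \<le> \<bar>\<psi> x\<bar> * norm (d\<psi> x)"
        by (intro mult_left_mono) auto
      then show "\<bar>partial i ?p x\<bar> \<le> 2 * (\<bar>\<psi> x\<bar> * norm (d\<psi> x))"
        unfolding part by (simp add: abs_mult)
    qed
    also have "\<dots> = ennreal (LINT x|lborel. 2 * (\<bar>\<psi> x\<bar> * norm (d\<psi> x)))"
      by (rule nn_integral_eq_integral[OF i]) simp
    also have "\<dots> \<le> ennreal (2 * (sqrt a * sqrt b))"
      using CS(2) by (intro ennreal_leI) (simp add: a_def b_def)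
    finally show ?thesis .
  qed
  have p4: "(?p x)\<^sup>2 = \<psi> x ^ 4" for x by simp
  have "(\<integral>\<^sup>+ x. ennreal ((?p x)\<^sup>2) \<partial>lborel) \<le> ennreal (4 * (a + b)\<^sup>2)"
    using card
  proof
    assume "CARD('n) = 1"
    then obtain i where U: "UNIV = {i::'n}" by (metis card_1_singletonE)
    have "(\<integral>\<^sup>+ x. ennreal ((?p x)\<^sup>2) \<partial>lborel)
        \<le> (\<integral>\<^sup>+ x. ennreal \<bar>partial i ?p x\<bar> \<partial>lborel) * (\<integral>\<^sup>+ x. ennreal \<bar>?p x\<bar> \<partial>lborel)"
      by (rule nn_integral_square_le_line[OF U dp cp K(1) z(1)])
    also have "(\<integral>\<^sup>+ x. ennreal \<bar>?p x\<bar> \<partial>lborel) = ennreal a"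
      unfolding a_def using nn_integral_eq_integral[OF int(1)] by simp
    also have "(\<integral>\<^sup>+ x. ennreal \<bar>partial i ?p x\<bar> \<partial>lborel) * ennreal a
        \<le> ennreal (2 * (sqrt a * sqrt b)) * ennreal a"
      by (intro mult_right_mono p_le) auto
    also have "\<dots> = ennreal (2 * (sqrt a * sqrt b) * a)"
      using ab by (simp add: ennreal_mult)
    also have "\<dots> \<le> ennreal (4 * (a + b)\<^sup>2)"
    proof (rule ennreal_leI)
      have "2 * (sqrt a * sqrt b) \<le> a + b"
        using arith_geo_mean_sqrt[OF ab] by (simp add: real_sqrt_mult)
      then have "2 * (sqrt a * sqrt b) * a \<le> (a + b) * (a + b)"
        using ab by (intro mult_mono) auto
      then show "2 * (sqrt a * sqrt b) * a \<le> 4 * (a + b)\<^sup>2"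
        using zero_le_power2[of "a + b"] unfolding power2_eq_square by linarith
    qed
    finally show ?thesis .
  next
    assume "CARD('n) \<in> {2}"
    then obtain i j where U: "UNIV = {i, j::'n}" "i \<noteq> j" by (auto simp: card_2_iff)
    have "(\<integral>\<^sup>+ x. ennreal ((?p x)\<^sup>2) \<partial>lborel)
        \<le> (\<integral>\<^sup>+ x. ennreal \<bar>partial i ?p x\<bar> \<partial>lborel) * (\<integral>\<^sup>+ x. ennreal \<bar>partial j ?p x\<bar> \<partial>lborel)"
      by (rule nn_integral_square_le_plane[OF U dp cp K(1) z(1)])
    also have "\<dots> \<le> ennreal (2 * (sqrt a * sqrt b)) * ennreal (2 * (sqrt a * sqrt b))"
      by (intro mult_mono p_le) auto
    also have "\<dots> = ennreal ((2 * (sqrt a * sqrt b)) * (2 * (sqrt a * sqrt b)))"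
      using ab by (intro ennreal_mult[symmetric]) auto
    also have "\<dots> \<le> ennreal (4 * (a + b)\<^sup>2)"
    proof (rule ennreal_leI)
      have "2 * (sqrt a * sqrt b) \<le> a + b"
        using arith_geo_mean_sqrt[OF ab] by (simp add: real_sqrt_mult)
      then have "(2 * (sqrt a * sqrt b)) * (2 * (sqrt a * sqrt b)) \<le> (a + b) * (a + b)"
        using ab by (intro mult_mono) auto
      then show "(2 * (sqrt a * sqrt b)) * (2 * (sqrt a * sqrt b)) \<le> 4 * (a + b)\<^sup>2"
        using zero_le_power2[of "a + b"] unfolding power2_eq_square by linarith
    qed
    finally show ?thesis .
  qed
  moreover have "integrable lborel (\<lambda>x. \<psi> x ^ 4)"
    by (rule integrable_continuous_compact_support[OF c4 K(1)]) (simp add: K(3))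
  then have "(\<integral>\<^sup>+ x. ennreal (\<psi> x ^ 4) \<partial>lborel) = ennreal (LINT x|lborel. \<psi> x ^ 4)"
    by (rule nn_integral_eq_integral) simp
  ultimately have "(LINT x|lborel. \<psi> x ^ 4) \<le> 4 * (a + b)\<^sup>2"
    using ab by (simp add: p4)
  moreover have "(LINT x|lebesgue_on \<Omega>. \<psi> x ^ 4) = (LINT x|lborel. \<psi> x ^ 4)"
    by (rule integral_lebesgue_on_compact_support[OF \<Omega>(1) c4 K(2)]) (simp add: K(3))
  moreover have "(a + b)\<^sup>2 = H1_norm \<Omega> \<psi> ^ 4"
    unfolding H1[symmetric] by simp
  ultimately show "(LINT x|lebesgue_on \<Omega>. \<psi> x ^ 4) \<le> 4 * H1_norm \<Omega> \<psi> ^ 4" by simp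
qed

text \<open>\<open>u\<close> is only a limit of test functions in H1, so its fourth power is not yet
  known to be integrable. Fatou's lemma gives integrability and the bound together, with the same
  constant.\<close>

lemma H10_L4:
  fixes \<Omega> :: "(real^'n) set"
  assumes card: "CARD('n) \<in> {1, 2}" and \<Omega>: "open \<Omega>" "bounded \<Omega>" and u: "u \<in> carr (H10 \<Omega>)"
  shows "u \<in> Lp_set \<Omega> 4" and "(Lp_norm \<Omega> 4 u) ^ 4 \<le> 4 * H1_norm \<Omega> u ^ 4"
proof -
  let ?M = "lebesgue_on \<Omega>"
  have uW: "u \<in> W1p_set \<Omega> 2" using u by (simp add: H10_def)
  have um [measurable]: "u \<in> borel_measurable ?M" using uW by (simp add: W1p_set_def Lp_set_def)
  have "\<exists>\<psi>. \<psi> \<in> test_functions \<Omega> \<and> H1_norm \<Omega> (u - \<psi>) < inverse (real (Suc n))" for n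
    using u by (simp add: H10_def Bex_def)
  then obtain \<psi> where \<psi>: "\<And>n. \<psi> n \<in> test_functions \<Omega>"
    "\<And>n. H1_norm \<Omega> (u - \<psi> n) < inverse (real (Suc n))" by metis
  have \<psi>W: "\<psi> n \<in> W1p_set \<Omega> 2" for n by (rule test_function_W12[OF \<Omega> \<psi>(1)])
  have dW: "u - \<psi> n \<in> W1p_set \<Omega> 2" for n
    using W12_linear_combination(1)[OF \<Omega>(1) uW \<psi>W, of "-1" n] by simp
  have le: "H1_norm \<Omega> (\<psi> n) \<le> H1_norm \<Omega> u + inverse (real (Suc n))" for n
  proof -
    have "\<psi> n = u + (-1) *\<^sub>R (u - \<psi> n)" by simp
    then have "H1_norm \<Omega> (\<psi> n) \<le> H1_norm \<Omega> u + \<bar>-1\<bar> * H1_norm \<Omega> (u - \<psi> n)"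
      using W12_linear_combination(2)[OF \<Omega>(1) uW dW, of "-1" n] by (simp only:)
    then show ?thesis using \<psi>(2)[of n] by simp
  qed
  have int: "integrable ?M (\<lambda>x. (u x - \<psi> n x)\<^sup>2)" for n
    using dW[of n] by (simp add: W1p_set_def Lp_set_numeral)
  have "(\<lambda>n. (LINT x|?M. norm ((u x - \<psi> n x)\<^sup>2))) \<longlonglongrightarrow> 0"
  proof (rule tendsto_sandwich[where f = "\<lambda>_. 0"])
    show "\<forall>\<^sub>F n in sequentially. (LINT x|?M. norm ((u x - \<psi> n x)\<^sup>2)) \<le> (inverse (real (Suc n)))\<^sup>2"
    proof (intro always_eventually allI)
      fix n
      have "(LINT x|?M. norm ((u x - \<psi> n x)\<^sup>2)) \<le> (H1_norm \<Omega> (u - \<psi> n))\<^sup>2"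
        using H10_grad_bound(2)[of \<Omega> "u - \<psi> n"] by simp
      also have "\<dots> \<le> (inverse (real (Suc n)))\<^sup>2"
        using \<psi>(2)[of n] by (intro power_mono H1_norm_nonneg) simp
      finally show "(LINT x|?M. norm ((u x - \<psi> n x)\<^sup>2)) \<le> (inverse (real (Suc n)))\<^sup>2" .
    qed
    have "(\<lambda>n. (inverse (real (Suc n)))\<^sup>2) \<longlonglongrightarrow> 0\<^sup>2"
      by (intro tendsto_intros LIMSEQ_inverse_real_of_nat)
    then show "(\<lambda>n. (inverse (real (Suc n)))\<^sup>2) \<longlonglongrightarrow> 0" by simp
  qed auto
  \<comment> \<open>The squared differences tend to 0 in L1, so a subsequence does almost
    everywhere, which is the pointwise convergence needed for Fatou.\<close>
  from tendsto_L1_AE_subseq[OF int this] obtain r :: "nat \<Rightarrow> nat" where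
    r: "strict_mono r" "AE x in ?M. (\<lambda>n. (u x - \<psi> (r n) x)\<^sup>2) \<longlonglongrightarrow> 0" by blast
  have ae: "AE x in ?M. ennreal (u x ^ 4) = liminf (\<lambda>n. ennreal (\<psi> (r n) x ^ 4))"
    using r(2)
  proof eventually_elim
    case (elim x)
    then have "(\<lambda>n. \<bar>u x - \<psi> (r n) x\<bar>) \<longlonglongrightarrow> 0"
      using tendsto_real_sqrt[OF elim] by simp
    then have "(\<lambda>n. u x - \<psi> (r n) x) \<longlonglongrightarrow> 0" by (rule tendsto_rabs_zero_cancel)
    then have "(\<lambda>n. u x - (u x - \<psi> (r n) x)) \<longlonglongrightarrow> u x - 0" by (intro tendsto_intros)
    then have "(\<lambda>n. ennreal (\<psi> (r n) x ^ 4)) \<longlonglongrightarrow> ennreal (u x ^ 4)"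
      by (intro tendsto_ennrealI tendsto_power) simp
    then show ?case by (intro lim_imp_Liminf[symmetric]) simp_all
  qed
  have L4: "integrable ?M (\<lambda>x. \<psi> n x ^ 4)" "(LINT x|?M. \<psi> n x ^ 4) \<le> 4 * H1_norm \<Omega> (\<psi> n) ^ 4" for n
    using ladyzhenskaya_test_function[OF card \<Omega> \<psi>(1)] by auto
  have bound: "(\<integral>\<^sup>+ x. ennreal (\<psi> (r n) x ^ 4) \<partial>?M)
      \<le> ennreal (4 * (H1_norm \<Omega> u + inverse (real (Suc (r n)))) ^ 4)" for n
  proof -
    have "(\<integral>\<^sup>+ x. ennreal (\<psi> (r n) x ^ 4) \<partial>?M) = ennreal (LINT x|?M. \<psi> (r n) x ^ 4)"
      by (rule nn_integral_eq_integral[OF L4(1)]) simp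
    also have "\<dots> \<le> ennreal (4 * (H1_norm \<Omega> u + inverse (real (Suc (r n)))) ^ 4)"
    proof (rule ennreal_leI)
      have "H1_norm \<Omega> (\<psi> (r n)) ^ 4 \<le> (H1_norm \<Omega> u + inverse (real (Suc (r n)))) ^ 4"
        by (intro power_mono le H1_norm_nonneg)
      then show "(LINT x|?M. \<psi> (r n) x ^ 4) \<le> 4 * (H1_norm \<Omega> u + inverse (real (Suc (r n)))) ^ 4"
        using L4(2)[of "r n"] by linarith
    qed
    finally show ?thesis .
  qed
  have lim: "(\<lambda>n. ennreal (4 * (H1_norm \<Omega> u + inverse (real (Suc (r n)))) ^ 4))
      \<longlonglongrightarrow> ennreal (4 * H1_norm \<Omega> u ^ 4)"
  proof -
    have "(\<lambda>n. inverse (real (Suc (r n)))) \<longlonglongrightarrow> 0"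
      using LIMSEQ_subseq_LIMSEQ[OF LIMSEQ_inverse_real_of_nat r(1)] by (simp add: o_def)
    then have "(\<lambda>n. ennreal (4 * (H1_norm \<Omega> u + inverse (real (Suc (r n)))) ^ 4))
        \<longlonglongrightarrow> ennreal (4 * (H1_norm \<Omega> u + 0) ^ 4)"
      by (intro tendsto_ennrealI tendsto_intros)
    then show ?thesis by simp
  qed
  have [measurable]: "\<psi> n \<in> borel_measurable ?M" for n
    using \<psi>W[of n] by (simp add: W1p_set_def Lp_set_def)
  have "(\<integral>\<^sup>+ x. ennreal (u x ^ 4) \<partial>?M) = (\<integral>\<^sup>+ x. liminf (\<lambda>n. ennreal (\<psi> (r n) x ^ 4)) \<partial>?M)"
    by (rule nn_integral_cong_AE[OF ae])
  also have "\<dots> \<le> liminf (\<lambda>n. \<integral>\<^sup>+ x. ennreal (\<psi> (r n) x ^ 4) \<partial>?M)"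
    by (rule nn_integral_liminf) measurable
  also have "\<dots> \<le> liminf (\<lambda>n. ennreal (4 * (H1_norm \<Omega> u + inverse (real (Suc (r n)))) ^ 4))"
    by (intro Liminf_mono always_eventually allI bound)
  also have "\<dots> = ennreal (4 * H1_norm \<Omega> u ^ 4)"
    by (rule lim_imp_Liminf[OF _ lim]) simp
  finally have fin: "(\<integral>\<^sup>+ x. ennreal (u x ^ 4) \<partial>?M) \<le> ennreal (4 * H1_norm \<Omega> u ^ 4)" .
  have u4: "integrable ?M (\<lambda>x. u x ^ 4)"
  proof (rule integrableI_bounded)
    show "(\<integral>\<^sup>+ x. ennreal (norm (u x ^ 4)) \<partial>?M) < \<infinity>"
      using fin by (simp add: le_less_trans[OF _ ennreal_less_top])
  qed measurable
  have n4: "norm (u x) ^ 4 = u x ^ 4" for x by simp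
  show "u \<in> Lp_set \<Omega> 4" unfolding Lp_set_numeral n4 using u4 um by simp
  have "ennreal (LINT x|?M. u x ^ 4) \<le> ennreal (4 * H1_norm \<Omega> u ^ 4)"
    using fin nn_integral_eq_integral[OF u4] by simp
  then have "(LINT x|?M. u x ^ 4) \<le> 4 * H1_norm \<Omega> u ^ 4"
    using H1_norm_nonneg[of \<Omega> u] by (subst (asm) ennreal_le_iff) auto
  then show "(Lp_norm \<Omega> 4 u) ^ 4 \<le> 4 * H1_norm \<Omega> u ^ 4"
    unfolding Lp_norm_numeral_power n4 .
qed

section \<open>The two cases of the theorem\<close>

text \<open>\<open>c\<close> = 1 because the H1 norm contains the L2 norm of the gradient, and
  \<open>K\<close> = 1 because the norm of \<open>W10inf\<close> bounds the test gradient almost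
  everywhere.\<close>

lemma weak_grad_superposition_setting:
  fixes \<Omega> :: "(real^'n) set"
  assumes \<Omega>: "open \<Omega>" "bounded \<Omega>" and "\<phi> \<in> borel_measurable (lebesgue_on \<Omega>)"
    and "0 < \<nu>" "AE x in lebesgue_on \<Omega>. \<nu> \<le> \<phi> x"
  shows "superposition_setting \<Omega> \<phi> \<nu> 1 1 1 (weak_grad \<Omega>) (H10 \<Omega>) (W10inf \<Omega>)"
proof -
  let ?M = "lebesgue_on \<Omega>"
  have lm: "\<Omega> \<in> lmeasurable" using \<Omega> by (simp add: lmeasurable_open)
  have W: "v \<in> W1p_set \<Omega> 2" if "v \<in> carr (H10 \<Omega>)" for v using that by (simp add: H10_def)
  have nH: "nrm (H10 \<Omega>) = H1_norm \<Omega>" by (simp add: H10_def)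
  have nW: "nrm (W10inf \<Omega>) u = Lp_norm \<Omega> \<infinity> u + Lp_norm \<Omega> \<infinity> (weak_grad \<Omega> u)" for u
    by (simp add: W10inf_def)
  have lin: "AE x in ?M. weak_grad \<Omega> (v + c *\<^sub>R w) x = weak_grad \<Omega> v x + c *\<^sub>R weak_grad \<Omega> w x"
    if "v \<in> carr (H10 \<Omega>)" "w \<in> carr (H10 \<Omega>)" for v w c
    using W1p_weak_grad(1)[OF \<Omega>(1) W] that by (intro weak_grad_linear_combination \<Omega>) auto
  have zero: "0 \<in> carr (H10 \<Omega>)" by (rule subspace_0[OF H10_subspace[OF \<Omega>]])
  \<comment> \<open>Homogeneity is obtained from the combination 0 + r v, so the gradient chosen for
    0 has to vanish almost everywhere.\<close>
  have lin0: "AE x in ?M. weak_grad \<Omega> 0 x = 0"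
    using lin[OF zero zero, of "-1"] by eventually_elim simp
  show ?thesis
  proof
    show "subspace (carr (H10 \<Omega>))" "subspace (carr (W10inf \<Omega>))"
      using H10_subspace[OF \<Omega>] W10inf_subspace[OF \<Omega>] by auto
    show "carr (W10inf \<Omega>) \<subseteq> carr (H10 \<Omega>)" by (auto simp: W10inf_def)
    show "0 \<le> nrm (H10 \<Omega>) v" for v by (simp add: nH H1_norm_nonneg)
    show "nrm (W10inf \<Omega>) 0 = 0"
    proof -
      have z: "Lp_norm \<Omega> \<infinity> f = 0" if "AE x in ?M. f x = 0" "f \<in> borel_measurable ?M"
        for f :: "real^'n \<Rightarrow> 'c::euclidean_space"
      proof -
        have "esssup ?M (\<lambda>x. ennreal (norm (f x))) \<le> 0"
          using that by (intro esssup_I) auto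
        then show ?thesis by (simp add: Lp_norm_def)
      qed
      have "weak_grad \<Omega> 0 \<in> borel_measurable ?M"
        using W1p_weak_grad(2)[OF \<Omega>(1) W[OF zero]] by (simp add: Lp_set_def)
      then show ?thesis using z[OF lin0] z[of "0 :: real^'n \<Rightarrow> real"]
        by (simp add: nW zero_fun_def)
    qed
    fix v assume v: "v \<in> carr (H10 \<Omega>)"
    note wg = W1p_weak_grad(2)[OF \<Omega>(1) W[OF v]]
    show "weak_grad \<Omega> v \<in> borel_measurable ?M" using wg by (simp add: Lp_set_def)
    show "AE x in ?M. weak_grad \<Omega> (v + w) x = weak_grad \<Omega> v x + weak_grad \<Omega> w x"
      if "w \<in> carr (H10 \<Omega>)" for w
      using lin[OF v that, of 1] by simp
    show "AE x in ?M. weak_grad \<Omega> (r *\<^sub>R v) x = r *\<^sub>R weak_grad \<Omega> v x" for r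
      using lin[OF zero v, of r] lin0 by (simp, eventually_elim) simp
    show "integrable ?M (\<lambda>x. norm (weak_grad \<Omega> v x) ^ (2 * 1))"
      using wg by (simp add: Lp_set_numeral)
    show "(LINT x|?M. norm (weak_grad \<Omega> v x) ^ (2 * 1)) \<le> (1 * nrm (H10 \<Omega>) v) ^ (2 * 1)"
      using H10_grad_bound(1)[of \<Omega> v] by (simp add: nH)
  next
    fix w g assume w: "w \<in> carr (W10inf \<Omega>)" and g [measurable]: "g \<in> borel_measurable ?M"
      and gi: "integrable ?M (\<lambda>x. norm (g x :: real^'n) ^ 1)"
    have wg: "weak_grad \<Omega> w \<in> Lp_set \<Omega> \<infinity>"
      using w by (intro W1p_weak_grad(2)[OF \<Omega>(1)]) (simp add: W10inf_def)
    then have [measurable]: "weak_grad \<Omega> w \<in> borel_measurable ?M" by (simp add: Lp_set_def)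
    have bd: "AE x in ?M. norm (g x \<bullet> weak_grad \<Omega> w x) \<le> norm (g x) * nrm (W10inf \<Omega>) w"
      using AE_le_Lp_norm_infinity[OF wg]
    proof eventually_elim
      case (elim x)
      then have "norm (weak_grad \<Omega> w x) \<le> nrm (W10inf \<Omega>) w"
        using Lp_norm_nonneg[of \<Omega> \<infinity> w] by (simp add: nW)
      then have "norm (g x) * norm (weak_grad \<Omega> w x) \<le> norm (g x) * nrm (W10inf \<Omega>) w"
        by (intro mult_left_mono) auto
      then show ?case using Cauchy_Schwarz_ineq2[of "g x" "weak_grad \<Omega> w x"] by simp
    qed
    have gi': "integrable ?M (\<lambda>x. norm (g x) * nrm (W10inf \<Omega>) w)" using gi by simp
    show i: "integrable ?M (\<lambda>x. g x \<bullet> weak_grad \<Omega> w x)"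
    proof (rule Bochner_Integration.integrable_bound[OF gi'])
      show "AE x in ?M. norm (g x \<bullet> weak_grad \<Omega> w x) \<le> norm (norm (g x) * nrm (W10inf \<Omega>) w)"
        using bd by eventually_elim simp
    qed measurable
    have "\<bar>LINT x|?M. g x \<bullet> weak_grad \<Omega> w x\<bar> \<le> (LINT x|?M. norm (g x \<bullet> weak_grad \<Omega> w x))"
      using integral_norm_bound[of ?M "\<lambda>x. g x \<bullet> weak_grad \<Omega> w x"] by simp
    also have "\<dots> \<le> (LINT x|?M. norm (g x) * nrm (W10inf \<Omega>) w)"
      using i gi' bd by (intro integral_mono_AE) auto
    finally show "\<bar>LINT x|?M. g x \<bullet> weak_grad \<Omega> w x\<bar>
        \<le> 1 * root 1 (LINT x|?M. norm (g x) ^ 1) * nrm (W10inf \<Omega>) w"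
      by simp
  qed (use assms lm in auto)
qed

text \<open>The L4 bound of \<open>D\<close>, composed with the L4 embedding, yields
  \<open>c\<close>; its L2 bound controls the test direction in the Cauchy-Schwarz pairing and
  yields \<open>K\<close>.\<close>

lemma Lp_bounded_operator_superposition_setting:
  fixes \<Omega> :: "(real^'n) set"
  assumes card: "CARD('n) \<in> {1, 2}" and \<Omega>: "open \<Omega>" "bounded \<Omega>"
    and "\<phi> \<in> borel_measurable (lebesgue_on \<Omega>)"
    and "0 < \<nu>" "AE x in lebesgue_on \<Omega>. \<nu> \<le> \<phi> x"
    and D2: "Lp_bounded_operator \<Omega> 2 D" and D4: "Lp_bounded_operator \<Omega> 4 D"
  obtains c K where "superposition_setting \<Omega> \<phi> \<nu> c K 2 D (H10 \<Omega>) (H10 \<Omega>)"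
proof -
  let ?M = "lebesgue_on \<Omega>"
  have lm: "\<Omega> \<in> lmeasurable" using \<Omega> by (simp add: lmeasurable_open)
  have nH: "nrm (H10 \<Omega>) = H1_norm \<Omega>" by (simp add: H10_def)
  have L2: "v \<in> Lp_set \<Omega> 2" if "v \<in> carr (H10 \<Omega>)" for v using that by (simp add: H10_def W1p_set_def)
  note L4 = H10_L4[OF card \<Omega>]
  obtain C2 where C2: "\<And>u. u \<in> Lp_set \<Omega> 2 \<Longrightarrow> Lp_norm \<Omega> 2 (D u) \<le> C2 * Lp_norm \<Omega> 2 u"
    using D2 unfolding Lp_bounded_operator_def by blast
  obtain C4 where C4: "\<And>u. u \<in> Lp_set \<Omega> 4 \<Longrightarrow> Lp_norm \<Omega> 4 (D u) \<le> C4 * Lp_norm \<Omega> 4 u"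
    using D4 unfolding Lp_bounded_operator_def by blast
  \<comment> \<open>The fourth root of 4 absorbs the constant of the L4 embedding. The absolute
    values are taken because the constants in \<open>Lp_bounded_operator\<close> carry no
    sign.\<close>
  define c K where "c = \<bar>C4\<bar> * root 4 4" and "K = \<bar>C2\<bar>"
  have c: "0 \<le> c" "c ^ 4 = 4 * \<bar>C4\<bar> ^ 4" by (simp_all add: c_def power_mult_distrib)
  have D_2: "D v \<in> Lp_set \<Omega> 2" if "v \<in> carr (H10 \<Omega>)" for v
    using D2 L2[OF that] by (auto simp: Lp_bounded_operator_def)
  have D_4: "D v \<in> Lp_set \<Omega> 4" if "v \<in> carr (H10 \<Omega>)" for v
    using D4 L4(1)[OF that] by (auto simp: Lp_bounded_operator_def)
  have D_2_le: "Lp_norm \<Omega> 2 (D v) \<le> K * H1_norm \<Omega> v" if "v \<in> carr (H10 \<Omega>)" for v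
  proof -
    have "Lp_norm \<Omega> 2 (D v) \<le> C2 * Lp_norm \<Omega> 2 v" by (rule C2[OF L2[OF that]])
    also have "\<dots> \<le> K * Lp_norm \<Omega> 2 v"
      unfolding K_def by (intro mult_right_mono Lp_norm_nonneg) simp
    also have "\<dots> \<le> K * H1_norm \<Omega> v"
      unfolding K_def H1_norm_def by (intro mult_left_mono real_le_rsqrt) auto
    finally show ?thesis .
  qed
  have "superposition_setting \<Omega> \<phi> \<nu> c K 2 D (H10 \<Omega>) (H10 \<Omega>)"
  proof
    show "subspace (carr (H10 \<Omega>))" by (rule H10_subspace[OF \<Omega>])
    show "0 \<le> nrm (H10 \<Omega>) v" for v by (simp add: nH H1_norm_nonneg)
    show "nrm (H10 \<Omega>) 0 = 0" by (simp add: nH H1_norm_0[OF \<Omega>])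
    fix v assume v: "v \<in> carr (H10 \<Omega>)"
    show "D v \<in> borel_measurable ?M" using D_2[OF v] by (simp add: Lp_set_def)
    show "AE x in ?M. D (v + w) x = D v x + D w x" if "w \<in> carr (H10 \<Omega>)" for w
      using D2 L2[OF v] L2[OF that] unfolding Lp_bounded_operator_def by blast
    show "AE x in ?M. D (r *\<^sub>R v) x = r *\<^sub>R D v x" for r
      using D2 L2[OF v] unfolding Lp_bounded_operator_def by blast
    show "integrable ?M (\<lambda>x. norm (D v x) ^ (2 * 2))"
      using D_4[OF v] by (simp add: Lp_set_numeral)
    have "(LINT x|?M. norm (D v x) ^ 4) = Lp_norm \<Omega> 4 (D v) ^ 4"
      by (simp add: Lp_norm_numeral_power)
    also have "\<dots> \<le> (\<bar>C4\<bar> * Lp_norm \<Omega> 4 v) ^ 4"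
    proof (rule power_mono[OF _ Lp_norm_nonneg])
      have "Lp_norm \<Omega> 4 (D v) \<le> C4 * Lp_norm \<Omega> 4 v" by (rule C4[OF L4(1)[OF v]])
      also have "\<dots> \<le> \<bar>C4\<bar> * Lp_norm \<Omega> 4 v" by (intro mult_right_mono Lp_norm_nonneg) simp
      finally show "Lp_norm \<Omega> 4 (D v) \<le> \<bar>C4\<bar> * Lp_norm \<Omega> 4 v" .
    qed
    also have "\<dots> \<le> \<bar>C4\<bar> ^ 4 * (4 * H1_norm \<Omega> v ^ 4)"
      unfolding power_mult_distrib by (intro mult_left_mono L4(2) v) simp
    also have "\<dots> = (c * H1_norm \<Omega> v) ^ 4" by (simp only: power_mult_distrib c(2) mult_ac)
    finally show "(LINT x|?M. norm (D v x) ^ (2 * 2)) \<le> (c * nrm (H10 \<Omega>) v) ^ (2 * 2)"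
      by (simp add: nH)
  next
    fix w g assume w: "w \<in> carr (H10 \<Omega>)" and g [measurable]: "g \<in> borel_measurable ?M"
      and gi: "integrable ?M (\<lambda>x. norm (g x :: real^'n) ^ 2)"
    have [measurable]: "D w \<in> borel_measurable ?M" and Di: "integrable ?M (\<lambda>x. (norm (D w x))\<^sup>2)"
      using D_2[OF w] by (simp_all add: Lp_set_numeral)
    note CS = Cauchy_Schwarz_integral[of "\<lambda>x. norm (g x)" ?M "\<lambda>x. norm (D w x)", OF _ _ gi Di]
    have CS1: "integrable ?M (\<lambda>x. norm (g x) * norm (D w x))" using CS(1) by simp
    show i: "integrable ?M (\<lambda>x. g x \<bullet> D w x)"
      by (rule Bochner_Integration.integrable_bound[OF CS1])
        (auto intro!: AE_I2 simp: Cauchy_Schwarz_ineq2)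
    have "\<bar>LINT x|?M. g x \<bullet> D w x\<bar> \<le> (LINT x|?M. norm (g x \<bullet> D w x))"
      using integral_norm_bound[of ?M "\<lambda>x. g x \<bullet> D w x"] by simp
    also have "\<dots> \<le> (LINT x|?M. norm (g x) * norm (D w x))"
      using i CS1 by (intro integral_mono) (auto simp: Cauchy_Schwarz_ineq2)
    also have "\<dots> \<le> sqrt (LINT x|?M. (norm (g x))\<^sup>2) * Lp_norm \<Omega> 2 (D w)"
      using CS(2) by (simp add: Lp_norm_2)
    also have "\<dots> \<le> sqrt (LINT x|?M. (norm (g x))\<^sup>2) * (K * H1_norm \<Omega> w)"
      by (intro mult_left_mono D_2_le w) simp
    finally show "\<bar>LINT x|?M. g x \<bullet> D w x\<bar>
        \<le> K * root 2 (LINT x|?M. norm (g x) ^ 2) * nrm (H10 \<Omega>) w"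
      by (simp add: nH sqrt_def mult_ac)
  qed (use assms lm c in \<open>auto simp: K_def\<close>)
  then show ?thesis by (rule that)
qed

theorem lemma4:
  fixes \<Omega> :: "(real^'n) set"
    and \<phi> :: "real^'n \<Rightarrow> real"
    and \<nu> :: real
    and D\<^sub>\<mu> :: "(real^'n \<Rightarrow> real) \<Rightarrow> real^'n \<Rightarrow> real^'n"
  assumes "CARD('n) \<in> {1, 2}"
    and "open \<Omega>" and "bounded \<Omega>"
    and "\<phi> \<in> borel_measurable (lebesgue_on \<Omega>)"
    and "\<nu> > 0" and "AE x in lebesgue_on \<Omega>. \<phi> x \<ge> \<nu>"
    and "\<forall>p\<ge>1. Lp_bounded_operator \<Omega> p D\<^sub>\<mu>"
  shows "(\<forall>u\<in>carr (H10 \<Omega>).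
        newton_differentiable_at (H10 \<Omega>) (dual_space (W10inf \<Omega>)) (carr (H10 \<Omega>))
          (P_op \<Omega> \<phi> (weak_grad \<Omega>) (W10inf \<Omega>)) u) \<and>
    has_newton_derivative (H10 \<Omega>) (dual_space (W10inf \<Omega>)) (carr (H10 \<Omega>))
      (P_op \<Omega> \<phi> (weak_grad \<Omega>) (W10inf \<Omega>)) (G_op \<Omega> \<phi> (weak_grad \<Omega>) (W10inf \<Omega>)) \<and>
    (\<forall>u\<in>carr (H10 \<Omega>).
        newton_differentiable_at (H10 \<Omega>) (dual_space (H10 \<Omega>)) (carr (H10 \<Omega>))
          (P_op \<Omega> \<phi> D\<^sub>\<mu> (H10 \<Omega>)) u) \<and>
    has_newton_derivative (H10 \<Omega>) (dual_space (H10 \<Omega>)) (carr (H10 \<Omega>))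
      (P_op \<Omega> \<phi> D\<^sub>\<mu> (H10 \<Omega>)) (G_op \<Omega> \<phi> D\<^sub>\<mu> (H10 \<Omega>))"
proof -
  have 1: "has_newton_derivative (H10 \<Omega>) (dual_space (W10inf \<Omega>)) (carr (H10 \<Omega>))
      (P_op \<Omega> \<phi> (weak_grad \<Omega>) (W10inf \<Omega>)) (G_op \<Omega> \<phi> (weak_grad \<Omega>) (W10inf \<Omega>))"
    using weak_grad_superposition_setting[OF assms(2-6)]
    by (rule superposition_setting.has_newton_derivative_P_op)
  have D: "Lp_bounded_operator \<Omega> 2 D\<^sub>\<mu>" "Lp_bounded_operator \<Omega> 4 D\<^sub>\<mu>"
    using assms(7) by simp_all
  obtain c K where "superposition_setting \<Omega> \<phi> \<nu> c K 2 D\<^sub>\<mu> (H10 \<Omega>) (H10 \<Omega>)"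
    using Lp_bounded_operator_superposition_setting[OF assms(1-6) D] .
  then have 2: "has_newton_derivative (H10 \<Omega>) (dual_space (H10 \<Omega>)) (carr (H10 \<Omega>))
      (P_op \<Omega> \<phi> D\<^sub>\<mu> (H10 \<Omega>)) (G_op \<Omega> \<phi> D\<^sub>\<mu> (H10 \<Omega>))"
    by (rule superposition_setting.has_newton_derivative_P_op)
  show ?thesis
    using 1 2 has_newton_derivative_imp_differentiable_at[OF 1]
      has_newton_derivative_imp_differentiable_at[OF 2] by blast
qed

end
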